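(* Let $X$ be a complete metric space and $p\ge1$. Then $P_p(X)$ is the free complete Wasserstein algebra of order $p$ over $X$, with universal arrow the Dirac map $\delta:X\to P_p(X)$. That is, $P_p(X)$ is a Wasserstein algebra of order $p$ whose underlying metric space is complete, $\delta$ is nonexpansive, and for every Wasserstein algebra $B$ of order $p$ whose underlying metric space is complete and every nonexpansive map $f:X\to B$ there is a unique nonexpansive affine map $\overline{f}:P_p(X)\to B$ with $\overline{f}\circ\delta=f$.
   Context: All measures are Borel. $P_p(X)$ is the set of Radon probability measures $\mu$ on $X$ (every Borel $B$ satisfies $\mu(B)=\sup\{\mu(K)\mid K\subseteq B\text{ compact}\}$) with finite moment of order $p$ ($\int d(x_0,-)^p\,\mathrm{d}\mu<\infty$ for some, equivalently all, $x_0\in X$), with metric $\mathrm{W}_p(\mu,\nu)=\left(\inf_\gamma\int d_X^p\,\mathrm{d}\gamma\right)^{1/p}$ (infimum over couplings $\gamma$, i.e.\ probability measures on $X\times X$ with marginals $\mu,\nu$) and operations $(\mu+_r\nu)(B)=r\mu(B)+(1-r)\nu(B)$, $r\in[0,1]$. A barycentric algebra is a set with binary operations $+_r$ ($r\in[0,1]$) satisfying $x+_1y=x$, $x+_rx=x$, $x+_ry=y+_{1-r}x$, and $(x+_py)+_rz=x+_{pr}(y+_{\frac{r-pr}{1-pr}}z)$ for $r<1,p<1$; affine maps are maps preserving all $+_r$. A Wasserstein algebra of order $p$ is a metric space with nonexpansive operations $+_r:X\times X\to X$ (max metric on the product) forming a barycentric algebra and satisfying $d(x+_ry,x'+_ry')^p\le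 r\,d(x,x')^p+(1-r)\,d(y,y')^p$ for all $x,x',y,y'$. *)

theory Defs
  imports "HOL-Probability.Probability"
begin

locale barycentric_algebra =
  fixes A :: "'a set" and mix :: "real \<Rightarrow> 'a \<Rightarrow> 'a \<Rightarrow> 'a"
  assumes mix_closed: "\<lbrakk>0 \<le> r; r \<le> 1; x \<in> A; y \<in> A\<rbrakk> \<Longrightarrow> mix r x y \<in> A"
    and mix_one: "\<lbrakk>x \<in> A; y \<in> A\<rbrakk> \<Longrightarrow> mix 1 x y = x"
    and mix_idem: "\<lbrakk>0 \<le> r; r \<le> 1; x \<in> A\<rbrakk> \<Longrightarrow> mix r x x = x"
    and mix_commute: "\<lbrakk>0 \<le> r; r \<le> 1; x \<in> A; y \<in> A\<rbrakk> \<Longrightarrow> mix r x y = mix (1 - r) y x"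
    and mix_assoc: "\<lbrakk>0 \<le> q; q < 1; 0 \<le> r; r < 1; x \<in> A; y \<in> A; z \<in> A\<rbrakk> \<Longrightarrow>
      mix r (mix q x y) z = mix (q * r) x (mix ((r - q * r) / (1 - q * r)) y z)"

definition affine_map_on ::
  "'a set \<Rightarrow> (real \<Rightarrow> 'a \<Rightarrow> 'a \<Rightarrow> 'a) \<Rightarrow> (real \<Rightarrow> 'b \<Rightarrow> 'b \<Rightarrow> 'b) \<Rightarrow> ('a \<Rightarrow> 'b) \<Rightarrow> bool" where
  "affine_map_on A mixA mixB f \<longleftrightarrow>
    (\<forall>r\<in>{0..1}. \<forall>x\<in>A. \<forall>y\<in>A. f (mixA r x y) = mixB r (f x) (f y))"

definition nonexpansive_map ::
  "'a set \<Rightarrow> ('a \<Rightarrow> 'a \<Rightarrow> real) \<Rightarrow> 'b set \<Rightarrow> ('b \<Rightarrow> 'b \<Rightarrow> real) \<Rightarrow> ('a \<Rightarrow> 'b) \<Rightarrow> bool" where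
  "nonexpansive_map A dA B dB f \<longleftrightarrow>
    f \<in> A \<rightarrow> B \<and> (\<forall>x\<in>A. \<forall>y\<in>A. dB (f x) (f y) \<le> dA x y)"

locale Wasserstein_algebra = Metric_space A d + barycentric_algebra A mix
  for p :: real
    and A :: "'a set"
    and d :: "'a \<Rightarrow> 'a \<Rightarrow> real"
    and mix :: "real \<Rightarrow> 'a \<Rightarrow> 'a \<Rightarrow> 'a" +
  assumes mix_nonexpansive:
      "\<lbrakk>0 \<le> r; r \<le> 1; x \<in> A; y \<in> A; x' \<in> A; y' \<in> A\<rbrakk> \<Longrightarrow>
        d (mix r x y) (mix r x' y') \<le> max (d x x') (d y y')"
    and mix_powr_le:
      "\<lbrakk>0 \<le> r; r \<le> 1; x \<in> A; y \<in> A; x' \<in> A; y' \<in> A\<rbrakk> \<Longrightarrow>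
        d (mix r x y) (mix r x' y') powr p \<le> r * d x x' powr p + (1 - r) * d y y' powr p"

locale complete_Wasserstein_algebra = Wasserstein_algebra +
  assumes complete: "mcomplete"

definition borel_of :: "'a topology \<Rightarrow> 'a measure" where
  "borel_of X = sigma (topspace X) {U. openin X U}"

definition Radon_measure_on :: "'a topology \<Rightarrow> 'a measure \<Rightarrow> bool" where
  "Radon_measure_on X \<mu> \<longleftrightarrow> sets \<mu> = sets (borel_of X) \<and>
    (\<forall>B\<in>sets \<mu>. emeasure \<mu> B = (SUP K\<in>{K. compactin X K \<and> K \<subseteq> B}. emeasure \<mu> K))"

definition mix_measure :: "real \<Rightarrow> 'a measure \<Rightarrow> 'a measure \<Rightarrow> 'a measure" where
  "mix_measure r \<mu> \<nu> = measure_of (space \<mu>) (sets \<mu>)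
    (\<lambda>B. ennreal r * emeasure \<mu> B + ennreal (1 - r) * emeasure \<nu> B)"

(* Couplings live on the Borel sigma-algebra of the product topology. For non-separable X
   this can be strictly larger than the product of the Borel sigma-algebras of the factors,
   and the distance function need not be measurable with respect to the latter. *)
definition couplings :: "'a topology \<Rightarrow> 'a measure \<Rightarrow> 'a measure \<Rightarrow> ('a \<times> 'a) measure set" where
  "couplings X \<mu> \<nu> = {\<gamma>. prob_space \<gamma> \<and> sets \<gamma> = sets (borel_of (prod_topology X X)) \<and>
    distr \<gamma> (borel_of X) fst = \<mu> \<and> distr \<gamma> (borel_of X) snd = \<nu>}"

context Metric_space
begin

definition Wasserstein_space :: "real \<Rightarrow> 'a measure set" where
  "Wasserstein_space p = {\<mu>. prob_space \<mu> \<and> Radon_measure_on mtopology \<mu> \<and>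
    (\<exists>x0\<in>M. (\<integral>\<^sup>+x. ennreal (d x0 x powr p) \<partial>\<mu>) < \<infinity>)}"

(* The infimum is taken in ennreal and is finite for measures in Wasserstein_space p. *)
definition Wasserstein_dist :: "real \<Rightarrow> 'a measure \<Rightarrow> 'a measure \<Rightarrow> real" where
  "Wasserstein_dist p \<mu> \<nu> =
    enn2real (INF \<gamma>\<in>couplings mtopology \<mu> \<nu>. \<integral>\<^sup>+z. ennreal (d (fst z) (snd z) powr p) \<partial>\<gamma>)
      powr (1 / p)"

definition dirac :: "'a \<Rightarrow> 'a measure" where
  "dirac x = return (borel_of mtopology) x"

end

end

theory Submission
  imports Defs
begin

text \<open>A Radon probability measure on a complete metric space is the same as a Borel probability
  measure carried by the closure of a countable set; this makes products and pairings Borel without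
  assuming separability. The triangle inequality needs no disintegration: two couplings are glued
  along a countable partition of the middle space into pieces of diameter at most \<open>e\<close>, at the
  price of an error \<open>e\<close>. Finitely supported measures are dense, and a rapidly Cauchy sequence of
  them is realised by simple random variables on \<open>[0, 1]\<close> that converge almost surely and in
  \<open>L^p\<close>, which gives completeness. On a finitely supported measure the extension of \<open>f\<close> is the
  convex combination of the values of \<open>f\<close>; splitting both combinations along a coupling shows
  that it is nonexpansive, so it extends uniquely by density.\<close>

section \<open>Borel measures and couplings\<close>

text \<open>Measurability shapes the proof. Couplings live on the Borel sets of the product
  topology, while product measures and pairs of Borel maps are a priori measurable only for the
  product sigma-algebra, which can be smaller. So no product coupling is used: finiteness of the
  distance comes from gluing through a Dirac measure, and in a gluing the two outer coordinates are
  paired only after the first has been moved into the closure of a countable set. Conditioning on a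
  cell of positive mass is an elementary density, which is why a countable partition can replace
  conditional measures; the error disappears because the distance is an infimum. The unit interval
  serves because it has no atoms: each level set of a simple random variable can be cut into pieces
  of prescribed masses, so the variable extends to a pair whose law is any given coupling with a
  finitely supported measure. For convex combinations the nuisance is normalisation; keeping the
  total weight as a coordinate lets inductions run over partial sums.\<close>

lemma space_borel_of [simp]: "space (borel_of X) = topspace X"
  unfolding borel_of_def by (rule space_measure_of) (auto dest: openin_subset)

lemma sets_borel_of: "sets (borel_of X) = sigma_sets (topspace X) {U. openin X U}"
  unfolding borel_of_def by (rule sets_measure_of) (auto dest: openin_subset)

lemma borel_of_openin [measurable]: "openin X U \<Longrightarrow> U \<in> sets (borel_of X)"
  by (auto simp: sets_borel_of)

lemma borel_of_closedin: "closedin X C \<Longrightarrow> C \<in> sets (borel_of X)"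
proof -
  assume C: "closedin X C"
  then have "topspace X - (topspace X - C) \<in> sets (borel_of X)"
    by (metis borel_of_openin closedin_def sets.compl_sets space_borel_of)
  then show ?thesis
    using C by (simp add: closedin_def double_diff)
qed

lemma measurable_borel_ofI:
  assumes "f \<in> space N \<rightarrow> topspace X"
    and "\<And>U. openin X U \<Longrightarrow> f -` U \<inter> space N \<in> sets N"
  shows "f \<in> N \<rightarrow>\<^sub>M borel_of X"
  unfolding borel_of_def
  by (rule measurable_measure_of) (use assms in \<open>auto dest: openin_subset\<close>)

lemma continuous_map_borel_of:
  assumes "continuous_map X Y f"
  shows "f \<in> borel_of X \<rightarrow>\<^sub>M borel_of Y"
proof (rule measurable_borel_ofI)
  show "f \<in> space (borel_of X) \<rightarrow> topspace Y"
    using assms by (simp add: continuous_map_def)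
next
  fix U assume "openin Y U"
  then have "openin X {x \<in> topspace X. f x \<in> U}"
    using assms by (simp add: continuous_map_def)
  moreover have "f -` U \<inter> space (borel_of X) = {x \<in> topspace X. f x \<in> U}" by auto
  ultimately show "f -` U \<inter> space (borel_of X) \<in> sets (borel_of X)"
    by simp
qed

lemma continuous_map_euclidean_borel_of:
  assumes "continuous_map X euclidean f"
  shows "f \<in> borel_measurable (borel_of X)"
proof (rule borel_measurableI)
  fix S :: "'b set" assume "open S"
  then have "openin X {x \<in> topspace X. f x \<in> S}"
    using assms by (simp add: continuous_map_def)
  moreover have "f -` S \<inter> space (borel_of X) = {x \<in> topspace X. f x \<in> S}" by auto
  ultimately show "f -` S \<inter> space (borel_of X) \<in> sets (borel_of X)"
    by simp
qed

lemma borel_of_measure_eqI: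
  assumes "prob_space \<mu>" "prob_space \<nu>" "sets \<mu> = sets (borel_of X)" "sets \<nu> = sets (borel_of X)"
    and "\<And>U. openin X U \<Longrightarrow> emeasure \<mu> U = emeasure \<nu> U"
  shows "\<mu> = \<nu>"
proof (rule measure_eqI_generator_eq[where E = "{U. openin X U}" and \<Omega> = "topspace X" and A = "\<lambda>_. topspace X"])
  interpret prob_space \<mu> by fact
  show "Int_stable {U. openin X U}" by (auto simp: Int_stable_def)
  show "{U. openin X U} \<subseteq> Pow (topspace X)" by (auto dest: openin_subset)
  show "emeasure \<mu> (topspace X) \<noteq> \<infinity>" for i :: nat by simp
qed (use assms in \<open>auto simp: sets_borel_of\<close>)

context Metric_space
begin

abbreviation Borel :: "'a measure" where "Borel \<equiv> borel_of mtopology"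
abbreviation Borel2 :: "('a \<times> 'a) measure" where "Borel2 \<equiv> borel_of (prod_topology mtopology mtopology)"

lemma measurable_fst_Borel2 [measurable]: "fst \<in> Borel2 \<rightarrow>\<^sub>M Borel"
  and measurable_snd_Borel2 [measurable]: "snd \<in> Borel2 \<rightarrow>\<^sub>M Borel"
  by (auto intro!: continuous_map_borel_of continuous_map_fst continuous_map_snd)

lemma continuous_map_dist:
  "continuous_map (prod_topology mtopology mtopology) euclidean (\<lambda>z. d (fst z) (snd z))"
  unfolding continuous_map_def
proof (intro conjI allI impI)
  fix U :: "real set" assume U: "openin euclidean U"
  show "openin (prod_topology mtopology mtopology)
          {z \<in> topspace (prod_topology mtopology mtopology). d (fst z) (snd z) \<in> U}"
    unfolding openin_prod_topology_alt
  proof (intro allI impI)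
    fix x y assume "(x, y) \<in> {z \<in> topspace (prod_topology mtopology mtopology). d (fst z) (snd z) \<in> U}"
    then have xy: "x \<in> M" "y \<in> M" "d x y \<in> U" by auto
    then obtain e where e: "e > 0" "\<And>t. \<bar>t - d x y\<bar> < e \<Longrightarrow> t \<in> U"
      using U by (metis dist_real_def open_dist open_openin)
    have "mball x (e/2) \<times> mball y (e/2)
          \<subseteq> {z \<in> topspace (prod_topology mtopology mtopology). d (fst z) (snd z) \<in> U}"
    proof (rule subsetI)
      fix z assume z: "z \<in> mball x (e/2) \<times> mball y (e/2)"
      define a b where "a = fst z" and "b = snd z"
      have ab: "a \<in> M" "b \<in> M" "d x a < e / 2" "d y b < e / 2"
        using z by (auto simp: a_def b_def)
      have "d a b \<le> d x a + d x y + d y b" "d x y \<le> d x a + d a b + d y b"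
        using triangle''[of a x b] triangle[of x y b] triangle[of x a y] triangle'[of a b y] ab xy
        by auto
      then have "d a b \<in> U" using ab by (intro e) (auto simp: abs_less_iff)
      then show "z \<in> {z \<in> topspace (prod_topology mtopology mtopology). d (fst z) (snd z) \<in> U}"
        using z by (auto simp: a_def b_def)
    qed
    then show "\<exists>U' V. openin mtopology U' \<and> openin mtopology V \<and> x \<in> U' \<and> y \<in> V \<and>
       U' \<times> V \<subseteq> {z \<in> topspace (prod_topology mtopology mtopology). d (fst z) (snd z) \<in> U}"
      using xy e by (intro exI[of _ "mball x (e/2)"] exI[of _ "mball y (e/2)"]) auto
  qed
qed auto

lemma measurable_dist_Borel2 [measurable]: "(\<lambda>z. d (fst z) (snd z)) \<in> borel_measurable Borel2"
  by (rule continuous_map_euclidean_borel_of continuous_map_dist)+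

lemma measurable_dist_left [measurable]: "a \<in> M \<Longrightarrow> d a \<in> borel_measurable Borel"
proof -
  assume a: "a \<in> M"
  have "continuous_map mtopology (prod_topology mtopology mtopology) (\<lambda>x. (a, x))"
    using a by (simp add: continuous_map_pairwise comp_def)
  from continuous_map_compose[OF this continuous_map_dist] show ?thesis
    by (intro continuous_map_euclidean_borel_of) (simp add: comp_def)
qed

text \<open>Without separability the pairing of two Borel maps need not be Borel for the product
  topology, hence the assumption on \<open>f\<close>.\<close>

lemma measurable_Pair_Borel2:
  assumes f: "f \<in> N \<rightarrow>\<^sub>M Borel" and g: "g \<in> N \<rightarrow>\<^sub>M Borel"
    and Q: "countable Q" and fQ: "\<And>x. x \<in> space N \<Longrightarrow> f x \<in> mtopology closure_of Q"
  shows "(\<lambda>x. (f x, g x)) \<in> N \<rightarrow>\<^sub>M Borel2"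
proof (rule measurable_borel_ofI)
  show "(\<lambda>x. (f x, g x)) \<in> space N \<rightarrow> topspace (prod_topology mtopology mtopology)"
    using measurable_space[OF f] measurable_space[OF g] by auto
next
  fix U assume U: "openin (prod_topology mtopology mtopology) U"
  \<comment> \<open>Largest open set whose product with the ball about \<open>q\<close> lies in
    \<open>U\<close>. Indexing by \<open>q\<close> in \<open>Q\<close> and by \<open>n\<close>
    writes the preimage of \<open>U\<close> as a countable union of intersections of one preimage
    under \<open>f\<close> and one under \<open>g\<close>.\<close>
  define V where "V = (\<lambda>q n. \<Union>{V. openin mtopology V \<and> mball q (1 / real (Suc n)) \<times> V \<subseteq> U})"
  have V: "openin mtopology (V q n)" for q n
    by (auto simp: V_def)
  have "(\<lambda>x. (f x, g x)) -` U \<inter> space N =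
      (\<Union>q\<in>Q. \<Union>n. (f -` mball q (1 / real (Suc n)) \<inter> space N) \<inter> (g -` V q n \<inter> space N))" (is "?L = ?R")
  proof (rule set_eqI, rule iffI)
    fix x assume x: "x \<in> ?L"
    then obtain A B where AB: "openin mtopology A" "openin mtopology B" "f x \<in> A" "g x \<in> B" "A \<times> B \<subseteq> U"
      using U[unfolded openin_prod_topology_alt, rule_format, of "f x" "g x"] x by blast
    then obtain r where r: "r > 0" "mball (f x) r \<subseteq> A"
      by (meson openin_mtopology)
    \<comment> \<open>Half of \<open>r\<close>, because \<open>q\<close> is displaced from
      \<open>f x\<close> by up to one such radius and its own ball adds another.\<close>
    obtain n where n: "1 / real (Suc n) < r / 2"
      using r nat_approx_posE[of "r/2"] by auto
    have pos: "0 < 1 / real (Suc n)" by simp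
    obtain q where q: "q \<in> Q" "q \<in> mball (f x) (1 / real (Suc n))"
      using fQ[of x] x pos unfolding metric_closure_of by blast
    have "mball q (1 / real (Suc n)) \<subseteq> mball (f x) r"
      using q n by (intro mball_subset) (auto simp: commute)
    then have "B \<subseteq> V q n" using AB r unfolding V_def by blast
    then show "x \<in> ?R"
      using q x AB(4) by (auto simp: commute)
  qed (auto simp: V_def)
  also have "\<dots> \<in> sets N"
    using Q V by (intro sets.countable_UN'' sets.Int measurable_sets[OF f] measurable_sets[OF g]) auto
  finally show "(\<lambda>x. (f x, g x)) -` U \<inter> space N \<in> sets N" .
qed

section \<open>Couplings, their marginals and their cost\<close>

lemma couplingsD:
  assumes "\<gamma> \<in> couplings mtopology \<mu> \<nu>"
  shows "prob_space \<gamma>" "sets \<gamma> = sets Borel2" "space \<gamma> = M \<times> M"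
    "distr \<gamma> Borel fst = \<mu>" "distr \<gamma> Borel snd = \<nu>"
    "prob_space \<mu>" "prob_space \<nu>" "sets \<mu> = sets Borel" "sets \<nu> = sets Borel"
proof -
  show *: "prob_space \<gamma>" "sets \<gamma> = sets Borel2" "distr \<gamma> Borel fst = \<mu>" "distr \<gamma> Borel snd = \<nu>"
    using assms by (auto simp: couplings_def)
  show "space \<gamma> = M \<times> M" using sets_eq_imp_space_eq[OF *(2)] by simp
  have m: "fst \<in> \<gamma> \<rightarrow>\<^sub>M Borel" "snd \<in> \<gamma> \<rightarrow>\<^sub>M Borel"
    using * by (simp_all cong: measurable_cong_sets)
  show "prob_space \<mu>" "prob_space \<nu>" "sets \<mu> = sets Borel" "sets \<nu> = sets Borel"
    using prob_space.prob_space_distr[OF *(1) m(1)] prob_space.prob_space_distr[OF *(1) m(2)] * by auto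
qed

text \<open>Turns the construction of a coupling into that of a Borel pair of random variables on an
  arbitrary probability space; the cost becomes an integral over that space by
  \<open>cost_distr\<close>.\<close>

lemma distr_couplings:
  assumes "prob_space N" "Z \<in> N \<rightarrow>\<^sub>M Borel2"
  shows "distr N Borel2 Z \<in> couplings mtopology (distr N Borel (\<lambda>x. fst (Z x))) (distr N Borel (\<lambda>x. snd (Z x)))"
  using assms by (auto simp: couplings_def distr_distr comp_def intro: prob_space.prob_space_distr)

definition cost :: "real \<Rightarrow> ('a \<times> 'a) measure \<Rightarrow> ennreal" where
  "cost p \<gamma> = (\<integral>\<^sup>+z. ennreal (d (fst z) (snd z) powr p) \<partial>\<gamma>)"

lemma cost_distr:
  assumes "Z \<in> N \<rightarrow>\<^sub>M Borel2"
  shows "cost p (distr N Borel2 Z) = (\<integral>\<^sup>+x. ennreal (d (fst (Z x)) (snd (Z x)) powr p) \<partial>N)"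
  unfolding cost_def using assms by (subst nn_integral_distr) auto

lemma distr_swap_couplings:
  assumes "\<gamma> \<in> couplings mtopology \<mu> \<nu>"
  shows "distr \<gamma> Borel2 prod.swap \<in> couplings mtopology \<nu> \<mu>" "cost p (distr \<gamma> Borel2 prod.swap) = cost p \<gamma>"
proof -
  have [measurable_cong]: "sets \<gamma> = sets Borel2" by (rule couplingsD[OF assms])
  have "prod.swap \<in> Borel2 \<rightarrow>\<^sub>M Borel2"
    by (intro continuous_map_borel_of) (simp add: prod.swap_def continuous_map_pairwise comp_def continuous_map_fst continuous_map_snd)
  then have [measurable]: "prod.swap \<in> \<gamma> \<rightarrow>\<^sub>M Borel2" by simp
  show "distr \<gamma> Borel2 prod.swap \<in> couplings mtopology \<nu> \<mu>"
    using distr_couplings[of \<gamma> prod.swap] couplingsD[OF assms] by simp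
  show "cost p (distr \<gamma> Borel2 prod.swap) = cost p \<gamma>"
    by (subst cost_distr) (simp_all add: cost_def commute)
qed

lemma AE_coupling_fst:
  assumes "\<gamma> \<in> couplings mtopology \<mu> \<nu>" "AE x in \<mu>. R x"
  shows "AE z in \<gamma>. R (fst z)"
proof -
  have "fst \<in> \<gamma> \<rightarrow>\<^sub>M Borel"
    using measurable_fst_Borel2 by (simp cong: measurable_cong_sets add: couplingsD(2)[OF assms(1)])
  then show ?thesis
    using assms(2) unfolding couplingsD(4)[OF assms(1), symmetric] by (rule AE_distrD)
qed

lemma AE_coupling_snd:
  assumes "\<gamma> \<in> couplings mtopology \<mu> \<nu>" "AE x in \<nu>. R x"
  shows "AE z in \<gamma>. R (snd z)"
proof -
  have "snd \<in> \<gamma> \<rightarrow>\<^sub>M Borel"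
    using measurable_snd_Borel2 by (simp cong: measurable_cong_sets add: couplingsD(2)[OF assms(1)])
  then show ?thesis
    using assms(2) unfolding couplingsD(5)[OF assms(1), symmetric] by (rule AE_distrD)
qed

lemma nn_integral_coupling_fst:
  assumes "\<gamma> \<in> couplings mtopology \<mu> \<nu>" "g \<in> borel_measurable Borel"
  shows "(\<integral>\<^sup>+z. g (fst z) \<partial>\<gamma>) = (\<integral>\<^sup>+x. g x \<partial>\<mu>)"
proof -
  have [measurable_cong]: "sets \<gamma> = sets Borel2" by (rule couplingsD[OF assms(1)])
  show ?thesis
    using assms(2) by (subst couplingsD(4)[OF assms(1), symmetric], subst nn_integral_distr) auto
qed

lemma nn_integral_coupling_snd:
  assumes "\<gamma> \<in> couplings mtopology \<mu> \<nu>" "g \<in> borel_measurable Borel"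
  shows "(\<integral>\<^sup>+z. g (snd z) \<partial>\<gamma>) = (\<integral>\<^sup>+x. g x \<partial>\<nu>)"
proof -
  have [measurable_cong]: "sets \<gamma> = sets Borel2" by (rule couplingsD[OF assms(1)])
  show ?thesis
    using assms(2) by (subst couplingsD(5)[OF assms(1), symmetric], subst nn_integral_distr) auto
qed

section \<open>Radon measures\<close>

text \<open>Working substitute for inner regularity: it is verified by naming one countable set, and
  it passes easily to mixtures and to limits of random variables.\<close>

definition separably_supported :: "'a measure \<Rightarrow> bool" where
  "separably_supported \<mu> \<longleftrightarrow> (\<exists>Q. countable Q \<and> Q \<subseteq> M \<and> (AE x in \<mu>. x \<in> mtopology closure_of Q))"

lemma separably_supportedE:
  assumes "prob_space \<mu>" "separably_supported \<mu>"
  obtains q :: "nat \<Rightarrow> 'a" where "\<And>n. q n \<in> M" "AE x in \<mu>. x \<in> mtopology closure_of (range q)"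
proof -
  interpret prob_space \<mu> by fact
  obtain Q where Q: "countable Q" "Q \<subseteq> M" "AE x in \<mu>. x \<in> mtopology closure_of Q"
    using assms(2) unfolding separably_supported_def by blast
  have "Q \<noteq> {}"
  proof
    assume "Q = {}"
    then have "AE x in \<mu>. False" using Q(3) by simp
    then show False by simp
  qed
  then have "range (from_nat_into Q) = Q" by (rule range_from_nat_into) fact
  then show thesis using that[of "from_nat_into Q"] Q by auto
qed

text \<open>Compact sets of mass close to 1 are totally bounded. Their finite nets at all radii
  1/(k+1) form one countable set, whose closure contains each of these compact sets and so has mass
  1.\<close>

lemma Radon_imp_separably_supported:
  assumes "prob_space \<mu>" and "Radon_measure_on mtopology \<mu>"
  shows "separably_supported \<mu>"
proof -
  interpret prob_space \<mu> by fact
  have sets: "sets \<mu> = sets Borel" using assms(2) by (simp add: Radon_measure_on_def)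
  have space: "space \<mu> = M" using sets_eq_imp_space_eq[OF sets] by simp
  have M: "M \<in> sets \<mu>" using space by blast
  have sup: "1 = (SUP K\<in>{K. compactin mtopology K \<and> K \<subseteq> M}. emeasure \<mu> K)"
    using assms(2) M emeasure_space_1 space by (simp add: Radon_measure_on_def)
  have "\<exists>K. compactin mtopology K \<and> ennreal (1 - 1 / real (Suc n)) < emeasure \<mu> K" for n
  proof -
    have "ennreal (1 - 1 / real (Suc n)) < 1"
      by (subst ennreal_1[symmetric], subst ennreal_less_iff) auto
    then show ?thesis
      by (subst (asm) sup) (auto simp: less_SUP_iff)
  qed
  then obtain K where K: "\<And>n. compactin mtopology (K n)"
      "\<And>n. ennreal (1 - 1 / real (Suc n)) < emeasure \<mu> (K n)"
    by metis
  have "\<forall>n k. \<exists>F. finite F \<and> F \<subseteq> K n \<and> K n \<subseteq> (\<Union>x\<in>F. mball x (1 / real (Suc k)))"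
    using compactin_imp_mtotally_bounded[OF K(1)] unfolding mtotally_bounded_def by simp
  then obtain F where F: "\<And>n k. finite (F n k)" "\<And>n k. F n k \<subseteq> K n"
      "\<And>n k. K n \<subseteq> (\<Union>x\<in>F n k. mball x (1 / real (Suc k)))"
    by metis
  define Q where "Q = (\<Union>n k. F n k)"
  have "countable Q" unfolding Q_def by (intro countable_UN countableI_type countable_finite F(1))
  have KM: "K n \<subseteq> M" for n using compactin_subset_topspace[OF K(1)] by simp
  have "Q \<subseteq> M" using F(2) KM unfolding Q_def by blast
  have KQ: "K n \<subseteq> mtopology closure_of Q" for n
  proof
    fix x assume x: "x \<in> K n"
    have "\<exists>y\<in>Q. y \<in> mball x r" if r: "r > 0" for r
    proof -
      obtain k where k: "1 / real (Suc k) < r" using nat_approx_posE[OF r] by blast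
      obtain y where "y \<in> F n k" "x \<in> mball y (1 / real (Suc k))" using F(3) x by blast
      then show ?thesis using k unfolding Q_def by (intro bexI[of _ y]) (auto simp: commute)
    qed
    then show "x \<in> mtopology closure_of Q"
      using x KM by (auto simp: metric_closure_of)
  qed
  have C: "mtopology closure_of Q \<in> sets \<mu>" unfolding sets by (intro borel_of_closedin) simp
  have "1 - 1 / real (Suc n) \<le> prob (mtopology closure_of Q)" for n
  proof -
    have "ennreal (1 - 1 / real (Suc n)) \<le> emeasure \<mu> (mtopology closure_of Q)"
      using K(2)[of n] emeasure_mono[OF KQ C] by (meson less_imp_le order_trans)
    then show ?thesis
      by (simp add: emeasure_eq_measure)
  qed
  moreover have "(\<lambda>n. 1 - 1 / real (Suc n)) \<longlonglongrightarrow> 1 - 0"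
    by (intro tendsto_diff tendsto_const) (rule LIMSEQ_Suc[OF lim_1_over_n])
  ultimately have "1 \<le> prob (mtopology closure_of Q)"
    by (auto intro: LIMSEQ_le_const2)
  then have "prob (mtopology closure_of Q) = 1" using prob_le_1 by (simp add: antisym)
  then have "AE x in \<mu>. x \<in> mtopology closure_of Q"
    by (rule AE_prob_1)
  then show ?thesis
    using \<open>countable Q\<close> \<open>Q \<subseteq> M\<close> unfolding separably_supported_def by blast
qed

text \<open>The sets that can be squeezed between a closed and an open set with small difference
  form a sigma-algebra. It contains the open sets because in a metrizable space these are increasing
  unions of closed sets.\<close>

lemma closed_open_regular:
  assumes "finite_measure \<mu>" and sets: "sets \<mu> = sets Borel"
    and "A \<in> sets Borel" "e > 0"
  shows "\<exists>C U. closedin mtopology C \<and> openin mtopology U \<and> C \<subseteq> A \<and> A \<subseteq> U \<and> measure \<mu> (U - C) < e"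
proof -
  interpret finite_measure \<mu> by fact
  have cl: "C \<in> sets \<mu>" if "closedin mtopology C" for C
    using that borel_of_closedin sets by blast
  have op: "U \<in> sets \<mu>" if "openin mtopology U" for U
    using that borel_of_openin sets by blast
  have small: "\<exists>n. measure \<mu> (B - D n) < e"
    if D: "\<And>n. D n \<in> sets \<mu>" "incseq D" "(\<Union>n. D n) = B" and "e > 0" for B D and e :: real
  proof -
    have "(\<lambda>n. measure \<mu> (D n)) \<longlonglongrightarrow> measure \<mu> (\<Union>n. D n)"
      using D by (intro finite_Lim_measure_incseq) auto
    then have "(\<lambda>n. measure \<mu> (D n)) \<longlonglongrightarrow> measure \<mu> B" using D by simp
    from LIMSEQ_D[OF this \<open>e > 0\<close>]
    obtain n where n: "\<bar>measure \<mu> (D n) - measure \<mu> B\<bar> < e" by (auto simp: dist_real_def)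
    have "B \<in> sets \<mu>" using sets.countable_UN[of D UNIV \<mu>] D by auto
    then have "measure \<mu> (B - D n) = measure \<mu> B - measure \<mu> (D n)"
      using D by (intro finite_measure_Diff) auto
    with n show ?thesis by (intro exI[of _ n]) auto
  qed
  from assms(3) have "A \<in> sigma_sets M {U. openin mtopology U}"
    by (simp add: sets_borel_of)
  then show ?thesis using \<open>e > 0\<close>
  proof (induction arbitrary: e rule: sigma_sets.induct)
    case (Basic a)
    then have "fsigma_in mtopology a"
      by (intro open_imp_fsigma_in metrizable_space_mtopology) simp
    then obtain D where D: "\<And>n. closedin mtopology (D n)" "\<And>n. D n \<subseteq> D (Suc n)" "\<Union> (range D) = a"
      unfolding fsigma_in_ascending by blast
    obtain n where "measure \<mu> (a - D n) < e"
      using small[of D a e] D Basic cl by (auto simp: incseq_Suc_iff)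
    then show ?case using D Basic by (intro exI[of _ "D n"] exI[of _ a]) auto
  next
    case Empty
    then have "measure \<mu> ({} - {}) < e" by simp
    then show ?case using closedin_empty openin_empty by blast
  next
    case (Compl a)
    then obtain C U where CU: "closedin mtopology C" "openin mtopology U" "C \<subseteq> a" "a \<subseteq> U"
        "measure \<mu> (U - C) < e" using Compl.IH[OF Compl.prems] by (elim exE conjE)
    have "U \<subseteq> M" using CU openin_subset by fastforce
    then have "(M - C) - (M - U) = U - C" by auto
    moreover have "closedin mtopology (M - U)" "openin mtopology (M - C)"
      using CU closedin_diff[OF closedin_mspace CU(2)] openin_diff[OF open_in_mspace CU(1)] by auto
    ultimately show ?case using CU by (intro exI[of _ "M - U"] exI[of _ "M - C"]) auto
  next
    case (Union a)
    have "\<forall>i. \<exists>C U. closedin mtopology C \<and> openin mtopology U \<and> C \<subseteq> a i \<and> a i \<subseteq> U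
        \<and> measure \<mu> (U - C) < e / 4 * (1/2) ^ i"
      by (intro allI Union.IH) (use Union.prems in simp)
    then obtain C U where CU: "\<And>i. closedin mtopology (C i)" "\<And>i. openin mtopology (U i)"
        "\<And>i. C i \<subseteq> a i" "\<And>i. a i \<subseteq> U i" "\<And>i. measure \<mu> (U i - C i) < e / 4 * (1/2) ^ i"
      by metis
    \<comment> \<open>The union of all \<open>C i\<close> need not be closed, so only finitely many
      are kept. The truncation costs less than e/2, and the terms e/4 * 2^-i add up to the other
      e/2.\<close>
    define D where "D n = (\<Union>i\<le>n. C i)" for n :: nat
    have Dcl: "closedin mtopology (D n)" for n unfolding D_def by (intro closedin_Union) (auto simp: CU)
    have DU: "(\<Union>n. D n) = (\<Union>i. C i)" by (auto simp: D_def)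
    have "incseq D" unfolding incseq_def D_def by (intro allI impI UN_mono) auto
    then obtain n where n: "measure \<mu> ((\<Union>i. C i) - D n) < e / 2"
      using small[OF cl[OF Dcl] _ DU, of "e/2"] \<open>e > 0\<close> by auto
    have summ: "(\<lambda>i. e / 4 * (1/2) ^ i) sums (e / 4 * 2)"
      by (intro sums_mult) (use geometric_sums[of "1/2::real"] in simp)
    have summable: "summable (\<lambda>i. measure \<mu> (U i - C i))"
      by (rule summable_comparison_test'[OF sums_summable[OF summ], of 0])
         (use CU(5) in \<open>auto intro: less_imp_le\<close>)
    have m: "U i - C i \<in> sets \<mu>" for i by (intro sets.Diff op cl CU)
    have "measure \<mu> (\<Union>i. U i - C i) \<le> (\<Sum>i. measure \<mu> (U i - C i))"
      by (rule finite_measure_subadditive_countably[OF _ summable]) (intro image_subsetI m)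
    also have "\<dots> \<le> (\<Sum>i. e / 4 * (1/2) ^ i)"
      by (rule suminf_le[OF less_imp_le[OF CU(5)] summable sums_summable[OF summ]])
    also have "\<dots> = e / 4 * 2"
      by (rule sums_unique[OF summ, symmetric])
    finally have 1: "measure \<mu> (\<Union>i. U i - C i) \<le> e / 2" by simp
    have mC: "(\<Union>i. C i) \<in> sets \<mu>" by (intro sets.countable_UN'' cl CU) simp
    have mU: "(\<Union>i. U i - C i) \<in> sets \<mu>" by (intro sets.countable_UN'' m) simp
    have "measure \<mu> ((\<Union>i. U i) - D n) \<le> measure \<mu> ((\<Union>i. U i - C i) \<union> ((\<Union>i. C i) - D n))"
      using mC mU cl[OF Dcl] by (intro finite_measure_mono) auto
    also have "\<dots> \<le> measure \<mu> (\<Union>i. U i - C i) + measure \<mu> ((\<Union>i. C i) - D n)"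
      using mC mU cl[OF Dcl] by (intro measure_Un_le) auto
    also have "\<dots> < e" using 1 n by simp
    finally have *: "measure \<mu> ((\<Union>i. U i) - D n) < e" .
    have "D n \<subseteq> (\<Union>i. a i)" using CU(3) unfolding D_def by blast
    moreover have "(\<Union>i. a i) \<subseteq> (\<Union>i. U i)" using CU(4) by blast
    moreover have "openin mtopology (\<Union>i. U i)" by (intro openin_Union) (auto simp: CU(2))
    ultimately show ?case using * Dcl[of n] by (intro exI conjI)
  qed
qed

text \<open>Ulam's argument: for each \<open>k\<close>, finitely many closed balls of radius 1/(k+1)
  carry all mass except e/4 * 2^-k. The intersection over \<open>k\<close> is closed and totally
  bounded, hence compact by completeness, and misses mass at most e/2.\<close>

lemma separably_supported_tight:
  assumes "prob_space \<mu>" and sets: "sets \<mu> = sets Borel" and "separably_supported \<mu>"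
    and "mcomplete" and "e > 0"
  shows "\<exists>K. compactin mtopology K \<and> measure \<mu> (M - K) < e"
proof -
  interpret prob_space \<mu> by fact
  have space: "space \<mu> = M" using sets_eq_imp_space_eq[OF sets] by simp
  have cl: "C \<in> sets \<mu>" if "closedin mtopology C" for C
    using that borel_of_closedin sets by blast
  obtain q :: "nat \<Rightarrow> 'a" where qM: "\<And>n. q n \<in> M" and q: "AE x in \<mu>. x \<in> mtopology closure_of (range q)"
    using separably_supportedE[OF assms(1,3)] by blast
  define B where "B k n = (\<Union>i\<le>n. mcball (q i) (1 / real (Suc k)))" for k n :: nat
  have Bcl: "closedin mtopology (B k n)" for k n
    unfolding B_def by (intro closedin_Union) auto
  have "\<exists>n. measure \<mu> (M - B k n) < e / 4 * (1/2) ^ k" for k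
  proof -
    have "(\<lambda>n. measure \<mu> (B k n)) \<longlonglongrightarrow> measure \<mu> (\<Union>n. B k n)"
    proof (rule finite_Lim_measure_incseq)
      show "incseq (B k)" unfolding incseq_def B_def by (intro allI impI UN_mono) auto
    qed (use cl[OF Bcl] in auto)
    moreover have "measure \<mu> (\<Union>n. B k n) = 1"
    proof (subst prob_eq_1)
      show "(\<Union>n. B k n) \<in> events" using cl[OF Bcl] by blast
      show "AE x in \<mu>. x \<in> (\<Union>n. B k n)"
        using q
      proof eventually_elim
        case (elim x)
        have "0 < 1 / real (Suc k)" by simp
        then obtain i where "q i \<in> mball x (1 / real (Suc k))"
          using elim unfolding metric_closure_of by blast
        then have "x \<in> mcball (q i) (1 / real (Suc k))" by (simp add: commute less_imp_le)
        then show ?case unfolding B_def by blast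
      qed
    qed
    ultimately have "(\<lambda>n. measure \<mu> (B k n)) \<longlonglongrightarrow> 1" by simp
    from LIMSEQ_D[OF this, of "e / 4 * (1/2) ^ k"] \<open>e > 0\<close>
    obtain n where n: "\<bar>measure \<mu> (B k n) - 1\<bar> < e / 4 * (1/2) ^ k" by (auto simp: dist_real_def)
    have "measure \<mu> (M - B k n) = 1 - measure \<mu> (B k n)"
      using prob_compl[OF cl[OF Bcl]] space by simp
    with n show ?thesis by (intro exI[of _ n]) auto
  qed
  then obtain N where N: "\<And>k. measure \<mu> (M - B k (N k)) < e / 4 * (1/2) ^ k" by metis
  define K where "K = (\<Inter>k. B k (N k))"
  have Kcl: "closedin mtopology K" unfolding K_def by (intro closedin_Inter) (auto simp: Bcl)
  then have KM: "K \<subseteq> M" using closedin_subset by fastforce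
  have "mtotally_bounded K"
    unfolding mtotally_bounded_def
  proof (intro allI impI)
    fix r :: real assume "r > 0"
    then obtain k where k: "1 / real (Suc k) < r / 2" using nat_approx_posE[of "r/2"] by auto
    \<comment> \<open>Total boundedness asks for a net inside \<open>K\<close>, while the centres
      \<open>q i\<close> may lie outside. Each ball meeting \<open>K\<close> is therefore
      represented by a point \<open>c i\<close> of \<open>K\<close>, which doubles the radius and
      explains r/2 above.\<close>
    define I where "I = {i. i \<le> N k \<and> K \<inter> mcball (q i) (1 / real (Suc k)) \<noteq> {}}"
    have "\<forall>i\<in>I. \<exists>c. c \<in> K \<inter> mcball (q i) (1 / real (Suc k))" unfolding I_def by blast
    then obtain c where c: "\<And>i. i \<in> I \<Longrightarrow> c i \<in> K \<inter> mcball (q i) (1 / real (Suc k))" by metis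
    have "K \<subseteq> (\<Union>x\<in>c ` I. mball x r)"
    proof
      fix x assume x: "x \<in> K"
      then have "x \<in> B k (N k)" unfolding K_def by blast
      then obtain i where i: "i \<le> N k" "x \<in> mcball (q i) (1 / real (Suc k))" unfolding B_def by blast
      then have "i \<in> I" using x unfolding I_def by blast
      have "d (c i) x \<le> d (q i) (c i) + d (q i) x"
        using c[OF \<open>i \<in> I\<close>] i by (intro triangle'') auto
      also have "\<dots> < r" using c[OF \<open>i \<in> I\<close>] i k by auto
      finally show "x \<in> (\<Union>x\<in>c ` I. mball x r)" using c[OF \<open>i \<in> I\<close>] i \<open>i \<in> I\<close> by auto
    qed
    moreover have "finite (c ` I)" "c ` I \<subseteq> K" using c by (auto simp: I_def)
    ultimately show "\<exists>F. finite F \<and> F \<subseteq> K \<and> K \<subseteq> (\<Union>x\<in>F. mball x r)" by blast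
  qed
  then have "compactin mtopology K"
    using mtotally_bounded_eq_compact_closure_of[OF \<open>mcomplete\<close>] Kcl by (simp add: closure_of_closedin)
  moreover have "measure \<mu> (M - K) < e"
  proof -
    have summ: "(\<lambda>i. e / 4 * (1/2) ^ i) sums (e / 4 * 2)"
      by (intro sums_mult) (use geometric_sums[of "1/2::real"] in simp)
    have summable: "summable (\<lambda>k. measure \<mu> (M - B k (N k)))"
      by (rule summable_comparison_test'[OF sums_summable[OF summ], of 0])
         (use N in \<open>auto intro: less_imp_le\<close>)
    have "measure \<mu> (\<Union>k. M - B k (N k)) \<le> (\<Sum>k. measure \<mu> (M - B k (N k)))"
      using cl[OF Bcl] cl[OF closedin_mspace]
      by (intro finite_measure_subadditive_countably summable) auto
    moreover have "(\<Union>k. M - B k (N k)) = M - K" unfolding K_def by blast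
    ultimately have "measure \<mu> (M - K) \<le> (\<Sum>k. measure \<mu> (M - B k (N k)))" by simp
    also have "\<dots> \<le> (\<Sum>i. e / 4 * (1/2) ^ i)"
      by (rule suminf_le[OF less_imp_le[OF N] summable sums_summable[OF summ]])
    also have "\<dots> = e / 4 * 2"
      by (rule sums_unique[OF summ, symmetric])
    also have "\<dots> < e" using \<open>e > 0\<close> by simp
    finally show ?thesis .
  qed
  ultimately show ?thesis by blast
qed

text \<open>For the converse, a closed set \<open>C\<close> inside \<open>B\<close> from regularity
  is intersected with a compact set \<open>K\<close> from tightness. The result is compact and loses
  at most e/2 on either account.\<close>

lemma Radon_iff_separably_supported:
  assumes "prob_space \<mu>" "mcomplete"
  shows "Radon_measure_on mtopology \<mu> \<longleftrightarrow> sets \<mu> = sets Borel \<and> separably_supported \<mu>"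
proof
  assume "Radon_measure_on mtopology \<mu>"
  then show "sets \<mu> = sets Borel \<and> separably_supported \<mu>"
    using assms Radon_imp_separably_supported by (auto simp: Radon_measure_on_def)
next
  assume *: "sets \<mu> = sets Borel \<and> separably_supported \<mu>"
  interpret prob_space \<mu> by fact
  have space: "space \<mu> = M" using * sets_eq_imp_space_eq[of \<mu> Borel] by simp
  have comp_meas: "K \<in> sets \<mu>" if "compactin mtopology K" for K
    using that borel_of_closedin compactin_imp_closedin[OF Hausdorff_space_mtopology] * by blast
  show "Radon_measure_on mtopology \<mu>"
    unfolding Radon_measure_on_def
  proof (intro conjI ballI antisym)
    fix B assume B: "B \<in> sets \<mu>"
    show "(SUP K\<in>{K. compactin mtopology K \<and> K \<subseteq> B}. emeasure \<mu> K) \<le> emeasure \<mu> B"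
      using B by (intro SUP_least emeasure_mono) auto
    show "emeasure \<mu> B \<le> (SUP K\<in>{K. compactin mtopology K \<and> K \<subseteq> B}. emeasure \<mu> K)"
    proof (rule ennreal_le_epsilon)
      fix e :: real assume "e > 0"
      obtain C U where CU: "closedin mtopology C" "openin mtopology U" "C \<subseteq> B" "B \<subseteq> U" "measure \<mu> (U - C) < e/2"
        using closed_open_regular[OF finite_measure_axioms, of B "e/2"] * B \<open>e > 0\<close> by auto
      obtain K where K: "compactin mtopology K" "measure \<mu> (M - K) < e/2"
        using separably_supported_tight[of \<mu> "e/2"] * assms \<open>e > 0\<close> by auto
      have meas: "C \<in> sets \<mu>" "U \<in> sets \<mu>" "K \<in> sets \<mu>"
        using CU K comp_meas * borel_of_closedin borel_of_openin by auto
      have CK: "compactin mtopology (C \<inter> K)" using closed_Int_compactin CU K by blast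
      have "B \<subseteq> (C \<inter> K) \<union> ((U - C) \<union> (M - K))"
        using CU sets.sets_into_space[OF B] space by auto
      then have "measure \<mu> B \<le> measure \<mu> ((C \<inter> K) \<union> ((U - C) \<union> (M - K)))"
        using meas space by (intro finite_measure_mono) auto
      also have "\<dots> \<le> measure \<mu> (C \<inter> K) + measure \<mu> ((U - C) \<union> (M - K))"
        using meas space by (intro measure_Un_le) auto
      also have "\<dots> \<le> measure \<mu> (C \<inter> K) + (measure \<mu> (U - C) + measure \<mu> (M - K))"
        using meas space by (intro add_left_mono measure_Un_le) auto
      also have "\<dots> \<le> measure \<mu> (C \<inter> K) + e" using CU K by simp
      finally have "emeasure \<mu> B \<le> emeasure \<mu> (C \<inter> K) + ennreal e"
        using \<open>e > 0\<close> by (simp add: emeasure_eq_measure flip: ennreal_plus)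
      also have "emeasure \<mu> (C \<inter> K) \<le> (SUP K\<in>{K. compactin mtopology K \<and> K \<subseteq> B}. emeasure \<mu> K)"
        using CK CU by (intro SUP_upper) auto
      finally show "emeasure \<mu> B \<le> (SUP K\<in>{K. compactin mtopology K \<and> K \<subseteq> B}. emeasure \<mu> K) + ennreal e"
        by (simp add: add_right_mono)
    qed
  qed (use * in auto)
qed

end

section \<open>Gluing couplings\<close>

text \<open>In the interior this is convexity of the power function; at the boundary a = 0 or b = 0
  it reduces to t^p \<le> t for t in [0, 1].\<close>

lemma powr_convex_nonneg:
  fixes a b l p :: real
  assumes "1 \<le> p" "0 \<le> a" "0 \<le> b" "0 < l" "l < 1"
  shows "(l * a + (1 - l) * b) powr p \<le> l * a powr p + (1 - l) * b powr p"
proof -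
  have le: "t powr p \<le> t" if "0 \<le> t" "t \<le> 1" for t :: real
    using powr_mono'[of 1 p t] that assms(1) by simp
  consider "a = 0" | "b = 0" | "a > 0" "b > 0" using assms by linarith
  then show ?thesis
  proof cases
    case 1
    then show ?thesis
      using le[of "1 - l"] assms by (auto simp: powr_mult intro!: mult_right_mono)
  next
    case 2
    then show ?thesis
      using le[of l] assms by (auto simp: powr_mult intro!: mult_right_mono)
  next
    case 3
    then show ?thesis
      using convex_onD[OF powr_convex[OF assms(1)], of "1 - l" a b] assms by simp
  qed
qed

text \<open>Only the upper bounds \<open>A\<close>, \<open>B\<close> of the norms enter: by convexity
  \<open>((f + g) / (A + B))^p \<le> A / (A + B) * (f / A)^p + B / (A + B) * (g / B)^p\<close>.\<close>

lemma Minkowski_powr: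
  fixes f g :: "'a \<Rightarrow> real"
  assumes "1 \<le> p" and f: "f \<in> borel_measurable N" "\<And>x. 0 \<le> f x" and g: "g \<in> borel_measurable N" "\<And>x. 0 \<le> g x"
    and A: "A > 0" "(\<integral>\<^sup>+x. ennreal (f x powr p) \<partial>N) \<le> ennreal (A powr p)"
    and B: "B > 0" "(\<integral>\<^sup>+x. ennreal (g x powr p) \<partial>N) \<le> ennreal (B powr p)"
  shows "(\<integral>\<^sup>+x. ennreal ((f x + g x) powr p) \<partial>N) \<le> ennreal ((A + B) powr p)"
proof -
  define l where "l = A / (A + B)"
  have l: "0 < l" "l < 1" "1 - l = B / (A + B)" using A(1) B(1) by (auto simp: l_def field_simps)
  \<comment> \<open>Coefficients of the convexity inequality after clearing (A + B)^p. They are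
    balanced so that a * A^p + b * B^p = (A + B)^p.\<close>
  define a b where "a = (A + B) powr p * l / A powr p" and "b = (A + B) powr p * (1 - l) / B powr p"
  have ab: "0 \<le> a" "0 \<le> b" using l A B by (auto simp: a_def b_def)
  have "(f x + g x) powr p \<le> a * f x powr p + b * g x powr p" for x
  proof -
    have "(f x + g x) / (A + B) = l * (f x / A) + (1 - l) * (g x / B)"
    proof -
      have "l * (f x / A) = f x / (A + B)" using A(1) by (simp add: l_def)
      moreover have "(1 - l) * (g x / B) = g x / (A + B)" unfolding l(3) using B(1) by simp
      ultimately show ?thesis by (simp add: add_divide_distrib)
    qed
    then have "((f x + g x) / (A + B)) powr p \<le> l * (f x / A) powr p + (1 - l) * (g x / B) powr p"
      using powr_convex_nonneg[of p "f x / A" "g x / B" l] assms l by simp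
    then have "(f x + g x) powr p / (A + B) powr p \<le> l * (f x powr p / A powr p) + (1 - l) * (g x powr p / B powr p)"
      using A(1) B(1) f(2) g(2) by (simp add: powr_divide)
    then have "(f x + g x) powr p \<le> (A + B) powr p * (l * (f x powr p / A powr p) + (1 - l) * (g x powr p / B powr p))"
      using A(1) B(1) by (simp add: divide_le_eq mult.commute)
    then show ?thesis by (simp add: a_def b_def algebra_simps)
  qed
  then have "(\<integral>\<^sup>+x. ennreal ((f x + g x) powr p) \<partial>N) \<le> (\<integral>\<^sup>+x. ennreal a * ennreal (f x powr p) + ennreal b * ennreal (g x powr p) \<partial>N)"
    using ab by (intro nn_integral_mono) (simp flip: ennreal_mult ennreal_plus)
  also have "\<dots> = ennreal a * (\<integral>\<^sup>+x. ennreal (f x powr p) \<partial>N) + ennreal b * (\<integral>\<^sup>+x. ennreal (g x powr p) \<partial>N)"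
    using f g by (simp add: nn_integral_add nn_integral_cmult)
  also have "\<dots> \<le> ennreal a * ennreal (A powr p) + ennreal b * ennreal (B powr p)"
    by (intro add_mono mult_left_mono A B) auto
  also have "\<dots> = ennreal ((A + B) powr p)"
  proof -
    have "a * A powr p = (A + B) powr p * l" "b * B powr p = (A + B) powr p * (1 - l)"
      using A(1) B(1) by (simp_all add: a_def b_def)
    then have "a * A powr p + b * B powr p = (A + B) powr p" by (simp add: algebra_simps)
    then show ?thesis using ab by (simp flip: ennreal_mult ennreal_plus)
  qed
  finally show ?thesis .
qed

context Metric_space
begin

text \<open>The pairs are made conditionally independent given the cell \<open>\<iota>\<close> of
  the middle point: on the product of both couplings, \<open>h\<close> is 1/(mass of the cell) where
  the two middle points share a cell and 0 elsewhere. Both couplings survive exactly as marginals of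
  \<open>G\<close>; only the two middle points differ, by at most \<open>e\<close>.\<close>

lemma couplings_approx_glue:
  assumes p: "1 \<le> p"
    and \<gamma>: "\<gamma> \<in> couplings mtopology \<mu> \<nu>" "cost p \<gamma> \<le> ennreal (A powr p)" "A > 0"
    and \<gamma>': "\<gamma>' \<in> couplings mtopology \<nu> \<rho>" "cost p \<gamma>' \<le> ennreal (B powr p)" "B > 0"
    and sep: "separably_supported \<mu>" "separably_supported \<nu>" and "e > 0"
  shows "\<exists>\<delta>\<in>couplings mtopology \<mu> \<rho>. cost p \<delta> \<le> ennreal ((A + B + e) powr p)"
proof -
  note c = couplingsD[OF \<gamma>(1)] and c' = couplingsD[OF \<gamma>'(1)]
  note [measurable_cong] = c(2) c'(2) c(8) c(9) c'(9)
  interpret g1: prob_space \<gamma> by (rule c)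
  interpret g2: prob_space \<gamma>' by (rule c')
  interpret pair_prob_space \<gamma> \<gamma>' by unfold_locales
  have sp: "space \<nu> = M" using sets_eq_imp_space_eq[OF c(9)] by simp
  interpret \<mu>: prob_space \<mu> by (rule c)
  interpret \<nu>: prob_space \<nu> by (rule c)
  obtain r :: "nat \<Rightarrow> 'a" where rM: "\<And>n. r n \<in> M" and r: "AE x in \<mu>. x \<in> mtopology closure_of (range r)"
    using separably_supportedE[OF c(6) sep(1)] by blast
  obtain q :: "nat \<Rightarrow> 'a" where qM [measurable]: "\<And>n. q n \<in> M" and q: "AE x in \<nu>. x \<in> mtopology closure_of (range q)"
    using separably_supportedE[OF c(7) sep(2)] by blast
  \<comment> \<open>Index of the first \<open>q n\<close> within e/2, so points of equal index are
    less than \<open>e\<close> apart. Where no such \<open>n\<close> exists the value is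
    unspecified, which happens only on a \<open>\<nu>\<close>-null set.\<close>
  define \<iota> where "\<iota> y = (LEAST n. d (q n) y < e / 2)" for y
  have [measurable]: "\<iota> \<in> Borel \<rightarrow>\<^sub>M count_space UNIV"
    unfolding \<iota>_def by measurable
  have \<iota>: "d (q (\<iota> y)) y < e / 2" if y: "y \<in> mtopology closure_of (range q)" for y
  proof -
    have "0 < e / 2" using \<open>e > 0\<close> by simp
    then obtain i where "q i \<in> mball y (e / 2)"
      using y unfolding metric_closure_of by blast
    then have "d (q i) y < e / 2" by (simp add: commute)
    then show ?thesis unfolding \<iota>_def by (rule LeastI)
  qed
  define w where "w n = emeasure \<nu> {y \<in> M. \<iota> y = n}" for n
  have w_meas: "{y \<in> M. \<iota> y = n} \<in> sets \<nu>" for n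
  proof -
    have "{y \<in> space \<nu>. \<iota> y = n} \<in> sets \<nu>" by measurable
    then show ?thesis using sp by simp
  qed
  \<comment> \<open>A cell of mass zero has \<open>inverse (w n)\<close> infinite; almost every
    point avoids all such cells.\<close>
  have w_AE: "AE y in \<nu>. w (\<iota> y) \<noteq> 0"
  proof -
    have "AE y in \<nu>. \<forall>n. w n = 0 \<longrightarrow> \<iota> y \<noteq> n"
      unfolding AE_all_countable
    proof
      fix n
      show "AE y in \<nu>. w n = 0 \<longrightarrow> \<iota> y \<noteq> n"
      proof (cases "w n = 0")
        case True
        then have "{y \<in> M. \<iota> y = n} \<in> null_sets \<nu>" using w_meas by (auto simp: w_def)
        then show ?thesis by (rule AE_I'[of _ \<nu>]) (auto simp: sp)
      qed simp
    qed
    then show ?thesis by eventually_elim auto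
  qed
  have winv: "inverse (w n) * w n = 1" if "w n \<noteq> 0" for n
    proof -
    have "w n < \<top>" using \<nu>.emeasure_finite by (simp add: w_def less_top[symmetric])
    then show ?thesis using ennreal_divide_self[OF that] by (simp add: divide_ennreal_def mult.commute)
  qed
  define h :: "('a \<times> 'a) \<times> ('a \<times> 'a) \<Rightarrow> ennreal" where "h u = (if \<iota> (snd (fst u)) = \<iota> (fst (snd u)) then inverse (w (\<iota> (snd (fst u)))) else 0)" for u
  have h [measurable]: "h \<in> borel_measurable (\<gamma> \<Otimes>\<^sub>M \<gamma>')"
  proof -
    have 1: "(\<lambda>u. \<iota> (snd (fst u))) \<in> (\<gamma> \<Otimes>\<^sub>M \<gamma>') \<rightarrow>\<^sub>M count_space UNIV"
      by (rule measurable_compose[OF measurable_fst, where g = "\<lambda>z. \<iota> (snd z)"]) measurable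
    have 2: "(\<lambda>u. \<iota> (fst (snd u))) \<in> (\<gamma> \<Otimes>\<^sub>M \<gamma>') \<rightarrow>\<^sub>M count_space UNIV"
      by (rule measurable_compose[OF measurable_snd, where g = "\<lambda>z. \<iota> (fst z)"]) measurable
    have 3: "{u \<in> space (\<gamma> \<Otimes>\<^sub>M \<gamma>'). \<iota> (snd (fst u)) = \<iota> (fst (snd u))} \<in> sets (\<gamma> \<Otimes>\<^sub>M \<gamma>')"
      using measurable_equality_set[OF measurable_compose[OF 1, of real borel] measurable_compose[OF 2, of real borel]]
      by simp
    have 4: "(\<lambda>u. inverse (w (\<iota> (snd (fst u))))) \<in> borel_measurable (\<gamma> \<Otimes>\<^sub>M \<gamma>')"
      by (rule measurable_compose[OF 1]) simp
    show ?thesis unfolding h_def by (rule measurable_If[OF 4 _ 3]) simp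
  qed
  define G where "G = density (\<gamma> \<Otimes>\<^sub>M \<gamma>') h"
  have [measurable_cong]: "sets G = sets (Borel2 \<Otimes>\<^sub>M Borel2)"
    unfolding G_def by (simp add: c(2) c'(2) cong: sets_pair_measure_cong)
  have spG: "space G = (M \<times> M) \<times> (M \<times> M)" by (simp add: G_def space_pair_measure c(3) c'(3))
  have int_w: "(\<integral>\<^sup>+y. (if \<iota> y = n then inverse (w n) else 0) \<partial>\<nu>) = 1" if "w n \<noteq> 0" for n
  proof -
    have "(\<integral>\<^sup>+y. (if \<iota> y = n then inverse (w n) else 0) \<partial>\<nu>) = (\<integral>\<^sup>+y. inverse (w n) * indicator {y \<in> M. \<iota> y = n} y \<partial>\<nu>)"
      by (intro nn_integral_cong) (auto simp: sp)
    also have "\<dots> = inverse (w n) * w n"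
      unfolding w_def by (intro nn_integral_cmult_indicator w_meas)
    finally show ?thesis using winv[OF that] by simp
  qed
  \<comment> \<open>For almost every \<open>z\<close> the integral of \<open>h (z, z')\<close> over
    \<open>z'\<close> is 1, by \<open>int_w\<close> and because the first marginal of
    \<open>\<gamma>'\<close> is \<open>\<nu>\<close>. Hence the first pair keeps its law; fact 2 is
    the mirror image.\<close>
  have 1: "(\<integral>\<^sup>+u. g (fst u) \<partial>G) = (\<integral>\<^sup>+z. g z \<partial>\<gamma>)"
    if [measurable]: "g \<in> borel_measurable Borel2" for g
  proof -
    have AE: "AE z in \<gamma>. w (\<iota> (snd z)) \<noteq> 0" by (rule AE_coupling_snd[OF \<gamma>(1) w_AE])
    have "(\<integral>\<^sup>+u. g (fst u) \<partial>G) = (\<integral>\<^sup>+u. h u * g (fst u) \<partial>(\<gamma> \<Otimes>\<^sub>M \<gamma>'))"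
      unfolding G_def by (subst nn_integral_density) auto
    also have "\<dots> = (\<integral>\<^sup>+z. (\<integral>\<^sup>+z'. h (z, z') * g z \<partial>\<gamma>') \<partial>\<gamma>)"
      by (subst g2.nn_integral_fst[symmetric]) auto
    also have "\<dots> = (\<integral>\<^sup>+z. g z \<partial>\<gamma>)"
    proof (rule nn_integral_cong_AE, use AE in eventually_elim)
      case (elim z)
      define n where "n = \<iota> (snd z)"
      have "(\<integral>\<^sup>+z'. h (z, z') * g z \<partial>\<gamma>') = (\<integral>\<^sup>+z'. (if \<iota> (fst z') = n then inverse (w n) else 0) * g z \<partial>\<gamma>')"
        by (intro nn_integral_cong) (auto simp: h_def n_def)
      also have "\<dots> = (\<integral>\<^sup>+z'. (if \<iota> (fst z') = n then inverse (w n) else 0) \<partial>\<gamma>') * g z"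
        by (intro nn_integral_multc) auto
      also have "(\<integral>\<^sup>+z'. (if \<iota> (fst z') = n then inverse (w n) else 0) \<partial>\<gamma>') = (\<integral>\<^sup>+y. (if \<iota> y = n then inverse (w n) else 0) \<partial>\<nu>)"
        by (intro nn_integral_coupling_fst[OF \<gamma>'(1), of "\<lambda>y. if \<iota> y = n then inverse (w n) else 0"]) auto
      finally show ?case using int_w[of n] elim by (simp add: n_def)
    qed
    finally show ?thesis .
  qed
  have 2: "(\<integral>\<^sup>+u. g (snd u) \<partial>G) = (\<integral>\<^sup>+z. g z \<partial>\<gamma>')"
    if [measurable]: "g \<in> borel_measurable Borel2" for g
  proof -
    have AE: "AE z in \<gamma>'. w (\<iota> (fst z)) \<noteq> 0" by (rule AE_coupling_fst[OF \<gamma>'(1) w_AE])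
    have "(\<integral>\<^sup>+u. g (snd u) \<partial>G) = (\<integral>\<^sup>+u. h u * g (snd u) \<partial>(\<gamma> \<Otimes>\<^sub>M \<gamma>'))"
      unfolding G_def by (subst nn_integral_density) auto
    also have "\<dots> = (\<integral>\<^sup>+z'. (\<integral>\<^sup>+z. h (z, z') * g z' \<partial>\<gamma>) \<partial>\<gamma>')"
      by (subst nn_integral_snd[symmetric]) auto
    also have "\<dots> = (\<integral>\<^sup>+z'. g z' \<partial>\<gamma>')"
    proof (rule nn_integral_cong_AE, use AE in eventually_elim)
      case (elim z')
      define n where "n = \<iota> (fst z')"
      have "(\<integral>\<^sup>+z. h (z, z') * g z' \<partial>\<gamma>) = (\<integral>\<^sup>+z. (if \<iota> (snd z) = n then inverse (w n) else 0) * g z' \<partial>\<gamma>)"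
        by (intro nn_integral_cong) (auto simp: h_def n_def)
      also have "\<dots> = (\<integral>\<^sup>+z. (if \<iota> (snd z) = n then inverse (w n) else 0) \<partial>\<gamma>) * g z'"
        by (intro nn_integral_multc) auto
      also have "(\<integral>\<^sup>+z. (if \<iota> (snd z) = n then inverse (w n) else 0) \<partial>\<gamma>) = (\<integral>\<^sup>+y. (if \<iota> y = n then inverse (w n) else 0) \<partial>\<nu>)"
        by (intro nn_integral_coupling_snd[OF \<gamma>(1), of "\<lambda>y. if \<iota> y = n then inverse (w n) else 0"]) auto
      finally show ?case using int_w[of n] elim by (simp add: n_def)
    qed
    finally show ?thesis .
  qed
  have G_fst: "distr G Borel2 fst = \<gamma>"
  proof (rule measure_eqI)
    fix S assume "S \<in> sets (distr G Borel2 fst)"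
    then have [measurable]: "S \<in> sets Borel2" by simp
    have "emeasure (distr G Borel2 fst) S = (\<integral>\<^sup>+z. indicator S z \<partial>distr G Borel2 fst)" by simp
    also have "\<dots> = (\<integral>\<^sup>+u. indicator S (fst u) \<partial>G)" by (subst nn_integral_distr) auto
    also have "\<dots> = emeasure \<gamma> S" by (subst 1) (auto simp: c(2))
    finally show "emeasure (distr G Borel2 fst) S = emeasure \<gamma> S" .
  qed (simp add: c)
  have G_snd: "distr G Borel2 snd = \<gamma>'"
  proof (rule measure_eqI)
    fix S assume "S \<in> sets (distr G Borel2 snd)"
    then have [measurable]: "S \<in> sets Borel2" by simp
    have "emeasure (distr G Borel2 snd) S = (\<integral>\<^sup>+z. indicator S z \<partial>distr G Borel2 snd)" by simp
    also have "\<dots> = (\<integral>\<^sup>+u. indicator S (snd u) \<partial>G)" by (subst nn_integral_distr) auto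
    also have "\<dots> = emeasure \<gamma>' S" by (subst 2) (auto simp: c')
    finally show "emeasure (distr G Borel2 snd) S = emeasure \<gamma>' S" .
  qed (simp add: c')
  have "prob_space (distr G Borel2 fst)" unfolding G_fst by (rule c)
  then have PG: "prob_space G" by (rule prob_space_distrD[rotated]) simp
  interpret G: prob_space G by fact
  define C where "C = mtopology closure_of (range r)"
  have C [measurable]: "C \<in> sets Borel" unfolding C_def by (intro borel_of_closedin) simp
  define x0 where "x0 = r 0"
  have x0C: "x0 \<in> C" "x0 \<in> M" using closure_of_subset[of "range r" mtopology] rM by (auto simp: C_def x0_def)
  \<comment> \<open>\<open>measurable_Pair_Borel2\<close> asks for values in the closure of a
    countable set at every point, not just almost everywhere. Redirecting the first coordinate to
    \<open>x0\<close> off \<open>C\<close> achieves this and changes only a null set.\<close>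
  define X where "X u = (if fst (fst u) \<in> C then fst (fst u) else x0)" for u :: "('a \<times> 'a) \<times> ('a \<times> 'a)"
  define Z where "Z u = (X u, snd (snd u))" for u :: "('a \<times> 'a) \<times> ('a \<times> 'a)"
  have X [measurable]: "X \<in> G \<rightarrow>\<^sub>M Borel" 
  proof -
    have 1: "(\<lambda>u. fst (fst u)) \<in> G \<rightarrow>\<^sub>M Borel"
      by (rule measurable_compose[where g = fst and N = Borel2]) simp_all
    show ?thesis
      unfolding X_def
      by (rule measurable_If[OF 1]) (use measurable_sets[OF 1 C] x0C in \<open>simp_all add: vimage_def Int_def conj_commute\<close>)
  qed
  have Z: "Z \<in> G \<rightarrow>\<^sub>M Borel2"
    unfolding Z_def
    by (rule measurable_Pair_Borel2[OF X, of _ "range r"]) (auto simp: X_def C_def x0C(1)[unfolded C_def])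
  have AE_G1: "AE u in G. P (fst u)" if "AE z in \<gamma>. P z" for P :: "'a \<times> 'a \<Rightarrow> bool"
  proof -
    have "AE z in distr G Borel2 fst. P z" unfolding G_fst by (rule that)
    then show ?thesis by (rule AE_distrD[rotated]) simp
  qed
  have AE_G2: "AE u in G. P (snd u)" if "AE z in \<gamma>'. P z" for P :: "'a \<times> 'a \<Rightarrow> bool"
  proof -
    have "AE z in distr G Borel2 snd. P z" unfolding G_snd by (rule that)
    then show ?thesis by (rule AE_distrD[rotated]) simp
  qed
  have a1: "AE u in G. fst (fst u) \<in> C"
    unfolding C_def by (rule AE_G1[OF AE_coupling_fst[OF \<gamma>(1) r]])
  have a2: "AE u in G. snd (fst u) \<in> mtopology closure_of (range q)"
    by (rule AE_G1[OF AE_coupling_snd[OF \<gamma>(1) q]])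
  have a3: "AE u in G. fst (snd u) \<in> mtopology closure_of (range q)"
    by (rule AE_G2[OF AE_coupling_fst[OF \<gamma>'(1) q]])
  have a4: "AE u in G. \<iota> (snd (fst u)) = \<iota> (fst (snd u))"
    unfolding G_def by (subst AE_density) (auto simp: h_def)
  define D D' where "D u = d (fst (fst u)) (snd (fst u))" and "D' u = d (fst (snd u)) (snd (snd u))"
    for u :: "('a \<times> 'a) \<times> ('a \<times> 'a)"
  have dist: "AE u in G. d (fst (Z u)) (snd (Z u)) \<le> (D u + D' u) + e"
    using a1 a2 a3 a4 AE_space
  proof eventually_elim
    case (elim u)
    obtain x y y' z where u: "u = ((x, y), (y', z))" by (metis prod.collapse)
    have m: "x \<in> M" "y \<in> M" "y' \<in> M" "z \<in> M" using elim(5) by (auto simp: spG u)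
    define q' where "q' = q (\<iota> y)"
    have "d q' y < e / 2" "d q' y' < e / 2" "q' \<in> M"
      using elim \<iota>[of y] \<iota>[of y'] qM by (auto simp: u q'_def)
    then have "d y y' \<le> e" using triangle''[of y q' y'] m by auto
    then have "d x z \<le> d x y + e + d y' z"
      using triangle[of x y z] triangle[of y y' z] m by auto
    then show ?case using elim(1) by (simp add: u Z_def X_def D_def D'_def)
  qed
  have "(\<integral>\<^sup>+u. ennreal (((D u + D' u) + e) powr p) \<partial>G)
      \<le> ennreal ((A + B + e) powr p)"
  proof (intro Minkowski_powr p \<open>e > 0\<close> add_pos_pos \<gamma>(3) \<gamma>'(3))
    show "(\<integral>\<^sup>+u. ennreal (D u powr p) \<partial>G) \<le> ennreal (A powr p)"
      using \<gamma>(2) unfolding cost_def D_def by (subst 1) auto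
    show "(\<integral>\<^sup>+u. ennreal (D' u powr p) \<partial>G) \<le> ennreal (B powr p)"
      using \<gamma>'(2) unfolding cost_def D'_def by (subst 2) auto
    show "(\<integral>\<^sup>+u. ennreal (e powr p) \<partial>G) \<le> ennreal (e powr p)"
      by (simp add: G.emeasure_space_1)
    show D: "D \<in> borel_measurable G"
      unfolding D_def by (rule measurable_compose[OF _ measurable_dist_Borel2]) simp
    show D': "D' \<in> borel_measurable G"
      unfolding D'_def by (rule measurable_compose[OF _ measurable_dist_Borel2]) simp
    show "(\<lambda>u. D u + D' u) \<in> borel_measurable G" by (intro borel_measurable_add D D')
  qed (use \<open>e > 0\<close> in \<open>auto simp: D_def D'_def\<close>)
  moreover have "cost p (distr G Borel2 Z) \<le> (\<integral>\<^sup>+u. ennreal (((D u + D' u) + e) powr p) \<partial>G)"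
    unfolding cost_distr[OF Z]
    by (rule nn_integral_mono_AE, use dist in eventually_elim) (auto intro!: ennreal_leI powr_mono2 simp: p[THEN order_trans[rotated]] order_trans[OF zero_le_one p])
  moreover have "distr G Borel2 Z \<in> couplings mtopology \<mu> \<rho>"
  proof -
    have "distr G Borel (\<lambda>u. fst (Z u)) = distr G Borel (\<lambda>u. fst (fst u))"
    proof (rule distr_cong_AE)
      show "AE u in G. fst (Z u) = fst (fst u)"
        using a1 by eventually_elim (simp add: Z_def X_def)
      show "(\<lambda>u. fst (Z u)) \<in> G \<rightarrow>\<^sub>M Borel" using X by (simp add: Z_def)
      show "(\<lambda>u. fst (fst u)) \<in> G \<rightarrow>\<^sub>M Borel"
        by (rule measurable_compose[where g = fst and N = Borel2]) simp_all
    qed simp_all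
    also have "\<dots> = distr (distr G Borel2 fst) Borel fst"
      by (subst distr_distr) (auto simp: comp_def)
    finally have 1: "distr G Borel (\<lambda>u. fst (Z u)) = \<mu>" unfolding G_fst c(4) .
    have "distr G Borel (\<lambda>u. snd (Z u)) = distr (distr G Borel2 snd) Borel snd"
      by (subst distr_distr) (auto simp: comp_def Z_def)
    then have 2: "distr G Borel (\<lambda>u. snd (Z u)) = \<rho>" unfolding G_snd c'(5) .
    show ?thesis using distr_couplings[OF PG Z] by (simp add: 1 2)
  qed
  ultimately show ?thesis by (meson order_trans)
qed

end

section \<open>The Wasserstein algebra of Radon measures\<close>

text \<open>Markov's inequality for the p-th power gives (a/t)^p, and a \<le> t together with p
  \<ge> 1 weakens this to a/t. The weaker bound is free of \<open>p\<close>, which keeps the choice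
  of constants in its applications independent of the order.\<close>

lemma Markov_powr:
  fixes f :: "'a \<Rightarrow> real"
  assumes p: "1 \<le> p" and f [measurable]: "f \<in> borel_measurable N"
    and a: "0 < a" "a \<le> t" and le: "(\<integral>\<^sup>+x. ennreal (f x powr p) \<partial>N) \<le> ennreal (a powr p)"
  shows "emeasure N {x \<in> space N. t \<le> f x} \<le> ennreal (a / t)"
proof -
  have "emeasure N {x \<in> space N. t \<le> f x} = (\<integral>\<^sup>+x. indicator {x \<in> space N. t \<le> f x} x \<partial>N)"
    by simp
  also have "\<dots> \<le> (\<integral>\<^sup>+x. ennreal (1 / t powr p) * ennreal (f x powr p) \<partial>N)"
  proof (rule nn_integral_mono)
    fix x
    show "indicator {x \<in> space N. t \<le> f x} x \<le> ennreal (1 / t powr p) * ennreal (f x powr p)"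
    proof (cases "x \<in> {x \<in> space N. t \<le> f x}")
      case True
      then have "t powr p \<le> f x powr p" using a p by (intro powr_mono2) auto
      then show ?thesis using True a by (simp add: ennreal_mult[symmetric])
    qed simp
  qed
  also have "\<dots> = ennreal (1 / t powr p) * (\<integral>\<^sup>+x. ennreal (f x powr p) \<partial>N)"
    by (intro nn_integral_cmult) auto
  also have "\<dots> \<le> ennreal (1 / t powr p) * ennreal (a powr p)"
    by (intro mult_left_mono le) auto
  also have "\<dots> = ennreal ((a / t) powr p)"
    using a by (simp add: powr_divide ennreal_mult[symmetric])
  also have "\<dots> \<le> ennreal (a / t)"
    using powr_mono'[of 1 p "a / t"] a p by (intro ennreal_leI) simp
  finally show ?thesis .
qed

lemma sets_mix_measure [simp]: "sets (mix_measure r \<mu> \<nu>) = sets \<mu>"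
  and space_mix_measure [simp]: "space (mix_measure r \<mu> \<nu>) = space \<mu>"
  unfolding mix_measure_def by simp_all

lemma emeasure_mix_measure:
  assumes "sets \<nu> = sets \<mu>" "B \<in> sets \<mu>"
  shows "emeasure (mix_measure r \<mu> \<nu>) B = ennreal r * emeasure \<mu> B + ennreal (1 - r) * emeasure \<nu> B"
proof (rule emeasure_measure_of[OF mix_measure_def])
  show "sets \<mu> \<subseteq> Pow (space \<mu>)" by (rule sets.space_closed)
  show "positive (sets (mix_measure r \<mu> \<nu>)) (\<lambda>B. ennreal r * emeasure \<mu> B + ennreal (1 - r) * emeasure \<nu> B)"
    by (simp add: positive_def)
  show "countably_additive (sets (mix_measure r \<mu> \<nu>)) (\<lambda>B. ennreal r * emeasure \<mu> B + ennreal (1 - r) * emeasure \<nu> B)"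
  proof (rule countably_additiveI)
    fix A :: "nat \<Rightarrow> 'a set"
    assume A: "range A \<subseteq> sets (mix_measure r \<mu> \<nu>)" "disjoint_family A"
    have "(\<Sum>i. emeasure \<mu> (A i)) = emeasure \<mu> (\<Union>i. A i)"
      using A by (intro suminf_emeasure) auto
    moreover have "(\<Sum>i. emeasure \<nu> (A i)) = emeasure \<nu> (\<Union>i. A i)"
      using A assms(1) by (intro suminf_emeasure) auto
    ultimately show "(\<Sum>i. ennreal r * emeasure \<mu> (A i) + ennreal (1 - r) * emeasure \<nu> (A i))
        = ennreal r * emeasure \<mu> (\<Union>i. A i) + ennreal (1 - r) * emeasure \<nu> (\<Union>i. A i)"
      by (subst suminf_add[symmetric]) (simp_all add: ennreal_suminf_cmult)
  qed
qed (use assms in auto)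

lemma prob_space_mix_measure:
  assumes "prob_space \<mu>" "prob_space \<nu>" "sets \<nu> = sets \<mu>" "0 \<le> r" "r \<le> 1"
  shows "prob_space (mix_measure r \<mu> \<nu>)"
proof (rule prob_spaceI)
  have "space \<nu> = space \<mu>" using assms(3) by (rule sets_eq_imp_space_eq)
  then have "emeasure \<mu> (space \<mu>) = 1" "emeasure \<nu> (space \<mu>) = 1"
    using assms(1,2)[THEN prob_space.emeasure_space_1] by auto
  then have "emeasure (mix_measure r \<mu> \<nu>) (space (mix_measure r \<mu> \<nu>)) = ennreal r + ennreal (1 - r)"
    by (subst emeasure_mix_measure) (use assms in auto)
  also have "\<dots> = 1" using assms by (simp flip: ennreal_plus)
  finally show "emeasure (mix_measure r \<mu> \<nu>) (space (mix_measure r \<mu> \<nu>)) = 1" .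
qed

lemma measure_mix_measure:
  assumes "prob_space \<mu>" "prob_space \<nu>" "sets \<nu> = sets \<mu>" "0 \<le> r" "r \<le> 1" "B \<in> sets \<mu>"
  shows "measure (mix_measure r \<mu> \<nu>) B = r * measure \<mu> B + (1 - r) * measure \<nu> B"
proof -
  interpret \<mu>: prob_space \<mu> by fact
  interpret \<nu>: prob_space \<nu> by fact
  have "emeasure (mix_measure r \<mu> \<nu>) B = ennreal (r * measure \<mu> B + (1 - r) * measure \<nu> B)"
    using assms by (subst emeasure_mix_measure) (simp_all add: \<mu>.emeasure_eq_measure \<nu>.emeasure_eq_measure ennreal_mult ennreal_plus)
  then show ?thesis
    using assms by (intro measure_eq_emeasure_eq_ennreal) auto
qed

lemma prob_space_measure_eqI:
  assumes "prob_space \<mu>" "prob_space \<nu>" "sets \<mu> = sets \<nu>" "\<And>B. B \<in> sets \<mu> \<Longrightarrow> measure \<mu> B = measure \<nu> B"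
  shows "\<mu> = \<nu>"
proof (rule measure_eqI)
  interpret \<mu>: prob_space \<mu> by fact
  interpret \<nu>: prob_space \<nu> by fact
  show "emeasure \<mu> B = emeasure \<nu> B" if "B \<in> sets \<mu>" for B
    using assms(4)[OF that] by (simp add: \<mu>.emeasure_eq_measure \<nu>.emeasure_eq_measure)
qed fact

lemma nn_integral_mix_measure:
  assumes sets: "sets \<nu> = sets \<mu>" and f: "f \<in> borel_measurable \<mu>"
  shows "(\<integral>\<^sup>+x. f x \<partial>mix_measure r \<mu> \<nu>) = ennreal r * (\<integral>\<^sup>+x. f x \<partial>\<mu>) + ennreal (1 - r) * (\<integral>\<^sup>+x. f x \<partial>\<nu>)"
  using f
proof (induction rule: borel_measurable_induct)
  have space: "space \<nu> = space \<mu>" using sets by (rule sets_eq_imp_space_eq)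
  have m: "borel_measurable \<nu> = (borel_measurable \<mu> :: ('a \<Rightarrow> ennreal) set)"
    "borel_measurable (mix_measure r \<mu> \<nu>) = (borel_measurable \<mu> :: ('a \<Rightarrow> ennreal) set)"
    by (intro measurable_cong_sets sets sets_mix_measure refl)+
  {
    case (cong f g)
    have "(\<integral>\<^sup>+x. f x \<partial>N) = (\<integral>\<^sup>+x. g x \<partial>N)" if "space N = space \<mu>" for N
      using cong that by (intro nn_integral_cong) auto
    from this[of \<mu>] this[of \<nu>] this[of "mix_measure r \<mu> \<nu>"] cong.IH space show ?case by simp
  next
    case (set A)
    then show ?case using sets by (simp add: emeasure_mix_measure)
  next
    case (mult u c)
    then show ?case by (simp add: nn_integral_cmult m distrib_left mult.left_commute)
  next
    case (add u v)
    then show ?case by (simp add: nn_integral_add m distrib_left add.assoc add.left_commute)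
  next
    case (seq U)
    have sup: "(\<integral>\<^sup>+x. (SUP i. U i) x \<partial>N) = (SUP i. \<integral>\<^sup>+x. U i x \<partial>N)" if "borel_measurable N = (borel_measurable \<mu> :: ('a \<Rightarrow> ennreal) set)" for N
      unfolding SUP_apply by (rule nn_integral_monotone_convergence_SUP) (use seq that in auto)
    have eq: "(\<integral>\<^sup>+x. (SUP i. U i) x \<partial>\<mu>) = (SUP i. \<integral>\<^sup>+x. U i x \<partial>\<mu>)"
        "(\<integral>\<^sup>+x. (SUP i. U i) x \<partial>\<nu>) = (SUP i. \<integral>\<^sup>+x. U i x \<partial>\<nu>)"
      using sup[of \<mu>] sup[of \<nu>] m by simp_all
    have "(\<integral>\<^sup>+x. (SUP i. U i) x \<partial>mix_measure r \<mu> \<nu>) = (SUP i. ennreal r * (\<integral>\<^sup>+x. U i x \<partial>\<mu>) + ennreal (1 - r) * (\<integral>\<^sup>+x. U i x \<partial>\<nu>))"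
      using sup[of "mix_measure r \<mu> \<nu>"] m seq.IH by simp
    also have "\<dots> = (SUP i. ennreal r * (\<integral>\<^sup>+x. U i x \<partial>\<mu>)) + (SUP i. ennreal (1 - r) * (\<integral>\<^sup>+x. U i x \<partial>\<nu>))"
      using \<open>incseq U\<close> by (intro ennreal_SUP_add) (auto simp: incseq_def le_fun_def intro!: mult_left_mono nn_integral_mono)
    finally show ?case by (simp only: eq SUP_mult_left_ennreal)
  }
qed

lemma distr_mix_measure:
  assumes sets: "sets \<nu> = sets \<mu>" and f: "f \<in> \<mu> \<rightarrow>\<^sub>M N"
  shows "distr (mix_measure r \<mu> \<nu>) N f = mix_measure r (distr \<mu> N f) (distr \<nu> N f)"
proof (rule measure_eqI)
  have space: "space \<nu> = space \<mu>" using sets by (rule sets_eq_imp_space_eq)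
  have m: "f \<in> \<nu> \<rightarrow>\<^sub>M N" "f \<in> mix_measure r \<mu> \<nu> \<rightarrow>\<^sub>M N"
    using f sets by (simp_all cong: measurable_cong_sets)
  fix A assume "A \<in> sets (distr (mix_measure r \<mu> \<nu>) N f)"
  then have A: "A \<in> sets N" by simp
  show "emeasure (distr (mix_measure r \<mu> \<nu>) N f) A = emeasure (mix_measure r (distr \<mu> N f) (distr \<nu> N f)) A"
    using A f m space measurable_sets[OF f A] sets by (simp add: emeasure_distr emeasure_mix_measure)
qed simp

lemma AE_mix_measure:
  assumes sets: "sets \<nu> = sets \<mu>" and B: "B \<in> sets \<mu>" and AE: "AE x in \<mu>. x \<in> B" "AE x in \<nu>. x \<in> B"
  shows "AE x in mix_measure r \<mu> \<nu>. x \<in> B"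
proof (rule AE_I[of _ _ "space \<mu> - B"])
  have space: "space \<nu> = space \<mu>" using sets by (rule sets_eq_imp_space_eq)
  have "emeasure \<mu> (space \<mu> - B) = 0" "emeasure \<nu> (space \<mu> - B) = 0"
    using AE B sets space by (auto intro!: AE_iff_measurable[THEN iffD1, rotated 2, OF AE(1)] AE_iff_measurable[THEN iffD1, rotated 2, OF AE(2)])
  then show "emeasure (mix_measure r \<mu> \<nu>) (space \<mu> - B) = 0"
    using B sets by (simp add: emeasure_mix_measure)
qed (use B in auto)

section \<open>The Wasserstein distance is a metric\<close>

locale complete_metric_order = Metric_space M d for M :: "'a set" and d +
  fixes p :: real
  assumes mcomplete: "mcomplete" and order: "1 \<le> p"
begin

abbreviation "P \<equiv> Wasserstein_space p"
abbreviation "W \<equiv> Wasserstein_dist p"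
abbreviation "Cpl \<equiv> couplings mtopology"

text \<open>The infimum before \<open>enn2real\<close>, which would send an infinite value to 0.
  Statements that recover couplings from a bound on \<open>W\<close> have to pass through finiteness
  of this quantity.\<close>

definition W_cost :: "'a measure \<Rightarrow> 'a measure \<Rightarrow> ennreal" where
  "W_cost \<mu> \<nu> = (INF \<gamma>\<in>Cpl \<mu> \<nu>. cost p \<gamma>)"

lemma W_eq: "W \<mu> \<nu> = enn2real (W_cost \<mu> \<nu>) powr (1 / p)"
  by (simp add: Wasserstein_dist_def W_cost_def cost_def)

lemma W_powr: "W \<mu> \<nu> powr p = enn2real (W_cost \<mu> \<nu>)"
  using order by (simp add: W_eq powr_powr)

lemma P_iff: "\<mu> \<in> P \<longleftrightarrow> prob_space \<mu> \<and> sets \<mu> = sets Borel \<and> separably_supported \<mu> \<and>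
    (\<exists>x0\<in>M. (\<integral>\<^sup>+x. ennreal (d x0 x powr p) \<partial>\<mu>) < \<infinity>)"
  using Radon_iff_separably_supported[OF _ mcomplete] by (auto simp: Wasserstein_space_def)

lemma P_D:
  assumes "\<mu> \<in> P"
  shows "prob_space \<mu>" "sets \<mu> = sets Borel" "space \<mu> = M" "separably_supported \<mu>"
  using assms sets_eq_imp_space_eq[of \<mu> Borel] by (auto simp: P_iff)

lemma dirac_in_P: "x \<in> M \<Longrightarrow> dirac x \<in> P"
proof -
  assume x: "x \<in> M"
  have "AE y in dirac x. y \<in> mtopology closure_of {x}"
  proof -
    have [measurable]: "mtopology closure_of {x} \<in> sets Borel" by (intro borel_of_closedin) simp
    show ?thesis
      unfolding dirac_def using x closure_of_subset[of "{x}" mtopology] by (subst AE_return) auto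
  qed
  then have "separably_supported (dirac x)"
    using x unfolding separably_supported_def by (intro exI[of _ "{x}"]) auto
  moreover have "(\<integral>\<^sup>+y. ennreal (d x y powr p) \<partial>dirac x) < \<infinity>"
    unfolding dirac_def using x by (subst nn_integral_return) auto
  ultimately show ?thesis
    using x by (auto simp: P_iff dirac_def intro: prob_space_return)
qed

text \<open>An upper bound for the distance witnessed by a coupling. \<open>W_le\<close> and
  \<open>coupled_of_W_less\<close> translate to and from \<open>W\<close>, so most later arguments
  handle couplings instead of an infimum.\<close>

definition coupled :: "real \<Rightarrow> 'a measure \<Rightarrow> 'a measure \<Rightarrow> bool" where
  "coupled a \<mu> \<nu> \<longleftrightarrow> (\<exists>\<gamma>\<in>Cpl \<mu> \<nu>. cost p \<gamma> \<le> ennreal (a powr p))"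

lemma coupled_distr:
  assumes "prob_space N" "Z \<in> N \<rightarrow>\<^sub>M Borel2"
    and "distr N Borel (\<lambda>x. fst (Z x)) = \<mu>" "distr N Borel (\<lambda>x. snd (Z x)) = \<nu>"
    and "(\<integral>\<^sup>+x. ennreal (d (fst (Z x)) (snd (Z x)) powr p) \<partial>N) \<le> ennreal (a powr p)"
  shows "coupled a \<mu> \<nu>"
  unfolding coupled_def
  by (rule bexI[of _ "distr N Borel2 Z"]) (use distr_couplings[OF assms(1,2)] assms in \<open>simp_all add: cost_distr\<close>)

lemma coupled_sym: "coupled a \<mu> \<nu> \<Longrightarrow> coupled a \<nu> \<mu>"
  unfolding coupled_def by (metis (no_types) distr_swap_couplings)

lemma coupled_glue:
  assumes "coupled a \<mu> \<nu>" "coupled b \<nu> \<rho>" "a > 0" "b > 0" "e > 0" "\<mu> \<in> P" "\<nu> \<in> P"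
  shows "coupled (a + b + e) \<mu> \<rho>"
  using assms couplings_approx_glue[OF order _ _ \<open>a > 0\<close> _ _ \<open>b > 0\<close> P_D(4)[OF \<open>\<mu> \<in> P\<close>] P_D(4)[OF \<open>\<nu> \<in> P\<close>] \<open>e > 0\<close>]
  unfolding coupled_def by meson

lemma coupled_dirac_dirac:
  assumes "x \<in> M" "y \<in> M"
  shows "coupled (d x y) (dirac x) (dirac y)"
proof (rule coupled_distr)
  show "prob_space (dirac x)" by (rule P_D(1)[OF dirac_in_P[OF assms(1)]])
  have s: "sets (dirac x) = sets Borel" by (rule P_D(2)[OF dirac_in_P[OF assms(1)]])
  have [measurable_cong]: "sets (dirac x) = sets Borel" by fact
  show "(\<lambda>_. (x, y)) \<in> dirac x \<rightarrow>\<^sub>M Borel2" using assms by simp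
  show "distr (dirac x) Borel (\<lambda>_. fst (x, y)) = dirac x" "distr (dirac x) Borel (\<lambda>_. snd (x, y)) = dirac y"
    using prob_space.distr_const[OF \<open>prob_space (dirac x)\<close>, of _ Borel] assms by (simp_all add: dirac_def)
  show "(\<integral>\<^sup>+_. ennreal (d (fst (x, y)) (snd (x, y)) powr p) \<partial>dirac x) \<le> ennreal (d x y powr p)"
    using prob_space.emeasure_space_1[OF \<open>prob_space (dirac x)\<close>] by simp
qed

lemma W_le:
  assumes "coupled a \<mu> \<nu>" "0 \<le> a"
  shows "W \<mu> \<nu> \<le> a"
proof -
  have "W_cost \<mu> \<nu> \<le> ennreal (a powr p)"
    using assms(1) unfolding W_cost_def coupled_def by (auto intro: INF_lower2)
  then have "enn2real (W_cost \<mu> \<nu>) \<le> a powr p"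
    using enn2real_mono[of "W_cost \<mu> \<nu>" "ennreal (a powr p)"] by simp
  then have "W \<mu> \<nu> \<le> (a powr p) powr (1 / p)"
    unfolding W_eq using order by (intro powr_mono2) auto
  then show ?thesis using order assms by (simp add: powr_powr)
qed

lemma ennreal_le_powr:
  assumes "c < \<infinity>"
  obtains a :: real where "a > 0" "c \<le> ennreal (a powr p)"
proof
  \<comment> \<open>Adding 1 keeps the root positive also for c = 0, as
    \<open>Minkowski_powr\<close> requires.\<close>
  define t where "t = enn2real c + 1"
  have "0 < t" unfolding t_def by (intro add_nonneg_pos) auto
  define a where "a = t powr (1 / p)"
  show "a > 0" using \<open>0 < t\<close> by (simp add: a_def)
  have "a powr p = t" using order \<open>0 < t\<close> by (simp add: a_def powr_powr)
  then show "c \<le> ennreal (a powr p)"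
    using assms by (cases c) (auto simp: t_def)
qed

lemma moment_finite:
  assumes "\<mu> \<in> P" "x \<in> M"
  shows "(\<integral>\<^sup>+y. ennreal (d x y powr p) \<partial>\<mu>) < \<infinity>"
proof -
  obtain x0 where x0: "x0 \<in> M" "(\<integral>\<^sup>+x. ennreal (d x0 x powr p) \<partial>\<mu>) < \<infinity>"
    using assms by (auto simp: P_iff)
  interpret prob_space \<mu> by (rule P_D[OF assms(1)])
  have [measurable_cong]: "sets \<mu> = sets Borel" by (rule P_D[OF assms(1)])
  obtain a where a: "a > 0" "(\<integral>\<^sup>+x. ennreal (d x0 x powr p) \<partial>\<mu>) \<le> ennreal (a powr p)"
    using ennreal_le_powr[OF x0(2)] .
  \<comment> \<open>Change of base point by Minkowski. The extra 1 keeps the constant summand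
    positive when x = x0.\<close>
  have "(\<integral>\<^sup>+y. ennreal (d x y powr p) \<partial>\<mu>) \<le> (\<integral>\<^sup>+y. ennreal ((d x0 y + (d x x0 + 1)) powr p) \<partial>\<mu>)"
  proof (intro nn_integral_mono ennreal_leI powr_mono2)
    fix y assume "y \<in> space \<mu>"
    then have "y \<in> M" using P_D(3)[OF assms(1)] by simp
    then show "d x y \<le> d x0 y + (d x x0 + 1)" using triangle[of x x0 y] x0 assms by simp
  qed (use order in auto)
  also have "\<dots> \<le> ennreal ((a + (d x x0 + 1)) powr p)"
    by (rule Minkowski_powr[OF order])
       (use a x0 in \<open>auto simp: emeasure_space_1 add_nonneg_pos\<close>)
  finally show ?thesis by (rule order.strict_trans1) simp
qed

lemma coupled_dirac:
  assumes "\<mu> \<in> P" "x \<in> M"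
  obtains a where "a > 0" "coupled a \<mu> (dirac x)"
proof -
  have s [measurable_cong]: "sets \<mu> = sets Borel" and PS: "prob_space \<mu>" by (rule P_D[OF assms(1)])+
  obtain a where a: "a > 0" "(\<integral>\<^sup>+y. ennreal (d x y powr p) \<partial>\<mu>) \<le> ennreal (a powr p)"
    using ennreal_le_powr[OF moment_finite[OF assms]] .
  have "coupled a \<mu> (dirac x)"
  proof (rule coupled_distr[OF PS])
    have "continuous_map mtopology (prod_topology mtopology mtopology) (\<lambda>y. (y, x))"
      using assms by (simp add: continuous_map_pairwise comp_def)
    from continuous_map_borel_of[OF this] show "(\<lambda>y. (y, x)) \<in> \<mu> \<rightarrow>\<^sub>M Borel2" by simp
    show "distr \<mu> Borel (\<lambda>y. fst (y, x)) = \<mu>" using s by (simp add: distr_id2)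
    show "distr \<mu> Borel (\<lambda>y. snd (y, x)) = dirac x"
      using prob_space.distr_const[OF PS, of _ Borel] assms by (simp add: dirac_def)
  qed (use a in \<open>simp add: commute\<close>)
  then show thesis using that a by blast
qed

text \<open>Gluing through a Dirac measure stands in for the product coupling: pairing with a
  constant is continuous, hence Borel, whereas the product measure is defined on a possibly smaller
  sigma-algebra than \<open>Borel2\<close>.\<close>

lemma coupled_exists:
  assumes "\<mu> \<in> P" "\<nu> \<in> P"
  obtains a where "a > 0" "coupled a \<mu> \<nu>"
proof -
  obtain x where x: "x \<in> M" using assms(1) by (auto simp: P_iff)
  obtain a where a: "a > 0" "coupled a \<mu> (dirac x)" using coupled_dirac[OF assms(1) x] .
  obtain b where b: "b > 0" "coupled b \<nu> (dirac x)" using coupled_dirac[OF assms(2) x] .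
  have "coupled (a + b + 1) \<mu> \<nu>"
    using coupled_glue[OF a(2) coupled_sym[OF b(2)] a(1) b(1) _ assms(1) dirac_in_P[OF x], of 1] by simp
  then show thesis using that[of "a + b + 1"] a b by simp
qed

lemma W_cost_finite:
  assumes "\<mu> \<in> P" "\<nu> \<in> P"
  shows "W_cost \<mu> \<nu> < \<infinity>"
proof -
  obtain a where "coupled a \<mu> \<nu>" using coupled_exists[OF assms] by blast
  then have "W_cost \<mu> \<nu> \<le> ennreal (a powr p)"
    unfolding W_cost_def coupled_def by (auto intro: INF_lower2)
  then show ?thesis by (rule order.strict_trans1) simp
qed

text \<open>A strict bound above an infimum is undercut by some coupling. Finiteness of the cost
  rules out that \<open>W\<close> is small merely because \<open>enn2real\<close> maps infinity to
  0.\<close>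

lemma coupled_of_W_less:
  assumes "\<mu> \<in> P" "\<nu> \<in> P" "W \<mu> \<nu> < a"
  shows "coupled a \<mu> \<nu>"
proof -
  have W0: "0 \<le> W \<mu> \<nu>" by (simp add: W_eq)
  have "enn2real (W_cost \<mu> \<nu>) < a powr p"
    using powr_less_mono2[of p "W \<mu> \<nu>" a] W0 assms(3) order by (simp add: W_powr)
  then have "W_cost \<mu> \<nu> < ennreal (a powr p)"
    using W_cost_finite[OF assms(1,2)] by (cases "W_cost \<mu> \<nu>") (auto simp: ennreal_less_iff)
  then show ?thesis
    unfolding W_cost_def coupled_def INF_less_iff by (auto intro: less_imp_le)
qed

lemma W_commute: "W \<mu> \<nu> = W \<nu> \<mu>"
proof -
  have "W_cost \<mu> \<nu> \<le> W_cost \<nu> \<mu>" for \<mu> \<nu>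
    unfolding W_cost_def
  proof (rule INF_mono)
    fix \<gamma> assume "\<gamma> \<in> Cpl \<nu> \<mu>"
    then show "\<exists>\<gamma>'\<in>Cpl \<mu> \<nu>. cost p \<gamma>' \<le> cost p \<gamma>"
      using distr_swap_couplings[of \<gamma> \<nu> \<mu>] by (intro bexI[of _ "distr \<gamma> Borel2 prod.swap"]) simp_all
  qed
  from antisym[OF this this] show ?thesis by (simp add: W_eq)
qed

lemma W_triangle:
  assumes "\<mu> \<in> P" "\<nu> \<in> P" "\<rho> \<in> P"
  shows "W \<mu> \<rho> \<le> W \<mu> \<nu> + W \<nu> \<rho>"
proof (rule field_le_epsilon)
  fix e :: real assume "e > 0"
  have nn: "0 \<le> W \<mu> \<nu>" "0 \<le> W \<nu> \<rho>" by (simp_all add: W_eq)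
  \<comment> \<open>One third of \<open>e\<close> on each side makes the bounds strict, and positive
    even at distance 0; the last third pays for the gluing.\<close>
  have "coupled ((W \<mu> \<nu> + e/3) + (W \<nu> \<rho> + e/3) + e/3) \<mu> \<rho>"
    using \<open>e > 0\<close> nn assms
    by (intro coupled_glue[of _ \<mu> \<nu>] coupled_of_W_less) auto
  then show "W \<mu> \<rho> \<le> W \<mu> \<nu> + W \<nu> \<rho> + e"
    by (rule W_le[THEN order_trans]) (use \<open>e > 0\<close> nn in auto)
qed

lemma W_self:
  assumes "\<mu> \<in> P"
  shows "W \<mu> \<mu> = 0"
proof -
  have s [measurable_cong]: "sets \<mu> = sets Borel" and PS: "prob_space \<mu>" by (rule P_D[OF assms(1)])+
  have "coupled 0 \<mu> \<mu>"
  proof (rule coupled_distr[OF PS])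
    have "continuous_map mtopology (prod_topology mtopology mtopology) (\<lambda>x. (x, x))"
      by (simp add: continuous_map_pairwise comp_def)
    from continuous_map_borel_of[OF this] show "(\<lambda>x. (x, x)) \<in> \<mu> \<rightarrow>\<^sub>M Borel2" by simp
    show "distr \<mu> Borel (\<lambda>x. fst (x, x)) = \<mu>" "distr \<mu> Borel (\<lambda>x. snd (x, x)) = \<mu>"
      using s by (simp_all add: distr_id2)
    have "(\<integral>\<^sup>+x. ennreal (d (fst (x, x)) (snd (x, x)) powr p) \<partial>\<mu>) = (\<integral>\<^sup>+x. 0 \<partial>\<mu>)"
      using P_D(3)[OF assms] by (intro nn_integral_cong) auto
    then show "(\<integral>\<^sup>+x. ennreal (d (fst (x, x)) (snd (x, x)) powr p) \<partial>\<mu>) \<le> ennreal (0 powr p)" by simp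
  qed
  from W_le[OF this] show ?thesis by (simp add: W_eq)
qed

text \<open>Under a coupling, the mass of \<open>C\<close> either ends up in the open neighbourhood
  \<open>D k\<close> or travels at least 1/(k+1). The latter has arbitrarily small probability by
  Markov's inequality, and the neighbourhoods shrink to \<open>C\<close>.\<close>

lemma W_eq_0_closed_le:
  assumes \<mu>: "\<mu> \<in> P" and \<nu>: "\<nu> \<in> P" and W0: "W \<mu> \<nu> = 0" and C: "closedin mtopology C"
  shows "measure \<mu> C \<le> measure \<nu> C"
proof -
  have s [measurable_cong]: "sets \<mu> = sets Borel" "sets \<nu> = sets Borel" by (rule P_D[OF \<mu>] P_D[OF \<nu>])+
  interpret \<mu>: prob_space \<mu> by (rule P_D[OF \<mu>])
  interpret \<nu>: prob_space \<nu> by (rule P_D[OF \<nu>])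
  have CM: "C \<subseteq> M" using closedin_subset[OF C] by simp
  have Cm [measurable]: "C \<in> sets Borel" by (rule borel_of_closedin[OF C])
  define D where "D k = (\<Union>x\<in>C. mball x (1 / real (Suc k)))" for k
  have D_open: "openin mtopology (D k)" for k unfolding D_def by auto
  have Dm [measurable]: "D k \<in> sets Borel" for k by (rule borel_of_openin[OF D_open])
  have le: "measure \<mu> C \<le> measure \<nu> (D k)" for k
  proof (rule field_le_epsilon)
    fix e :: real assume "e > 0"
    \<comment> \<open>With cost parameter e'/(k+1) and threshold 1/(k+1), the Markov quotient is
      exactly \<open>e'\<close>. Capping at 1 ensures that the parameter does not exceed the
      threshold.\<close>
    define e' where "e' = min e 1"
    have e': "0 < e'" "e' \<le> e" "e' \<le> 1" using \<open>e > 0\<close> by (auto simp: e'_def)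
    define a where "a = e' / real (Suc k)"
    have a: "a > 0" using e' by (simp add: a_def)
    have "coupled a \<mu> \<nu>" using coupled_of_W_less[OF \<mu> \<nu>] W0 a by simp
    then obtain \<gamma> where g: "\<gamma> \<in> Cpl \<mu> \<nu>" "cost p \<gamma> \<le> ennreal (a powr p)"
      unfolding coupled_def by blast
    note c = couplingsD[OF g(1)]
    have [measurable_cong]: "sets \<gamma> = sets Borel2" by (rule c)
    interpret \<gamma>: prob_space \<gamma> by (rule c)
    define F where "F = {z \<in> space \<gamma>. 1 / real (Suc k) \<le> d (fst z) (snd z)}"
    have F [measurable]: "F \<in> sets \<gamma>" unfolding F_def by measurable
    have "emeasure \<gamma> F \<le> ennreal (a / (1 / real (Suc k)))"
      unfolding F_def
      by (rule Markov_powr[OF order]) (use g(2) a e' in \<open>auto simp: cost_def a_def divide_right_mono\<close>)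
    also have "a / (1 / real (Suc k)) = e'" by (simp add: a_def)
    finally have "emeasure \<gamma> F \<le> ennreal e'" .
    then have F_le: "measure \<gamma> F \<le> e" using e' by (simp add: \<gamma>.emeasure_eq_measure)
    have "measure \<mu> C = measure \<gamma> (fst -` C \<inter> space \<gamma>)"
      by (subst c(4)[symmetric], subst measure_distr) auto
    also have "\<dots> \<le> measure \<gamma> ((snd -` D k \<inter> space \<gamma>) \<union> F)"
    proof (rule \<gamma>.finite_measure_mono)
      show "fst -` C \<inter> space \<gamma> \<subseteq> (snd -` D k \<inter> space \<gamma>) \<union> F"
        using CM by (auto simp: D_def F_def c(3)) (meson not_less subsetD)
    qed measurable
    also have "\<dots> \<le> measure \<gamma> (snd -` D k \<inter> space \<gamma>) + measure \<gamma> F"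
      by (intro measure_Un_le) measurable
    also have "measure \<gamma> (snd -` D k \<inter> space \<gamma>) = measure \<nu> (D k)"
      by (subst c(5)[symmetric], subst measure_distr) auto
    finally show "measure \<mu> C \<le> measure \<nu> (D k) + e" using F_le by simp
  qed
  have "decseq D"
  proof (rule decseq_SucI)
    fix k
    have "1 / real (Suc (Suc k)) \<le> 1 / real (Suc k)" by (intro divide_left_mono) auto
    then show "D (Suc k) \<subseteq> D k"
      unfolding D_def by (intro UN_mono order_refl mball_subset_concentric)
  qed
  then have "(\<lambda>k. measure \<nu> (D k)) \<longlonglongrightarrow> measure \<nu> (\<Inter>k. D k)"
    by (intro \<nu>.finite_Lim_measure_decseq) (auto simp only: s image_subset_iff Dm)
  moreover have DC: "(\<Inter>k. D k) = C"
  proof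
    show "C \<subseteq> (\<Inter>k. D k)"
    proof
      fix x assume "x \<in> C"
      then have "x \<in> mball x (1 / real (Suc k))" for k using CM by auto
      then show "x \<in> (\<Inter>k. D k)" using \<open>x \<in> C\<close> unfolding D_def by blast
    qed
    show "(\<Inter>k. D k) \<subseteq> C"
    proof
      fix x assume x: "x \<in> (\<Inter>k. D k)"
      have "\<exists>y\<in>C. y \<in> mball x r" if r: "r > 0" for r
      proof -
        obtain k where k: "1 / real (Suc k) < r" using nat_approx_posE[OF r] by blast
        have "x \<in> D k" using x by blast
        then obtain y where "y \<in> C" "x \<in> mball y (1 / real (Suc k))" unfolding D_def by blast
        then show ?thesis using k by (intro bexI[of _ y]) (auto simp: commute)
      qed
      moreover have "x \<in> M" using x unfolding D_def by auto
      ultimately have "x \<in> mtopology closure_of C" unfolding metric_closure_of by blast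
      then show "x \<in> C" using C by (simp add: closure_of_closedin)
    qed
  qed
  ultimately have "(\<lambda>k. measure \<nu> (D k)) \<longlonglongrightarrow> measure \<nu> C" by simp
  then show ?thesis by (rule LIMSEQ_le_const) (use le in blast)
qed

lemma W_eq_0_imp_eq:
  assumes "\<mu> \<in> P" "\<nu> \<in> P" "W \<mu> \<nu> = 0"
  shows "\<mu> = \<nu>"
proof (rule borel_of_measure_eqI[where X = mtopology])
  note D = P_D[OF assms(1)] and D' = P_D[OF assms(2)]
  interpret \<mu>: prob_space \<mu> by (rule D)
  interpret \<nu>: prob_space \<nu> by (rule D')
  fix U assume U: "openin mtopology U"
  then have "closedin mtopology (M - U)" by blast
  then have "measure \<mu> (M - U) = measure \<nu> (M - U)"
    using W_eq_0_closed_le assms W_commute by (metis antisym)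
  then have "measure \<mu> U = measure \<nu> U"
    using \<mu>.prob_compl[of U] \<nu>.prob_compl[of U] borel_of_openin[OF U] D D' by simp
  then show "emeasure \<mu> U = emeasure \<nu> U"
    by (simp add: \<mu>.emeasure_eq_measure \<nu>.emeasure_eq_measure)
qed (use P_D assms in auto)

lemma Metric_space_W: "Metric_space P W"
proof
  show "W \<mu> \<nu> = 0 \<longleftrightarrow> \<mu> = \<nu>" if "\<mu> \<in> P" "\<nu> \<in> P" for \<mu> \<nu>
    using that W_self W_eq_0_imp_eq by blast
  show "0 \<le> W \<mu> \<nu>" for \<mu> \<nu> by (simp add: W_eq)
qed (rule W_commute W_triangle; assumption?)+

section \<open>Mixtures of measures and the algebra axioms\<close>

lemma mix_in_P:
  assumes \<mu>: "\<mu> \<in> P" and \<nu>: "\<nu> \<in> P" and r: "0 \<le> r" "r \<le> 1"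
  shows "mix_measure r \<mu> \<nu> \<in> P"
proof -
  note D = P_D[OF \<mu>] and D' = P_D[OF \<nu>]
  obtain Q where Q: "countable Q" "Q \<subseteq> M" "AE x in \<mu>. x \<in> mtopology closure_of Q"
    using D(4) unfolding separably_supported_def by blast
  obtain R where R: "countable R" "R \<subseteq> M" "AE x in \<nu>. x \<in> mtopology closure_of R"
    using D'(4) unfolding separably_supported_def by blast
  have "AE x in mix_measure r \<mu> \<nu>. x \<in> mtopology closure_of (Q \<union> R)"
  proof (rule AE_mix_measure)
    show "mtopology closure_of (Q \<union> R) \<in> sets \<mu>" unfolding D(2) by (intro borel_of_closedin closedin_closure_of)
    show "AE x in \<mu>. x \<in> mtopology closure_of (Q \<union> R)"
      using Q(3) by eventually_elim (simp add: closure_of_Un)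
    show "AE x in \<nu>. x \<in> mtopology closure_of (Q \<union> R)"
      using R(3) by eventually_elim (simp add: closure_of_Un)
    show "sets \<nu> = sets \<mu>" by (simp only: D(2) D'(2))
  qed
  then have "separably_supported (mix_measure r \<mu> \<nu>)"
    using Q R unfolding separably_supported_def by (intro exI[of _ "Q \<union> R"]) auto
  moreover obtain x where x: "x \<in> M" using \<mu> by (auto simp: P_iff)
  moreover have "(\<integral>\<^sup>+y. ennreal (d x y powr p) \<partial>mix_measure r \<mu> \<nu>) < \<infinity>"
  proof (subst nn_integral_mix_measure)
    show "sets \<nu> = sets \<mu>" by (simp only: D(2) D'(2))
    have [measurable_cong]: "sets \<mu> = sets Borel" by (rule D)
    show "(\<lambda>y. ennreal (d x y powr p)) \<in> borel_measurable \<mu>" using x by measurable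
    show "ennreal r * (\<integral>\<^sup>+y. ennreal (d x y powr p) \<partial>\<mu>) + ennreal (1 - r) * (\<integral>\<^sup>+y. ennreal (d x y powr p) \<partial>\<nu>) < \<infinity>"
      using moment_finite[OF \<mu> x] moment_finite[OF \<nu> x] by (simp add: ennreal_mult_less_top)
  qed
  ultimately show ?thesis
    using D(1,2) D'(1,2) r unfolding P_iff by (auto intro: prob_space_mix_measure)
qed

text \<open>The cost is linear in the coupling. Mixing nearly optimal couplings therefore bounds the
  p-th power of the distance between mixtures, which is the source of the inequality between p-th
  powers in a Wasserstein algebra.\<close>

lemma mix_couplings:
  assumes g: "\<gamma> \<in> Cpl \<mu> \<mu>'" and g': "\<gamma>' \<in> Cpl \<nu> \<nu>'" and r: "0 \<le> r" "r \<le> 1"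
  shows "mix_measure r \<gamma> \<gamma>' \<in> Cpl (mix_measure r \<mu> \<nu>) (mix_measure r \<mu>' \<nu>')"
    and "cost p (mix_measure r \<gamma> \<gamma>') = ennreal r * cost p \<gamma> + ennreal (1 - r) * cost p \<gamma>'"
proof -
  note c = couplingsD[OF g] and c' = couplingsD[OF g']
  have [measurable_cong]: "sets \<gamma> = sets Borel2" by (rule c)
  have s: "sets \<gamma>' = sets \<gamma>" using c c' by simp
  show "mix_measure r \<gamma> \<gamma>' \<in> Cpl (mix_measure r \<mu> \<nu>) (mix_measure r \<mu>' \<nu>')"
    unfolding couplings_def
    using c c' r s by (auto simp: distr_mix_measure[OF s] intro!: prob_space_mix_measure)
  show "cost p (mix_measure r \<gamma> \<gamma>') = ennreal r * cost p \<gamma> + ennreal (1 - r) * cost p \<gamma>'"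
    unfolding cost_def by (rule nn_integral_mix_measure[OF s]) measurable
qed

lemma W_mix_powr_le:
  assumes "\<mu> \<in> P" "\<nu> \<in> P" "\<mu>' \<in> P" "\<nu>' \<in> P" and r: "0 \<le> r" "r \<le> 1"
  shows "W (mix_measure r \<mu> \<nu>) (mix_measure r \<mu>' \<nu>') powr p \<le> r * W \<mu> \<mu>' powr p + (1 - r) * W \<nu> \<nu>' powr p"
proof -
  let ?C = "W_cost (mix_measure r \<mu> \<nu>) (mix_measure r \<mu>' \<nu>')"
  obtain a where a: "W_cost \<mu> \<mu>' = ennreal a" "0 \<le> a"
    using W_cost_finite[of \<mu> \<mu>'] assms by (cases "W_cost \<mu> \<mu>'") auto
  obtain b where b: "W_cost \<nu> \<nu>' = ennreal b" "0 \<le> b"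
    using W_cost_finite[of \<nu> \<nu>'] assms by (cases "W_cost \<nu> \<nu>'") auto
  have "?C \<le> ennreal (r * a + (1 - r) * b)"
  proof (rule ennreal_le_epsilon)
    fix e :: real assume e: "e > 0"
    have "W_cost \<mu> \<mu>' < ennreal (a + e)" "W_cost \<nu> \<nu>' < ennreal (b + e)"
      using a b e by (auto simp: ennreal_less_iff)
    then obtain \<gamma> \<gamma>' where g: "\<gamma> \<in> Cpl \<mu> \<mu>'" "cost p \<gamma> < ennreal (a + e)"
        and g': "\<gamma>' \<in> Cpl \<nu> \<nu>'" "cost p \<gamma>' < ennreal (b + e)"
      unfolding W_cost_def INF_less_iff by blast
    have "?C \<le> cost p (mix_measure r \<gamma> \<gamma>')"
      unfolding W_cost_def by (rule INF_lower) (rule mix_couplings[OF g(1) g'(1) r])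
    also have "\<dots> = ennreal r * cost p \<gamma> + ennreal (1 - r) * cost p \<gamma>'"
      by (rule mix_couplings[OF g(1) g'(1) r])
    also have "\<dots> \<le> ennreal r * ennreal (a + e) + ennreal (1 - r) * ennreal (b + e)"
      using g g' by (intro add_mono mult_left_mono) (auto intro: less_imp_le)
    also have "\<dots> = ennreal (r * (a + e) + (1 - r) * (b + e))"
      using r a b e by (simp add: ennreal_mult)
    also have "r * (a + e) + (1 - r) * (b + e) = r * a + (1 - r) * b + e"
      by (simp add: algebra_simps)
    also have "\<dots> = ennreal (r * a + (1 - r) * b) + ennreal e"
      using r a b e by (intro ennreal_plus) auto
    finally show "?C \<le> ennreal (r * a + (1 - r) * b) + ennreal e" .
  qed
  then have "enn2real (?C) \<le> r * a + (1 - r) * b"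
  proof -
    assume "?C \<le> ennreal (r * a + (1 - r) * b)"
    moreover have "0 \<le> r * a + (1 - r) * b" using r a b by simp
    ultimately show ?thesis by (metis enn2real_mono enn2real_ennreal ennreal_less_top)
  qed
  then show ?thesis using a b by (simp add: W_powr)
qed

lemma Wasserstein_algebra_P: "Wasserstein_algebra p P W mix_measure"
proof -
  have eqI: "\<mu> = \<nu>" if "\<mu> \<in> P" "\<nu> \<in> P" "\<And>B. B \<in> sets Borel \<Longrightarrow> measure \<mu> B = measure \<nu> B" for \<mu> \<nu>
    using that P_D(1,2)[OF that(1)] P_D(1,2)[OF that(2)] by (intro prob_space_measure_eqI) auto
  have meas: "measure (mix_measure r \<mu> \<nu>) B = r * measure \<mu> B + (1 - r) * measure \<nu> B"
    if "\<mu> \<in> P" "\<nu> \<in> P" "0 \<le> r" "r \<le> 1" "B \<in> sets Borel" for \<mu> \<nu> B and r :: real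
    using that P_D(1,2)[OF that(1)] P_D(1,2)[OF that(2)] by (intro measure_mix_measure) auto
  have bary: "barycentric_algebra P mix_measure"
  proof
    fix r q :: real and \<mu> \<nu> \<rho>
    show "mix_measure r \<mu> \<nu> \<in> P" if "0 \<le> r" "r \<le> 1" "\<mu> \<in> P" "\<nu> \<in> P"
      using that by (intro mix_in_P)
    show "mix_measure 1 \<mu> \<nu> = \<mu>" if "\<mu> \<in> P" "\<nu> \<in> P"
      by (rule eqI) (use that in \<open>auto simp: meas intro: mix_in_P\<close>)
    show "mix_measure r \<mu> \<mu> = \<mu>" if "0 \<le> r" "r \<le> 1" "\<mu> \<in> P"
      by (rule eqI) (use that in \<open>auto simp: meas algebra_simps intro: mix_in_P\<close>)
    show "mix_measure r \<mu> \<nu> = mix_measure (1 - r) \<nu> \<mu>" if "0 \<le> r" "r \<le> 1" "\<mu> \<in> P" "\<nu> \<in> P"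
      by (rule eqI) (use that in \<open>auto simp: meas intro: mix_in_P\<close>)
    show "mix_measure r (mix_measure q \<mu> \<nu>) \<rho> = mix_measure (q * r) \<mu> (mix_measure ((r - q * r) / (1 - q * r)) \<nu> \<rho>)"
      if "0 \<le> q" "q < 1" "0 \<le> r" "r < 1" "\<mu> \<in> P" "\<nu> \<in> P" "\<rho> \<in> P"
    proof -
      have qr: "q * r \<le> r" "q * r < 1" "0 \<le> q * r"
        using that mult_right_mono[of q 1 r] by auto
      define t where "t = (r - q * r) / (1 - q * r)"
      have t: "0 \<le> t" "t \<le> 1" using qr that by (auto simp: t_def)
      have "(1 - q * r) * t = r - q * r" using qr by (simp add: t_def)
      \<comment> \<open>Multiplication by the positive number 1 - q * r removes the quotient
        \<open>t\<close>; what remains of associativity is a polynomial identity.\<close>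
      then have t': "(1 - q * r) * (t * x + (1 - t) * y) = (r - q * r) * x + (1 - r) * y" for x y
        by algebra
      show ?thesis
        unfolding t_def[symmetric]
      proof (rule eqI)
        fix B assume "B \<in> sets Borel"
        then show "measure (mix_measure r (mix_measure q \<mu> \<nu>) \<rho>) B
            = measure (mix_measure (q * r) \<mu> (mix_measure t \<nu> \<rho>)) B"
          using that t qr by (simp add: meas mix_in_P t') (simp add: algebra_simps)
      qed (use that t qr in \<open>auto intro!: mix_in_P\<close>)
    qed
  qed
  interpret W: Metric_space P W by (rule Metric_space_W)
  have powr: "W (mix_measure r \<mu> \<nu>) (mix_measure r \<mu>' \<nu>') powr p \<le> r * W \<mu> \<mu>' powr p + (1 - r) * W \<nu> \<nu>' powr p"
    if "0 \<le> r" "r \<le> 1" "\<mu> \<in> P" "\<nu> \<in> P" "\<mu>' \<in> P" "\<nu>' \<in> P" for r :: real and \<mu> \<nu> \<mu>' \<nu>'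
    using that by (intro W_mix_powr_le)
  have "Wasserstein_algebra_axioms p P W mix_measure"
  proof
    fix r :: real and \<mu> \<nu> \<mu>' \<nu>'
    assume *: "0 \<le> r" "r \<le> 1" "\<mu> \<in> P" "\<nu> \<in> P" "\<mu>' \<in> P" "\<nu>' \<in> P"
    \<comment> \<open>A weighted mean of p-th powers is at most the largest of them, so
      nonexpansiveness for the max metric follows from the inequality between p-th powers.\<close>
    define m where "m = max (W \<mu> \<mu>') (W \<nu> \<nu>')"
    have "r * W \<mu> \<mu>' powr p + (1 - r) * W \<nu> \<nu>' powr p \<le> r * m powr p + (1 - r) * m powr p"
      using * order by (intro add_mono mult_left_mono powr_mono2) (auto simp: m_def)
    also have "\<dots> = m powr p" by (simp add: algebra_simps)
    finally have "W (mix_measure r \<mu> \<nu>) (mix_measure r \<mu>' \<nu>') powr p \<le> m powr p"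
      using powr[OF *] by linarith
    moreover have "0 \<le> m" by (simp add: m_def le_max_iff_disj)
    ultimately show "W (mix_measure r \<mu> \<nu>) (mix_measure r \<mu>' \<nu>') \<le> max (W \<mu> \<mu>') (W \<nu> \<nu>')"
      unfolding m_def[symmetric] using order powr_less_mono2[of p m "W (mix_measure r \<mu> \<nu>) (mix_measure r \<mu>' \<nu>')"]
      by linarith
  qed (rule powr)
  then show ?thesis by (intro Wasserstein_algebra.intro bary Metric_space_W)
qed

lemma dirac_nonexpansive: "nonexpansive_map M d P W dirac"
  unfolding nonexpansive_map_def
  using dirac_in_P W_le[OF coupled_dirac_dirac] by auto

end

section \<open>Finitely supported measures\<close>

lemma prob_space_eqI_finite_support:
  assumes "prob_space \<mu>" "prob_space \<nu>" and sets: "sets \<mu> = sets \<nu>"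
    and S: "finite S" "\<And>s. s \<in> S \<Longrightarrow> {s} \<in> sets \<mu>" "AE x in \<mu>. x \<in> S" "AE x in \<nu>. x \<in> S"
    and eq: "\<And>s. s \<in> S \<Longrightarrow> measure \<mu> {s} = measure \<nu> {s}"
  shows "\<mu> = \<nu>"
proof (rule prob_space_measure_eqI)
  interpret \<mu>: prob_space \<mu> by fact
  interpret \<nu>: prob_space \<nu> by fact
  fix B assume B: "B \<in> sets \<mu>"
  have fin: "C \<in> sets \<mu>" if "C \<subseteq> S" for C
  proof -
    have "(\<Union>s\<in>C. {s}) \<in> sets \<mu>"
      using that S finite_subset[OF that S(1)] by (intro sets.finite_UN) auto
    then show ?thesis by simp
  qed
  have "measure \<mu> B = measure \<mu> (B \<inter> S)"
    using S(3) B fin by (intro measure_eq_AE) auto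
  also have "\<dots> = (\<Sum>s\<in>B \<inter> S. measure \<mu> {s})"
    using S by (intro \<mu>.finite_measure_eq_sum_singleton) auto
  also have "\<dots> = (\<Sum>s\<in>B \<inter> S. measure \<nu> {s})" using eq by (intro sum.cong) auto
  also have "\<dots> = measure \<nu> (B \<inter> S)"
    using S sets by (intro \<nu>.finite_measure_eq_sum_singleton[symmetric]) auto
  also have "\<dots> = measure \<nu> B"
    using S(4) B fin sets by (intro measure_eq_AE) auto
  finally show "measure \<mu> B = measure \<nu> B" .
qed fact+

lemma point_mass_distr:
  assumes "prob_space \<gamma>" and S: "finite S" "\<And>z. z \<in> S \<Longrightarrow> {z} \<in> sets \<gamma>" "AE z in \<gamma>. z \<in> S"
    and g: "g \<in> \<gamma> \<rightarrow>\<^sub>M N" and x: "{x} \<in> sets N"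
  shows "measure (distr \<gamma> N g) {x} = (\<Sum>z | z \<in> S \<and> g z = x. measure \<gamma> {z})"
proof -
  interpret prob_space \<gamma> by fact
  have "measure (distr \<gamma> N g) {x} = measure \<gamma> (g -` {x} \<inter> space \<gamma>)"
    by (rule measure_distr[OF g x])
  also have "\<dots> = measure \<gamma> {z. z \<in> S \<and> g z = x}"
  proof (rule measure_eq_AE[OF _ measurable_sets[OF g x]])
    show "AE z in \<gamma>. z \<in> g -` {x} \<inter> space \<gamma> \<longleftrightarrow> z \<in> {z. z \<in> S \<and> g z = x}"
      using S(3) AE_space by eventually_elim auto
    have "(\<Union>z\<in>{z. z \<in> S \<and> g z = x}. {z}) \<in> sets \<gamma>" using S by (intro sets.finite_UN) auto
    then show "{z. z \<in> S \<and> g z = x} \<in> sets \<gamma>" by simp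
  qed
  also have "\<dots> = (\<Sum>z | z \<in> S \<and> g z = x. measure \<gamma> {z})"
    using S by (intro finite_measure_eq_sum_singleton) auto
  finally show ?thesis .
qed

lemma sum_point_masses:
  assumes "prob_space \<mu>" "finite S" "\<And>s. s \<in> S \<Longrightarrow> {s} \<in> sets \<mu>" "AE x in \<mu>. x \<in> S"
  shows "(\<Sum>s\<in>S. measure \<mu> {s}) = 1"
proof -
  \<comment> \<open>Collapsing everything to one point makes the total mass a single point mass,
    whose formula is \<open>point_mass_distr\<close>.\<close>
  have "distr \<mu> (count_space UNIV) (\<lambda>_. ()) = return (count_space UNIV) ()"
    using prob_space.distr_const[OF assms(1), of "()" "count_space UNIV"] by simp
  then show ?thesis
    using point_mass_distr[OF assms, of "\<lambda>_. ()" "count_space UNIV" "()"] by (simp add: measure_return)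
qed

text \<open>A fixed atomless probability space on which all finitely supported approximants are
  realised together.\<close>

definition U01 :: "real measure" where
  "U01 = uniform_measure lborel {0..1}"

lemma prob_space_U01: "prob_space U01"
  unfolding U01_def by (rule prob_space_uniform_measure) auto

lemma sets_U01 [simp, measurable_cong]: "sets U01 = sets borel"
  and space_U01 [simp]: "space U01 = UNIV"
  by (simp_all add: U01_def)

lemma measure_U01: "A \<in> sets borel \<Longrightarrow> measure U01 A = measure lborel ({0..1} \<inter> A)"
  unfolding U01_def by (subst measure_uniform_measure) auto

text \<open>The mass of the part of \<open>A\<close> up to \<open>t\<close> is 1-Lipschitz in
  \<open>t\<close> and runs from 0 to the mass of \<open>A\<close>, so it takes the value
  \<open>c\<close> by the intermediate value theorem.\<close>

lemma U01_split:
  assumes A [measurable]: "A \<in> sets borel" and c: "0 \<le> c" "c \<le> measure U01 A"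
  obtains B where "B \<subseteq> A" "B \<in> sets borel" "measure U01 B = c"
proof -
  interpret U: prob_space U01 by (rule prob_space_U01)
  define F where "F t = measure U01 (A \<inter> {..t})" for t
  have F_diff: "F t - F s = measure U01 (A \<inter> {s<..t})" if "s \<le> t" for s t
  proof -
    have "F t - F s = measure U01 (A \<inter> {..t} - A \<inter> {..s})"
      unfolding F_def using that by (intro U.finite_measure_Diff[symmetric]) auto
    also have "A \<inter> {..t} - A \<inter> {..s} = A \<inter> {s<..t}" by auto
    finally show ?thesis .
  qed
  have F_lip: "\<bar>F t - F s\<bar> \<le> t - s" if "s \<le> t" for s t
  proof -
    have "measure U01 (A \<inter> {s<..t}) = measure lborel ({0..1} \<inter> (A \<inter> {s<..t}))"
      by (intro measure_U01) measurable
    also have "\<dots> \<le> measure lborel {s<..t}"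
      using that by (intro measure_mono_fmeasurable) (auto simp: fmeasurable_def)
    also have "\<dots> = t - s" using that by simp
    finally show ?thesis using F_diff[OF that] by (simp add: measure_nonneg)
  qed
  have "1-lipschitz_on {-1..1} F"
  proof (rule lipschitz_onI)
    fix s t show "dist (F s) (F t) \<le> 1 * dist s t"
      using F_lip[of s t] F_lip[of t s] by (cases "s \<le> t") (auto simp: dist_real_def abs_minus_commute)
  qed simp
  then have "continuous_on {-1..1} F" by (rule lipschitz_on_continuous_on)
  moreover have "F (-1) = 0"
  proof -
    have "{0..1} \<inter> (A \<inter> {..-1}) = ({} :: real set)" by auto
    then show ?thesis unfolding F_def by (subst measure_U01) auto
  qed
  moreover have "F 1 = measure U01 A"
  proof -
    have "{0..1} \<inter> (A \<inter> {..1}) = {0..1::real} \<inter> A" by auto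
    then show ?thesis unfolding F_def by (simp add: measure_U01)
  qed
  ultimately obtain t where "F t = c" using IVT'[of F "-1" c 1] c by auto
  then show thesis by (intro that[of "A \<inter> {..t}"]) (auto simp: F_def)
qed

text \<open>Pieces of mass \<open>c y\<close> are cut off one after another by
  \<open>U01_split\<close>; what is left over has exactly the mass of the remaining weights. The
  last index takes all the rest.\<close>

lemma U01_partition:
  assumes "finite G" "G \<noteq> {}" "A \<in> sets borel" "\<And>y. y \<in> G \<Longrightarrow> 0 \<le> c y"
    and "(\<Sum>y\<in>G. c y) = measure U01 A"
  shows "\<exists>h. (\<forall>t. h t \<in> G) \<and>
    (\<forall>y\<in>G. {t \<in> A. h t = y} \<in> sets borel \<and> measure U01 {t \<in> A. h t = y} = c y)"
  using assms
proof (induction G arbitrary: A rule: finite_ne_induct)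
  case (singleton y)
  then show ?case by (intro exI[of _ "\<lambda>_. y"]) auto
next
  case (insert y G)
  interpret U: prob_space U01 by (rule prob_space_U01)
  have sum: "c y + (\<Sum>y\<in>G. c y) = measure U01 A" using insert by simp
  moreover have "0 \<le> (\<Sum>y\<in>G. c y)" using insert by (intro sum_nonneg) auto
  ultimately obtain B where B: "B \<subseteq> A" "B \<in> sets borel" "measure U01 B = c y"
    using U01_split[of A "c y"] insert by auto
  have "measure U01 (A - B) = measure U01 A - measure U01 B"
    using B insert by (intro U.finite_measure_Diff) auto
  then have "(\<Sum>y\<in>G. c y) = measure U01 (A - B)" using sum B by simp
  then have "\<exists>h. (\<forall>t. h t \<in> G) \<and>
      (\<forall>y\<in>G. {t \<in> A - B. h t = y} \<in> sets borel \<and> measure U01 {t \<in> A - B. h t = y} = c y)"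
    using insert.prems B by (intro insert.IH) auto
  then obtain h where h: "\<And>t. h t \<in> G"
      "\<And>z. z \<in> G \<Longrightarrow> {t \<in> A - B. h t = z} \<in> sets borel \<and> measure U01 {t \<in> A - B. h t = z} = c z"
    by blast
  define k where "k t = (if t \<in> B then y else h t)" for t
  have "{t \<in> A. k t = y} = B" using h(1) insert.hyps B(1) by (auto simp: k_def)
  moreover have "{t \<in> A. k t = z} = {t \<in> A - B. h t = z}" if "z \<in> G" for z
    using that insert.hyps by (auto simp: k_def)
  ultimately have "\<forall>z\<in>insert y G. {t \<in> A. k t = z} \<in> sets borel \<and> measure U01 {t \<in> A. k t = z} = c z"
    using B h(2) by simp
  moreover have "\<forall>t. k t \<in> insert y G" using h(1) by (simp add: k_def)
  ultimately show ?case by blast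
qed

section \<open>Measurability of maps with finite range and of their limits\<close>

context Metric_space
begin

lemma finite_in_sets_Borel: "finite F \<Longrightarrow> F \<subseteq> M \<Longrightarrow> F \<in> sets Borel"
  by (intro borel_of_closedin t1_space_closedin_finite[THEN iffD1, rule_format] conjI)
     (auto intro: Hausdorff_imp_t1_space Hausdorff_space_mtopology)

lemma singleton_in_sets_Borel: "x \<in> M \<Longrightarrow> {x} \<in> sets Borel"
  by (intro finite_in_sets_Borel) auto

lemma singleton_in_sets_Borel2:
  assumes "x \<in> M" "y \<in> M"
  shows "{(x, y)} \<in> sets Borel2"
proof -
  have "(fst -` {x} \<inter> space Borel2) \<inter> (snd -` {y} \<inter> space Borel2) \<in> sets Borel2"
    using singleton_in_sets_Borel assms
    by (intro sets.Int measurable_sets[OF measurable_fst_Borel2] measurable_sets[OF measurable_snd_Borel2])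
  also have "(fst -` {x} \<inter> space Borel2) \<inter> (snd -` {y} \<inter> space Borel2) = {(x, y)}"
    using assms by auto
  finally show ?thesis .
qed

lemma measurable_finite_range:
  assumes F: "finite F" "F \<subseteq> M" and f: "\<And>x. x \<in> space N \<Longrightarrow> f x \<in> F"
    and m: "\<And>y. y \<in> F \<Longrightarrow> {x \<in> space N. f x = y} \<in> sets N"
  shows "f \<in> N \<rightarrow>\<^sub>M Borel"
proof (rule measurable_borel_ofI)
  show "f \<in> space N \<rightarrow> topspace mtopology" using F f by auto
  fix U
  have "f -` U \<inter> space N = (\<Union>y\<in>F \<inter> U. {x \<in> space N. f x = y})" using f by auto
  also have "\<dots> \<in> sets N" using F m by (intro sets.finite_UN) auto
  finally show "f -` U \<inter> space N \<in> sets N" .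
qed

text \<open>That \<open>X n x\<close> is eventually in \<open>U\<close> does not force the limit
  into \<open>U\<close>. The right condition is that, for some \<open>k\<close>, the balls of radius
  1/(k+1) about \<open>X n x\<close> eventually lie in \<open>U\<close>; each such event is
  measurable because only finitely many centres occur.\<close>

lemma measurable_limit_finite_range:
  assumes X: "\<And>n. X n \<in> N \<rightarrow>\<^sub>M Borel" and F: "\<And>n. finite (F n)" "\<And>n x. x \<in> space N \<Longrightarrow> X n x \<in> F n"
    and lim: "\<And>x. x \<in> space N \<Longrightarrow> limitin mtopology (\<lambda>n. X n x) (Y x) sequentially"
  shows "Y \<in> N \<rightarrow>\<^sub>M Borel"
proof (rule measurable_borel_ofI)
  show "Y \<in> space N \<rightarrow> topspace mtopology" using limitin_topspace[OF lim] by auto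
  fix U assume U: "openin mtopology U"
  define B where "B n k = {x \<in> space N. mball (X n x) (1 / real (Suc k)) \<subseteq> U}" for n k
  have XM: "X n x \<in> M" if "x \<in> space N" for n x using measurable_space[OF X that] by simp
  have B: "B n k \<in> sets N" for n k
  proof -
    have "B n k = (\<Union>v\<in>{v \<in> F n \<inter> M. mball v (1 / real (Suc k)) \<subseteq> U}. X n -` {v} \<inter> space N)"
      using F(2) XM by (auto simp: B_def)
    also have "\<dots> \<in> sets N"
      using F(1) by (intro sets.finite_UN measurable_sets[OF X] finite_in_sets_Borel) auto
    finally show ?thesis .
  qed
  have "Y -` U \<inter> space N = (\<Union>k m. \<Inter>n\<in>{m..}. B n k)" (is "?L = ?R")
  proof (intro set_eqI iffI)
    fix x assume x: "x \<in> ?L"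
    then have YM: "Y x \<in> M" using openin_subset[OF U] by auto
    obtain r where r: "r > 0" "mball (Y x) r \<subseteq> U" using x U by (auto simp: openin_mtopology)
    obtain k where k: "1 / real (Suc k) < r / 2" using nat_approx_posE[of "r/2"] r by auto
    have "\<exists>m. \<forall>n\<ge>m. X n x \<in> M \<and> d (X n x) (Y x) < r / 2"
      using lim[of x] x r unfolding limit_metric_sequentially by (meson IntD2 half_gt_zero)
    then obtain m where m: "\<And>n. n \<ge> m \<Longrightarrow> X n x \<in> M \<and> d (X n x) (Y x) < r / 2" by blast
    have "mball (X n x) (1 / real (Suc k)) \<subseteq> U" if "n \<ge> m" for n
      using mball_subset[of "X n x" "Y x" "1 / real (Suc k)" r] m[OF that] k YM r(2) by auto
    then have "x \<in> (\<Inter>n\<in>{m..}. B n k)" using x by (auto simp: B_def)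
    then show "x \<in> ?R" by blast
  next
    fix x assume "x \<in> ?R"
    then obtain k m where km: "\<And>n. n \<ge> m \<Longrightarrow> x \<in> B n k" by auto
    then have x: "x \<in> space N" unfolding B_def by blast
    have "0 < 1 / real (Suc k)" by simp
    then obtain m' where m': "\<And>n. n \<ge> m' \<Longrightarrow> d (X n x) (Y x) < 1 / real (Suc k)"
      using lim[OF x] unfolding limit_metric_sequentially by meson
    have "Y x \<in> mball (X (max m m') x) (1 / real (Suc k))"
      using m'[of "max m m'"] XM[OF x] limitin_topspace[OF lim[OF x]] by simp
    moreover have "mball (X (max m m') x) (1 / real (Suc k)) \<subseteq> U"
      using km[of "max m m'"] by (simp add: B_def)
    ultimately show "x \<in> ?L" using x by blast
  qed
  also have "\<dots> \<in> sets N"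
  proof -
    have "(\<Inter>n\<in>{m..}. B n k) \<in> sets N" for k m
      by (rule sets.countable_INT') (use B in auto)
    then show ?thesis by (intro sets.countable_UN'') auto
  qed
  finally show "Y -` U \<inter> space N \<in> sets N" .
qed

end

section \<open>Density of finitely supported measures and their realisation on [0, 1]\<close>

context complete_metric_order
begin

definition Fin :: "'a measure set" where
  "Fin = {\<mu> \<in> P. \<exists>F. finite F \<and> F \<subseteq> M \<and> (AE x in \<mu>. x \<in> F)}"

lemma distr_in_Fin:
  assumes "prob_space N" and f [measurable]: "f \<in> N \<rightarrow>\<^sub>M Borel"
    and F: "finite F" "\<And>x. x \<in> space N \<Longrightarrow> f x \<in> F"
  shows "distr N Borel f \<in> Fin"
proof -
  interpret prob_space N by fact
  define F' where "F' = F \<inter> M"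
  have F': "finite F'" "F' \<subseteq> M" "\<And>x. x \<in> space N \<Longrightarrow> f x \<in> F'"
    using F measurable_space[OF f] by (auto simp: F'_def)
  obtain x where "x \<in> space N" using not_empty by blast
  then obtain x0 where x0: "x0 \<in> F'" "x0 \<in> M" using F' by blast
  have AE: "AE x in distr N Borel f. x \<in> F'"
    using F' finite_in_sets_Borel[OF F'(1,2)] by (subst AE_distr_iff) auto
  then have "AE x in distr N Borel f. x \<in> mtopology closure_of F'"
    by eventually_elim (use closure_of_subset[of F' mtopology] F' in auto)
  then have "separably_supported (distr N Borel f)"
    using F' unfolding separably_supported_def by (auto intro: countable_finite)
  moreover have "(\<integral>\<^sup>+x. ennreal (d x0 x powr p) \<partial>distr N Borel f) < \<infinity>"
  proof -
    have "(\<integral>\<^sup>+x. ennreal (d x0 x powr p) \<partial>distr N Borel f) = (\<integral>\<^sup>+x. ennreal (d x0 (f x) powr p) \<partial>N)"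
      using x0 by (subst nn_integral_distr) auto
    also have "\<dots> \<le> (\<integral>\<^sup>+x. ennreal (\<Sum>y\<in>F'. d x0 y powr p) \<partial>N)"
      using F' by (intro nn_integral_mono ennreal_leI member_le_sum) auto
    also have "\<dots> < \<infinity>" by (simp add: emeasure_space_1)
    finally show ?thesis .
  qed
  ultimately have "distr N Borel f \<in> P"
    using x0 by (auto simp: P_iff intro!: prob_space_distr)
  then show ?thesis using AE F' by (auto simp: Fin_def)
qed

text \<open>Points within e' of one of q 0, ..., q N move to the first such \<open>q n\<close>, and
  the remaining set \<open>A N\<close> is sent to \<open>x0\<close>. The latter costs the integral
  of d(x0, -)^p over \<open>A N\<close>, which vanishes as \<open>N\<close> grows because the moment
  is finite.\<close>

lemma Fin_dense:
  assumes \<mu>: "\<mu> \<in> P" and "e > 0"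
  shows "\<exists>\<nu>\<in>Fin. W \<nu> \<mu> < e"
proof -
  have s [measurable_cong]: "sets \<mu> = sets Borel" by (rule P_D[OF \<mu>])
  have sp: "space \<mu> = M" by (rule P_D[OF \<mu>])
  interpret prob_space \<mu> by (rule P_D[OF \<mu>])
  obtain x0 where x0 [measurable]: "x0 \<in> M" using \<mu> by (auto simp: P_iff)
  obtain q :: "nat \<Rightarrow> 'a" where qM [measurable]: "\<And>n. q n \<in> M" and q: "AE x in \<mu>. x \<in> mtopology closure_of (range q)"
    using separably_supportedE[OF P_D(1,4)[OF \<mu>]] by blast
  \<comment> \<open>Near points and far points each contribute at most e'^p, and 2 e'^p \<le> (2
    e')^p = (e/2)^p because p \<ge> 1. This leaves a strict inequality.\<close>
  define e' where "e' = e / 4"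
  have e': "e' > 0" using \<open>e > 0\<close> by (simp add: e'_def)
  define \<iota> where "\<iota> x = (LEAST n. d (q n) x < e')" for x
  have \<iota> [measurable]: "\<iota> \<in> Borel \<rightarrow>\<^sub>M count_space UNIV" unfolding \<iota>_def by measurable
  define A where "A N = {x \<in> M. \<forall>n\<in>{..N}. \<not> d (q n) x < e'}" for N :: nat
  have A [measurable]: "A N \<in> sets \<mu>" for N
  proof -
    have "{x \<in> space \<mu>. \<forall>n\<in>{..N}. \<not> d (q n) x < e'} \<in> sets \<mu>" by measurable
    then show ?thesis using sp by (simp add: A_def)
  qed
  \<comment> \<open>The moment as a finite measure, so that smallness of the tail over
    \<open>A N\<close> is continuity from above.\<close>
  define \<eta> where "\<eta> = density \<mu> (\<lambda>x. ennreal (d x0 x powr p))"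
  have \<eta>: "emeasure \<eta> B = (\<integral>\<^sup>+x. ennreal (d x0 x powr p) * indicator B x \<partial>\<mu>)" if "B \<in> sets \<mu>" for B
    unfolding \<eta>_def by (rule emeasure_density[OF _ that]) measurable
  have "(\<lambda>N. emeasure \<eta> (A N)) \<longlonglongrightarrow> emeasure \<eta> (\<Inter>N. A N)"
  proof (rule Lim_emeasure_decseq)
    show "range A \<subseteq> sets \<eta>" using A by (auto simp: \<eta>_def)
    show "decseq A" by (auto simp: decseq_def A_def)
    fix N
    have "emeasure \<eta> (A N) \<le> (\<integral>\<^sup>+x. ennreal (d x0 x powr p) \<partial>\<mu>)"
      unfolding \<eta>[OF A] by (intro nn_integral_mono) (auto simp: indicator_def)
    then show "emeasure \<eta> (A N) \<noteq> \<infinity>" using moment_finite[OF \<mu> x0] by auto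
  qed
  moreover have "emeasure \<eta> (\<Inter>N. A N) = 0"
  proof -
    have nA: "AE x in \<mu>. x \<notin> (\<Inter>N. A N)"
      using q
    proof eventually_elim
      case (elim x)
      then obtain i where "q i \<in> mball x e'"
        using e' unfolding metric_closure_of by blast
      then have "d (q i) x < e'" by (simp add: commute)
      then have "x \<notin> A i" by (auto simp: A_def)
      then show ?case by blast
    qed
    have "(\<integral>\<^sup>+x. ennreal (d x0 x powr p) * indicator (\<Inter>N. A N) x \<partial>\<mu>) = (\<integral>\<^sup>+x. 0 \<partial>\<mu>)"
    proof (rule nn_integral_cong_AE, use nA in eventually_elim)
      fix x assume "x \<notin> (\<Inter>N. A N)"
      then have "indicator (\<Inter>N. A N) x = (0 :: ennreal)" by (rule indicator_simps)
      then show "ennreal (d x0 x powr p) * indicator (\<Inter>N. A N) x = 0" by (simp only: mult_zero_right)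
    qed
    then show ?thesis using A by (subst \<eta>) auto
  qed
  ultimately have "(\<lambda>N. emeasure \<eta> (A N)) \<longlonglongrightarrow> 0" by simp
  then have "eventually (\<lambda>N. emeasure \<eta> (A N) < ennreal (e' powr p)) sequentially"
    by (rule order_tendstoD) (use e' in auto)
  then obtain N where N: "emeasure \<eta> (A N) < ennreal (e' powr p)"
    unfolding eventually_sequentially by blast
  define \<phi> where "\<phi> x = (if x \<in> A N then x0 else q (\<iota> x))" for x
  have \<phi> [measurable]: "\<phi> \<in> \<mu> \<rightarrow>\<^sub>M Borel"
  proof -
    have "(\<lambda>x. q (\<iota> x)) \<in> \<mu> \<rightarrow>\<^sub>M Borel"
      by (rule measurable_compose[where g = q and N = "count_space UNIV"]) (use qM \<iota> in auto)
    moreover have "{x \<in> space \<mu>. x \<in> A N} \<in> sets \<mu>" by measurable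
    ultimately show ?thesis unfolding \<phi>_def using x0 by (intro measurable_If) auto
  qed
  have near: "\<iota> x \<le> N \<and> d (q (\<iota> x)) x < e'" if "x \<in> M" "x \<notin> A N" for x
  proof -
    obtain n where n: "n \<le> N" "d (q n) x < e'" using \<open>x \<in> M\<close> \<open>x \<notin> A N\<close> by (auto simp: A_def)
    then show ?thesis
      unfolding \<iota>_def using LeastI[of "\<lambda>n. d (q n) x < e'" n] Least_le[of "\<lambda>n. d (q n) x < e'" n]
      by (meson order_trans)
  qed
  define F where "F = insert x0 (q ` {..N})"
  have F: "finite F" "F \<subseteq> M" "\<And>x. x \<in> M \<Longrightarrow> \<phi> x \<in> F"
    using x0 qM near by (auto simp: F_def \<phi>_def)
  have Fin: "distr \<mu> Borel \<phi> \<in> Fin"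
    by (rule distr_in_Fin[OF prob_space_axioms \<phi> F(1)]) (simp add: F sp)
  have "coupled (2 * e') (distr \<mu> Borel \<phi>) \<mu>"
  proof (rule coupled_distr[OF prob_space_axioms])
    show "(\<lambda>x. (\<phi> x, x)) \<in> \<mu> \<rightarrow>\<^sub>M Borel2"
      by (rule measurable_Pair_Borel2[where Q = F])
         (use F closure_of_subset[of F mtopology] in \<open>auto simp: sp intro: countable_finite\<close>)
    show "distr \<mu> Borel (\<lambda>x. fst (\<phi> x, x)) = distr \<mu> Borel \<phi>" by simp
    show "distr \<mu> Borel (\<lambda>x. snd (\<phi> x, x)) = \<mu>" using s by (simp add: distr_id2)
    have "(\<integral>\<^sup>+x. ennreal (d (fst (\<phi> x, x)) (snd (\<phi> x, x)) powr p) \<partial>\<mu>)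
        \<le> (\<integral>\<^sup>+x. ennreal (e' powr p) + ennreal (d x0 x powr p) * indicator (A N) x \<partial>\<mu>)"
    proof (rule nn_integral_mono)
      fix x assume "x \<in> space \<mu>"
      then show "ennreal (d (fst (\<phi> x, x)) (snd (\<phi> x, x)) powr p)
          \<le> ennreal (e' powr p) + ennreal (d x0 x powr p) * indicator (A N) x"
        using near[of x] sp order by (cases "x \<in> A N") (auto simp: \<phi>_def add_increasing intro!: ennreal_leI powr_mono2)
    qed
    also have "\<dots> = ennreal (e' powr p) + emeasure \<eta> (A N)"
      unfolding \<eta>[OF A] by (subst nn_integral_add) (auto simp: emeasure_space_1)
    also have "\<dots> \<le> ennreal (e' powr p) + ennreal (e' powr p)" by (intro add_left_mono less_imp_le N)
    also have "\<dots> = ennreal (2 * e' powr p)" by (simp flip: ennreal_plus)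
    also have "\<dots> \<le> ennreal ((2 * e') powr p)"
      using powr_mono[of 1 p 2] order e' by (intro ennreal_leI) (simp add: powr_mult mult_right_mono)
    finally show "(\<integral>\<^sup>+x. ennreal (d (fst (\<phi> x, x)) (snd (\<phi> x, x)) powr p) \<partial>\<mu>) \<le> ennreal ((2 * e') powr p)" .
  qed
  then have "W (distr \<mu> Borel \<phi>) \<mu> \<le> 2 * e'" using e' by (intro W_le) auto
  then show ?thesis using Fin \<open>e > 0\<close> by (intro bexI[of _ "distr \<mu> Borel \<phi>"]) (auto simp: e'_def)
qed

text \<open>Finite range at every point, not just almost surely: this makes pairing with any Borel
  map measurable and lets the level sets be partitioned one at a time.\<close>

definition simple_rv :: "(real \<Rightarrow> 'a) \<Rightarrow> bool" where
  "simple_rv X \<longleftrightarrow> X \<in> borel \<rightarrow>\<^sub>M Borel \<and> (\<exists>F. finite F \<and> F \<subseteq> M \<and> (\<forall>t. X t \<in> F))"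

lemma measurable_simple_rv_Pair:
  assumes "simple_rv X" "Y \<in> borel \<rightarrow>\<^sub>M Borel"
  shows "(\<lambda>t. (X t, Y t)) \<in> borel \<rightarrow>\<^sub>M Borel2"
proof -
  obtain F where F: "finite F" "F \<subseteq> M" "\<And>t. X t \<in> F" using assms(1) by (auto simp: simple_rv_def)
  show ?thesis
    by (rule measurable_Pair_Borel2[where Q = F])
       (use F assms closure_of_subset[of F mtopology] in \<open>auto simp: simple_rv_def intro: countable_finite\<close>)
qed

text \<open>Each level set {X = x} is cut into pieces of mass \<open>\<gamma>\<close> {(x, y)},
  which fit because the first marginal of \<open>\<gamma>\<close> is the law of \<open>X\<close>;
  \<open>Y\<close> is \<open>y\<close> on the corresponding piece. Then (X, Y) and
  \<open>\<gamma>\<close> have the same point masses on a finite carrier, hence the same law, and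
  the cost is attained exactly.\<close>

lemma simple_rv_extend:
  assumes X: "simple_rv X" "distr U01 Borel X = \<nu>" and \<nu>': "\<nu>' \<in> Fin" and \<gamma>: "\<gamma> \<in> Cpl \<nu> \<nu>'"
  shows "\<exists>Y. simple_rv Y \<and> distr U01 Borel Y = \<nu>' \<and>
    (\<integral>\<^sup>+t. ennreal (d (X t) (Y t) powr p) \<partial>U01) = cost p \<gamma>"
proof -
  interpret U: prob_space U01 by (rule prob_space_U01)
  note c = couplingsD[OF \<gamma>]
  interpret \<gamma>: prob_space \<gamma> by (rule c)
  have [measurable_cong]: "sets \<gamma> = sets Borel2" by (rule c)
  have Xm [measurable]: "X \<in> borel \<rightarrow>\<^sub>M Borel" using X by (simp add: simple_rv_def)
  obtain F where F: "finite F" "F \<subseteq> M" "\<And>t. X t \<in> F" using X by (auto simp: simple_rv_def)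
  obtain G where G: "finite G" "G \<subseteq> M" "AE y in \<nu>'. y \<in> G" using \<nu>' by (auto simp: Fin_def)
  note single = singleton_in_sets_Borel
  have "G \<noteq> {}"
  proof
    assume "G = {}"
    then have "AE y in \<nu>'. False" using G(3) by simp
    then show False using prob_space.AE_False[OF c(7)] by simp
  qed
  have AE_G: "AE z in \<gamma>. snd z \<in> G" by (rule AE_coupling_snd[OF \<gamma> G(3)])
  have "AE x in \<nu>. x \<in> F"
    unfolding X(2)[symmetric] using F finite_in_sets_Borel[OF F(1,2)] by (subst AE_distr_iff) auto
  then have AE_F: "AE z in \<gamma>. fst z \<in> F" by (rule AE_coupling_fst[OF \<gamma>])
  have pt: "{(x, y)} \<in> sets \<gamma>" if "x \<in> M" "y \<in> M" for x y
    using singleton_in_sets_Borel2 that by (simp add: c(2))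
  have lev: "{t. X t = x} \<in> sets borel" if "x \<in> M" for x
    using measurable_sets[OF Xm single[OF that]] by (simp add: vimage_def)
  have "\<exists>h. (\<forall>t. h t \<in> G) \<and> (\<forall>y\<in>G. {t \<in> {t. X t = x}. h t = y} \<in> sets borel \<and>
      measure U01 {t \<in> {t. X t = x}. h t = y} = measure \<gamma> {(x, y)})" if x: "x \<in> F" for x
  proof (rule U01_partition)
    have xM: "x \<in> M" using x F by blast
    show "{t. X t = x} \<in> sets borel" by (rule lev[OF xM])
    have "(\<Sum>y\<in>G. measure \<gamma> {(x, y)}) = (\<Sum>z | z \<in> F \<times> G \<and> fst z = x. measure \<gamma> {z})"
      using x by (intro sum.reindex_bij_witness[of _ snd "Pair x"]) auto
    also have "\<dots> = measure (distr \<gamma> Borel fst) {x}"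
    proof (intro point_mass_distr[symmetric] \<gamma>.prob_space_axioms single xM)
      show "AE z in \<gamma>. z \<in> F \<times> G" using AE_F AE_G by eventually_elim (simp add: mem_Times_iff)
      show "{z} \<in> sets \<gamma>" if "z \<in> F \<times> G" for z
        using that pt[OF subsetD[OF F(2)] subsetD[OF G(2)]] by (cases z) simp
    qed (use F(1) G(1) in simp_all)
    also have "\<dots> = measure \<nu> {x}" by (simp only: c(4))
    also have "\<dots> = measure U01 {t. X t = x}"
      using single[OF xM] unfolding X(2)[symmetric] by (subst measure_distr) (auto simp: vimage_def)
    finally show "(\<Sum>y\<in>G. measure \<gamma> {(x, y)}) = measure U01 {t. X t = x}" .
  qed (use G \<open>G \<noteq> {}\<close> in auto)
  then have "\<exists>h. \<forall>x\<in>F. (\<forall>t. h x t \<in> G) \<and> (\<forall>y\<in>G. {t \<in> {t. X t = x}. h x t = y} \<in> sets borel \<and>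
      measure U01 {t \<in> {t. X t = x}. h x t = y} = measure \<gamma> {(x, y)})"
    by (intro bchoice ballI)
  then obtain h where h0: "\<forall>x\<in>F. (\<forall>t. h x t \<in> G) \<and> (\<forall>y\<in>G. {t \<in> {t. X t = x}. h x t = y} \<in> sets borel \<and>
      measure U01 {t \<in> {t. X t = x}. h x t = y} = measure \<gamma> {(x, y)})"
    by (elim exE)
  have h: "\<And>x t. x \<in> F \<Longrightarrow> h x t \<in> G"
      "\<And>x y. x \<in> F \<Longrightarrow> y \<in> G \<Longrightarrow> {t \<in> {t. X t = x}. h x t = y} \<in> sets borel"
      "\<And>x y. x \<in> F \<Longrightarrow> y \<in> G \<Longrightarrow> measure U01 {t \<in> {t. X t = x}. h x t = y} = measure \<gamma> {(x, y)}"
    using h0 by blast+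
  define Y where "Y t = h (X t) t" for t
  have YG: "Y t \<in> G" for t using h(1) F(3) by (simp add: Y_def)
  have Ym [measurable]: "Y \<in> borel \<rightarrow>\<^sub>M Borel"
  proof (rule measurable_finite_range[OF G(1,2)])
    fix y assume y: "y \<in> G"
    have "{t \<in> space borel. Y t = y} = (\<Union>x\<in>F. {t \<in> {t. X t = x}. h x t = y})"
      using F(3) by (auto simp: Y_def)
    also have "\<dots> \<in> sets borel" using F y h(2) by (intro sets.finite_UN) auto
    finally show "{t \<in> space borel. Y t = y} \<in> sets borel" .
  qed (rule YG)
  have Y: "simple_rv Y" using Ym YG G by (auto simp: simple_rv_def)
  have Z [measurable]: "(\<lambda>t. (X t, Y t)) \<in> borel \<rightarrow>\<^sub>M Borel2"
    by (rule measurable_simple_rv_Pair[OF X(1) Ym])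
  then have ZU: "(\<lambda>t. (X t, Y t)) \<in> U01 \<rightarrow>\<^sub>M Borel2" by simp
  let ?D = "distr U01 Borel2 (\<lambda>t. (X t, Y t))"
  have eq: "?D = \<gamma>"
  proof (rule prob_space_eqI_finite_support)
    show "prob_space (?D)" by (rule U.prob_space_distr) simp
    show "prob_space \<gamma>" by (rule c)
    show "sets (?D) = sets \<gamma>" by (simp add: c(2))
    show "finite (F \<times> G)" using F G by simp
    show sg: "{s} \<in> sets (?D)" if "s \<in> F \<times> G" for s
      using that pt[unfolded c(2), OF subsetD[OF F(2)] subsetD[OF G(2)]] by (cases s) simp
    have "(\<Union>s\<in>F \<times> G. {s}) \<in> sets (?D)"
      using sg F G by (intro sets.finite_UN) auto
    moreover have "{s \<in> M \<times> M. s \<in> F \<times> G} = F \<times> G" using F(2) G(2) by blast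
    ultimately show "AE s in ?D. s \<in> F \<times> G"
      using F(3) YG by (subst AE_distr_iff) simp_all
    show "AE s in \<gamma>. s \<in> F \<times> G"
      using AE_F AE_G by eventually_elim (auto simp: mem_Times_iff)
    fix s assume "s \<in> F \<times> G"
    then obtain x y where xy: "s = (x, y)" "x \<in> F" "y \<in> G" by auto
    then have "{(x, y)} \<in> sets Borel2" using pt[unfolded c(2), OF subsetD[OF F(2)] subsetD[OF G(2)]] by blast
    then have "measure (?D) {(x, y)}
        = measure U01 {t \<in> {t. X t = x}. h x t = y}"
      by (subst measure_distr[OF ZU]) (auto simp: Y_def intro!: arg_cong[where f = "measure U01"])
    then show "measure (?D) {s} = measure \<gamma> {s}"
      using h(3) xy by simp
  qed
  have "cost p \<gamma> = (\<integral>\<^sup>+t. ennreal (d (X t) (Y t) powr p) \<partial>U01)"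
    unfolding eq[symmetric] by (subst cost_distr) auto
  moreover have "distr U01 Borel Y = \<nu>'"
  proof -
    have "distr U01 Borel Y = distr (?D) Borel snd"
      by (subst distr_distr) (auto simp: comp_def)
    then show ?thesis by (simp add: eq c(5))
  qed
  ultimately show ?thesis using Y by auto
qed

end

section \<open>Completeness\<close>

context Metric_space
begin

text \<open>The bound is asked only from \<open>N\<close> on because Borel-Cantelli supplies it from
  an index that depends on the sample point.\<close>

lemma geometric_MCauchy:
  assumes x: "\<And>n. x n \<in> M" and le: "\<And>n. n \<ge> N \<Longrightarrow> d (x n) (x (Suc n)) < (1/2) ^ n"
  shows "MCauchy x"
proof -
  \<comment> \<open>The bound is the geometric partial sum; keeping the subtracted term is what
    closes the induction.\<close>
  have *: "d (x m) (x (m + k)) \<le> 2 * (1/2) ^ m - 2 * (1/2) ^ (m + k)" if "m \<ge> N" for m k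
  proof (induction k)
    case (Suc k)
    have "d (x m) (x (m + Suc k)) \<le> d (x m) (x (m + k)) + d (x (m + k)) (x (Suc (m + k)))"
      using triangle[OF x x x] by simp
    also have "\<dots> \<le> (2 * (1/2) ^ m - 2 * (1/2) ^ (m + k)) + (1/2) ^ (m + k)"
      using Suc le[of "m + k"] that by simp
    finally show ?case by simp
  qed (simp add: x)
  have **: "d (x m) (x n) \<le> 2 * (1/2) ^ m" if "N \<le> m" "m \<le> n" for m n
  proof -
    have "d (x m) (x n) \<le> 2 * (1/2) ^ m - 2 * (1/2) ^ n"
      using *[OF that(1), of "n - m"] that(2) by simp
    moreover have "0 \<le> 2 * (1/2::real) ^ n" by simp
    ultimately show ?thesis by linarith
  qed
  show ?thesis
    unfolding MCauchy_def
  proof (intro conjI allI impI)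
    show "range x \<subseteq> M" using x by blast
    fix e :: real assume "e > 0"
    then obtain K where K: "(1/2) ^ K < e / 2" using real_arch_pow_inv[of "e/2" "1/2"] by auto
    have small: "2 * (1/2::real) ^ m < e" if "m \<ge> K" for m
    proof -
      have "(1/2::real) ^ m \<le> (1/2) ^ K" by (rule power_decreasing[OF that]) auto
      then show ?thesis using K by linarith
    qed
    have "d (x n) (x n') < e" if "max N K \<le> n" "max N K \<le> n'" for n n'
      using **[of n n'] **[of n' n] small[of n] small[of n'] that commute[of "x n" "x n'"]
      by (cases "n \<le> n'") auto
    then show "\<exists>N. \<forall>n n'. N \<le> n \<longrightarrow> N \<le> n' \<longrightarrow> d (x n) (x n') < e" by blast
  qed
qed

end

context complete_metric_order
begin

text \<open>The constants telescope: \<open>2 a^n - 4/3 a^m + a^m = 2 a^n - 4/3 a^(m+1)\<close> for \<open>a = 1/4\<close>.\<close>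

lemma norm_dist_telescope:
  assumes X: "\<And>n t. X n t \<in> M"
    and meas: "\<And>n m. (\<lambda>t. d (X n t) (X m t)) \<in> borel_measurable N"
    and step: "\<And>n. (\<integral>\<^sup>+t. ennreal (d (X n t) (X (Suc n) t) powr p) \<partial>N) \<le> ennreal (((1/4) ^ n) powr p)"
  shows "(\<integral>\<^sup>+t. ennreal (d (X n t) (X (n + k) t) powr p) \<partial>N)
    \<le> ennreal ((2 * (1/4) ^ n - 4/3 * (1/4) ^ (n + k)) powr p)"
proof (induction k)
  case (Suc k)
  \<comment> \<open>The exact geometric sum, with 4/3 in place of 2 in the leading term, would be 0
    at k = 0. The larger leading constant keeps the bound positive, as \<open>Minkowski_powr\<close>
    requires.\<close>
  have pos: "0 < 2 * (1/4) ^ n - 4/3 * (1/4::real) ^ (n + k)"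
    using power_decreasing[of n "n + k" "1/4::real"] zero_less_power[of "1/4::real" n] by linarith
  have "(\<integral>\<^sup>+t. ennreal (d (X n t) (X (n + Suc k) t) powr p) \<partial>N)
      \<le> (\<integral>\<^sup>+t. ennreal ((d (X n t) (X (n + k) t) + d (X (n + k) t) (X (Suc (n + k)) t)) powr p) \<partial>N)"
    using triangle[OF X X X] order by (intro nn_integral_mono ennreal_leI powr_mono2) auto
  also have "\<dots> \<le> ennreal (((2 * (1/4) ^ n - 4/3 * (1/4) ^ (n + k)) + (1/4) ^ (n + k)) powr p)"
    by (rule Minkowski_powr[OF order meas _ meas _ pos Suc _ step]) auto
  also have "(2 * (1/4) ^ n - 4/3 * (1/4) ^ (n + k)) + (1/4) ^ (n + k) = 2 * (1/4) ^ n - 4/3 * (1/4::real) ^ (n + Suc k)"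
    by simp
  finally show ?case .
qed (simp add: X)

text \<open>Two geometric rates are played against each other: with p-norm increments at most 4^-n,
  Markov at threshold 2^-n leaves exceptional events of probability at most 2^-n. Both thresholds
  and probabilities are summable, so Borel-Cantelli gives almost sure convergence in the complete
  space.\<close>

lemma Fin_geometric_limit:
  assumes \<nu>: "\<And>n. \<nu> n \<in> Fin" and close: "\<And>n. W (\<nu> n) (\<nu> (Suc n)) < (1/4) ^ n"
  shows "\<exists>\<mu>\<in>P. \<forall>n. W (\<nu> n) \<mu> \<le> 2 * (1/4) ^ n"
proof -
  interpret U: prob_space U01 by (rule prob_space_U01)
  have \<nu>P: "\<nu> n \<in> P" for n using \<nu> by (simp add: Fin_def)
  obtain x0 where x0: "x0 \<in> M" using \<nu>P[of 0] by (auto simp: P_iff)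
  define S where "S n X \<longleftrightarrow> simple_rv X \<and> distr U01 Borel X = \<nu> n" for n X
  define R where "R n X Y \<longleftrightarrow> (\<integral>\<^sup>+t. ennreal (d (X t) (Y t) powr p) \<partial>U01) \<le> ennreal (((1/4) ^ n) powr p)"
    for n and X Y :: "real \<Rightarrow> 'a"
  have "\<exists>X. \<forall>n. S n (X n) \<and> R n (X n) (X (Suc n))"
  proof (rule dependent_nat_choice)
    \<comment> \<open>A constant variable has a Dirac law, and extending it along any coupling
      realises the first measure; the cost of this coupling is immaterial.\<close>
    obtain a where "coupled a (dirac x0) (\<nu> 0)" using coupled_exists[OF dirac_in_P[OF x0] \<nu>P] by blast
    then obtain \<gamma> where \<gamma>: "\<gamma> \<in> Cpl (dirac x0) (\<nu> 0)" by (auto simp: coupled_def)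
    have "simple_rv (\<lambda>_. x0)" using x0 by (auto simp: simple_rv_def intro!: exI[of _ "{x0}"])
    moreover have "distr U01 Borel (\<lambda>_. x0) = dirac x0"
      using U.distr_const[of x0 Borel] x0 by (simp add: dirac_def)
    ultimately show "\<exists>X. S 0 X" unfolding S_def using simple_rv_extend[OF _ _ \<nu> \<gamma>] by blast
  next
    fix X n assume "S n X"
    then have X: "simple_rv X" "distr U01 Borel X = \<nu> n" by (simp_all add: S_def)
    obtain \<gamma> where \<gamma>: "\<gamma> \<in> Cpl (\<nu> n) (\<nu> (Suc n))" "cost p \<gamma> \<le> ennreal (((1/4) ^ n) powr p)"
      using coupled_of_W_less[OF \<nu>P \<nu>P close[of n]] by (auto simp: coupled_def)
    show "\<exists>Y. S (Suc n) Y \<and> R n X Y"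
      unfolding S_def R_def using simple_rv_extend[OF X \<nu> \<gamma>(1)] \<gamma>(2) by auto
  qed
  then obtain X where "\<And>n. S n (X n)" and XR: "\<And>n. R n (X n) (X (Suc n))" by blast
  then have X: "\<And>n. simple_rv (X n)" "\<And>n. distr U01 Borel (X n) = \<nu> n" by (simp_all add: S_def)
  have Xm: "X n \<in> borel \<rightarrow>\<^sub>M Borel" for n using X(1) by (simp add: simple_rv_def)
  have XM: "X n t \<in> M" for n t using measurable_space[OF Xm, of t n] by simp
  have dm: "(\<lambda>t. d (X n t) (X m t)) \<in> borel_measurable borel" for n m
    using measurable_compose[OF measurable_simple_rv_Pair[OF X(1) Xm] measurable_dist_Borel2] by simp
  define A where "A n = {t. (1/2) ^ n \<le> d (X n t) (X (Suc n) t)}" for n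
  have A: "A n \<in> sets borel" for n
  proof -
    have "{t \<in> space borel. (1/2) ^ n \<le> d (X n t) (X (Suc n) t)} \<in> sets borel"
      using dm[of n "Suc n"] by measurable
    then show ?thesis by (simp add: A_def)
  qed
  have A_small: "measure U01 (A n) \<le> (1/2) ^ n" for n
  proof -
    have "emeasure U01 {t \<in> space U01. (1/2) ^ n \<le> d (X n t) (X (Suc n) t)} \<le> ennreal ((1/4) ^ n / (1/2) ^ n)"
      by (rule Markov_powr[OF order]) (use XR[of n] dm[of n "Suc n"] in \<open>auto simp: R_def power_mono cong: measurable_cong_sets\<close>)
    also have "(1/4) ^ n / (1/2) ^ n = (1/2::real) ^ n" by (simp add: power_divide[symmetric])
    finally show ?thesis by (simp add: A_def U.emeasure_eq_measure)
  qed
  have AE_A: "AE t in U01. eventually (\<lambda>n. t \<in> space U01 - A n) sequentially"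
  proof (rule borel_cantelli_AE1)
    show "summable (\<lambda>n. measure U01 (A n))"
      by (rule summable_comparison_test'[OF summable_geometric[of "1/2::real"], of 0]) (use A_small in auto)
  qed (use A in \<open>auto simp: U.emeasure_eq_measure\<close>)
  define \<Omega> where "\<Omega> = (\<Union>m. \<Inter>n\<in>{m..}. - A n)"
  have \<Omega>: "\<Omega> \<in> sets borel"
  proof -
    have "(\<Inter>n\<in>{m..}. - A n) \<in> sets borel" for m
      by (rule sets.countable_INT') (use A in auto)
    then show ?thesis unfolding \<Omega>_def by (intro sets.countable_UN'') auto
  qed
  have AE_\<Omega>: "AE t in U01. t \<in> \<Omega>"
    using AE_A by eventually_elim (auto simp: \<Omega>_def eventually_sequentially)
  \<comment> \<open>Off the almost sure event the sequence is made constant. It then converges at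
    every point and keeps finite ranges, as \<open>measurable_limit_finite_range\<close> demands,
    while the laws are unchanged.\<close>
  define X' where "X' n t = (if t \<in> \<Omega> then X n t else x0)" for n t
  have X'_eq: "AE t in U01. X' n t = X n t" for n
    using AE_\<Omega> by eventually_elim (simp add: X'_def)
  have X'm: "X' n \<in> borel \<rightarrow>\<^sub>M Borel" for n
    unfolding X'_def using Xm x0 \<Omega> by (intro measurable_If) auto
  have "\<forall>n. \<exists>F. finite F \<and> F \<subseteq> M \<and> (\<forall>t. X n t \<in> F)" using X(1) by (simp add: simple_rv_def)
  then obtain F where F: "\<And>n. finite (F n)" "\<And>n. F n \<subseteq> M" "\<And>n t. X n t \<in> F n" by metis
  have X'F: "X' n t \<in> insert x0 (F n)" for n t using F(3) by (simp add: X'_def)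
  have X'M: "X' n t \<in> M" for n t using XM x0 by (simp add: X'_def)
  have X'_rv: "simple_rv (X' n)" for n
    unfolding simple_rv_def using X'm X'F F x0 by (intro conjI exI[of _ "insert x0 (F n)"]) auto
  have X'_distr: "distr U01 Borel (X' n) = \<nu> n" for n
    unfolding X(2)[symmetric]
    by (rule distr_cong_AE) (use X'_eq X'm Xm in \<open>simp_all cong: measurable_cong_sets\<close>)
  have X'_cauchy: "MCauchy (\<lambda>n. X' n t)" for t
  proof (cases "t \<in> \<Omega>")
    case True
    then obtain m where "\<And>n. n \<ge> m \<Longrightarrow> t \<notin> A n" by (auto simp: \<Omega>_def)
    then show ?thesis
      using XM True by (intro geometric_MCauchy[of _ m]) (auto simp: X'_def A_def not_le)
  qed (simp add: X'_def x0)
  then have "\<forall>t. \<exists>y. limitin mtopology (\<lambda>n. X' n t) y sequentially"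
    using mcomplete by (simp add: mcomplete_def)
  then obtain Y where Y: "\<And>t. limitin mtopology (\<lambda>n. X' n t) (Y t) sequentially" by metis
  have YM: "Y t \<in> M" for t using limitin_topspace[OF Y] by simp
  have Ym: "Y \<in> borel \<rightarrow>\<^sub>M Borel"
    by (rule measurable_limit_finite_range[where X = X' and F = "\<lambda>n. insert x0 (F n)"])
       (use X'm F X'F Y in auto)
  define \<mu> where "\<mu> = distr U01 Borel Y"
  have Zm: "(\<lambda>t. (X' n t, Y t)) \<in> U01 \<rightarrow>\<^sub>M Borel2" for n
    using measurable_simple_rv_Pair[OF X'_rv Ym] by (simp cong: measurable_cong_sets)
  have d'm: "(\<lambda>t. d (X' n t) (X' m t)) \<in> borel_measurable U01" for n m
    using measurable_compose[OF measurable_simple_rv_Pair[OF X'_rv X'm] measurable_dist_Borel2]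
    by (simp cong: measurable_cong_sets)
  have step: "(\<integral>\<^sup>+t. ennreal (d (X' n t) (X' (Suc n) t) powr p) \<partial>U01) \<le> ennreal (((1/4) ^ n) powr p)" for n
  proof -
    have "(\<integral>\<^sup>+t. ennreal (d (X' n t) (X' (Suc n) t) powr p) \<partial>U01) = (\<integral>\<^sup>+t. ennreal (d (X n t) (X (Suc n) t) powr p) \<partial>U01)"
      by (intro nn_integral_cong_AE, use X'_eq[of n] X'_eq[of "Suc n"] in eventually_elim) simp
    then show ?thesis using XR[of n] by (simp add: R_def)
  qed
  \<comment> \<open>Fatou's lemma transfers the telescoped bound, which is uniform in m \<ge> n,
    from \<open>X' m\<close> to the limit \<open>Y\<close>.\<close>
  have cost_le: "(\<integral>\<^sup>+t. ennreal (d (X' n t) (Y t) powr p) \<partial>U01) \<le> ennreal ((2 * (1/4) ^ n) powr p)" for n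
  proof -
    have lim: "(\<lambda>m. ennreal (d (X' n t) (X' m t) powr p)) \<longlonglongrightarrow> ennreal (d (X' n t) (Y t) powr p)" for t
    proof -
      have "(\<lambda>m. d (X' m t) (Y t)) \<longlonglongrightarrow> 0"
        using Y[of t] by (simp add: limitin_metric_dist_null)
      then have "(\<lambda>m. d (X' n t) (X' m t)) \<longlonglongrightarrow> d (X' n t) (Y t)"
      proof (rule Lim_transform_bound[where g = "\<lambda>m. d (X' m t) (Y t)", THEN LIM_zero_cancel, rotated])
        show "eventually (\<lambda>m. norm (d (X' n t) (X' m t) - d (X' n t) (Y t)) \<le> norm (d (X' m t) (Y t))) sequentially"
          using mdist_reverse_triangle[OF X'M X'M YM] commute by (intro always_eventually) (simp add: abs_minus_commute)
      qed
      then show ?thesis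
        using order by (intro tendsto_ennrealI tendsto_powr') auto
    qed
    have "(\<integral>\<^sup>+t. ennreal (d (X' n t) (Y t) powr p) \<partial>U01)
        = (\<integral>\<^sup>+t. liminf (\<lambda>m. ennreal (d (X' n t) (X' m t) powr p)) \<partial>U01)"
      by (intro nn_integral_cong lim_imp_Liminf[OF _ lim, symmetric]) simp
    also have "\<dots> \<le> liminf (\<lambda>m. \<integral>\<^sup>+t. ennreal (d (X' n t) (X' m t) powr p) \<partial>U01)"
      using d'm by (intro nn_integral_liminf) auto
    also have "\<dots> \<le> ennreal ((2 * (1/4) ^ n) powr p)"
    proof (rule Liminf_le)
      show "eventually (\<lambda>m. (\<integral>\<^sup>+t. ennreal (d (X' n t) (X' m t) powr p) \<partial>U01) \<le> ennreal ((2 * (1/4) ^ n) powr p)) sequentially"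
        using eventually_ge_at_top[of n]
      proof eventually_elim
        case (elim m)
        have "(\<integral>\<^sup>+t. ennreal (d (X' n t) (X' (n + (m - n)) t) powr p) \<partial>U01)
            \<le> ennreal ((2 * (1/4) ^ n - 4/3 * (1/4) ^ (n + (m - n))) powr p)"
          by (rule norm_dist_telescope[OF X'M d'm step])
        also have "\<dots> \<le> ennreal ((2 * (1/4) ^ n) powr p)"
        proof (intro ennreal_leI powr_mono2)
          have "(1/4::real) ^ (n + (m - n)) \<le> (1/4) ^ n" by (intro power_decreasing) auto
          moreover have "0 \<le> (1/4::real) ^ n" "0 \<le> (1/4::real) ^ (n + (m - n))" by simp_all
          ultimately show "0 \<le> 2 * (1/4) ^ n - 4/3 * (1/4::real) ^ (n + (m - n))"
              "2 * (1/4) ^ n - 4/3 * (1/4) ^ (n + (m - n)) \<le> 2 * (1/4::real) ^ n" by linarith+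
        qed (use order in simp)
        finally show ?case using elim by simp
      qed
    qed simp
    finally show ?thesis .
  qed
  have cpl: "coupled (2 * (1/4) ^ n) (\<nu> n) \<mu>" for n
    by (rule coupled_distr[OF prob_space_U01 Zm[of n]])
       (use cost_le[of n] X'_distr[of n] in \<open>simp_all add: \<mu>_def\<close>)
  have PS: "prob_space \<mu>" unfolding \<mu>_def by (rule U.prob_space_distr) (use Ym in \<open>simp cong: measurable_cong_sets\<close>)
  have "separably_supported \<mu>"
  proof -
    define Q where "Q = insert x0 (\<Union>n. F n)"
    have Q: "countable Q" "Q \<subseteq> M" using F x0 by (auto simp: Q_def intro: countable_finite)
    have "Y t \<in> mtopology closure_of Q" for t
    proof (rule limitin_closedin[OF Y[of t]])
      have "X' n t \<in> Q" for n using X'F[of n t] by (auto simp: Q_def)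
      then show "eventually (\<lambda>n. X' n t \<in> mtopology closure_of Q) sequentially"
        using closure_of_subset[of Q mtopology] Q(2) by (auto intro!: always_eventually)
    qed simp_all
    then have "AE y in \<mu>. y \<in> mtopology closure_of Q"
      unfolding \<mu>_def using Ym borel_of_closedin[OF closedin_closure_of[of mtopology Q]]
      by (subst AE_distr_iff) (auto cong: measurable_cong_sets simp: pred_def)
    then show ?thesis using Q unfolding separably_supported_def by blast
  qed
  moreover have "(\<integral>\<^sup>+y. ennreal (d x0 y powr p) \<partial>\<mu>) < \<infinity>"
  proof -
    obtain a where a: "a > 0" "(\<integral>\<^sup>+y. ennreal (d x0 y powr p) \<partial>\<nu> 0) \<le> ennreal (a powr p)"
      using ennreal_le_powr[OF moment_finite[OF \<nu>P x0]] .
    have X'0: "X' 0 \<in> U01 \<rightarrow>\<^sub>M Borel" and YU: "Y \<in> U01 \<rightarrow>\<^sub>M Borel"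
      using X'm Ym by (simp_all cong: measurable_cong_sets)
    have "(\<integral>\<^sup>+y. ennreal (d x0 y powr p) \<partial>\<mu>) = (\<integral>\<^sup>+t. ennreal (d x0 (Y t) powr p) \<partial>U01)"
      unfolding \<mu>_def using measurable_dist_left[OF x0] by (simp add: nn_integral_distr[OF YU])
    also have "\<dots> \<le> (\<integral>\<^sup>+t. ennreal ((d x0 (X' 0 t) + d (X' 0 t) (Y t)) powr p) \<partial>U01)"
      using triangle[OF x0 X'M YM] order by (intro nn_integral_mono ennreal_leI powr_mono2) auto
    also have "\<dots> \<le> ennreal ((a + 2 * (1/4) ^ 0) powr p)"
    proof (rule Minkowski_powr[OF order])
      show "(\<lambda>t. d x0 (X' 0 t)) \<in> borel_measurable U01"
        by (rule measurable_compose[OF X'0 measurable_dist_left[OF x0]])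
      show "(\<lambda>t. d (X' 0 t) (Y t)) \<in> borel_measurable U01"
        using measurable_compose[OF Zm measurable_dist_Borel2] by simp
      have "(\<integral>\<^sup>+t. ennreal (d x0 (X' 0 t) powr p) \<partial>U01) = (\<integral>\<^sup>+y. ennreal (d x0 y powr p) \<partial>distr U01 Borel (X' 0))"
        using measurable_dist_left[OF x0] by (simp add: nn_integral_distr[OF X'0])
      then show "(\<integral>\<^sup>+t. ennreal (d x0 (X' 0 t) powr p) \<partial>U01) \<le> ennreal (a powr p)"
        using a(2) by (simp add: X'_distr)
      show "(\<integral>\<^sup>+t. ennreal (d (X' 0 t) (Y t) powr p) \<partial>U01) \<le> ennreal ((2 * (1/4) ^ 0) powr p)"
        by (rule cost_le)
    qed (use a in auto)
    finally show ?thesis by (rule order.strict_trans1) simp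
  qed
  ultimately have "\<mu> \<in> P" using PS x0 by (auto simp: P_iff \<mu>_def)
  moreover have "W (\<nu> n) \<mu> \<le> 2 * (1/4) ^ n" for n by (rule W_le[OF cpl]) simp
  ultimately show ?thesis by blast
qed

lemma mcomplete_W: "Metric_space.mcomplete P W"
proof -
  interpret W: Metric_space P W by (rule Metric_space_W)
  show ?thesis
    unfolding W.mcomplete_def
  proof (intro allI impI)
    fix \<sigma> assume \<sigma>: "W.MCauchy \<sigma>"
    have \<sigma>P: "\<sigma> n \<in> P" for n using \<sigma> by (auto simp: W.MCauchy_def)
    \<comment> \<open>A third of 4^-n is reserved for the gap between consecutive terms of the
      subsequence and a third for each of the two replacements by finitely supported
      measures.\<close>
    define good where "good n k \<longleftrightarrow> (\<forall>i j. k \<le> i \<longrightarrow> k \<le> j \<longrightarrow> W (\<sigma> i) (\<sigma> j) < (1/4) ^ n / 3)" for n k :: nat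
    have ex: "\<exists>k. good n k" for n
      using \<sigma> unfolding W.MCauchy_def good_def by (metis divide_pos_pos zero_less_divide_1_iff zero_less_numeral zero_less_power)
    have "\<exists>r. \<forall>n. good n (r n) \<and> r n < r (Suc n)"
    proof (rule dependent_nat_choice)
      show "\<exists>k. good 0 k" by (rule ex)
      fix k n
      obtain l where "good (Suc n) l" using ex by blast
      then have "good (Suc n) (max l (Suc k))" by (auto simp: good_def)
      then show "\<exists>y. good (Suc n) y \<and> k < y" by (intro exI[of _ "max l (Suc k)"]) auto
    qed
    then obtain r where r: "\<And>n. good n (r n)" "\<And>n. r n < r (Suc n)" by blast
    have mono: "strict_mono r" using r(2) by (simp add: strict_mono_Suc_iff)
    have "\<forall>n. \<exists>\<nu>\<in>Fin. W \<nu> (\<sigma> (r n)) < (1/4) ^ n / 3"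
      by (intro allI Fin_dense \<sigma>P) simp
    then obtain \<nu> where \<nu>: "\<And>n. \<nu> n \<in> Fin" "\<And>n. W (\<nu> n) (\<sigma> (r n)) < (1/4) ^ n / 3" by metis
    have \<nu>P: "\<nu> n \<in> P" for n using \<nu>(1) by (simp add: Fin_def)
    have "W (\<nu> n) (\<nu> (Suc n)) < (1/4) ^ n" for n
    proof -
      have "W (\<nu> n) (\<nu> (Suc n)) \<le> W (\<nu> n) (\<sigma> (r n)) + W (\<sigma> (r n)) (\<nu> (Suc n))"
        by (intro W.triangle \<nu>P \<sigma>P)
      also have "W (\<sigma> (r n)) (\<nu> (Suc n)) \<le> W (\<sigma> (r n)) (\<sigma> (r (Suc n))) + W (\<nu> (Suc n)) (\<sigma> (r (Suc n)))"
        by (intro W.triangle' \<nu>P \<sigma>P)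
      also have "W (\<sigma> (r n)) (\<sigma> (r (Suc n))) < (1/4) ^ n / 3"
        using r(1)[of n] r(2)[of n] unfolding good_def by auto
      also have "W (\<nu> n) (\<sigma> (r n)) < (1/4) ^ n / 3" by (rule \<nu>)
      also have "W (\<nu> (Suc n)) (\<sigma> (r (Suc n))) < (1/4) ^ n / 3"
      proof (rule less_le_trans[OF \<nu>(2)[of "Suc n"]])
        show "(1/4::real) ^ Suc n / 3 \<le> (1/4) ^ n / 3" by simp
      qed
      finally show ?thesis by simp
    qed
    then obtain \<mu> where \<mu>: "\<mu> \<in> P" "\<And>n. W (\<nu> n) \<mu> \<le> 2 * (1/4) ^ n"
      using Fin_geometric_limit[of \<nu>] \<nu>(1) by blast
    have le: "W ((\<sigma> \<circ> r) n) \<mu> \<le> 3 * (1/4) ^ n" for n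
    proof -
      have "W (\<sigma> (r n)) \<mu> \<le> W (\<nu> n) (\<sigma> (r n)) + W (\<nu> n) \<mu>"
        by (intro W.triangle'' \<nu>P \<sigma>P \<mu>)
      moreover have "0 \<le> (1/4::real) ^ n" by simp
      ultimately show ?thesis unfolding comp_apply using \<nu>(2)[of n] \<mu>(2)[of n] by linarith
    qed
    have lim: "(\<lambda>n. W ((\<sigma> \<circ> r) n) \<mu>) \<longlonglongrightarrow> 0"
    proof (rule tendsto_sandwich)
      show "eventually (\<lambda>n. 0 \<le> W ((\<sigma> \<circ> r) n) \<mu>) sequentially"
        by (intro always_eventually allI W.nonneg)
      show "eventually (\<lambda>n. W ((\<sigma> \<circ> r) n) \<mu> \<le> 3 * (1/4) ^ n) sequentially"
        by (intro always_eventually allI le)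
      show "(\<lambda>n. 3 * (1/4::real) ^ n) \<longlonglongrightarrow> 0"
        by (intro tendsto_mult_right_zero LIMSEQ_power_zero) simp
    qed (rule tendsto_const)
    have ev: "eventually (\<lambda>n. (\<sigma> \<circ> r) n \<in> P) sequentially"
      by (rule always_eventually) (simp only: comp_apply \<sigma>P simp_thms)
    have "limitin W.mtopology (\<sigma> \<circ> r) \<mu> sequentially"
      unfolding W.limitin_metric_dist_null by (intro conjI \<mu>(1) ev lim)
    then have "limitin W.mtopology \<sigma> \<mu> sequentially"
      by (rule W.MCauchy_convergent_subsequence[OF \<sigma> mono])
    then show "\<exists>x. limitin W.mtopology \<sigma> x sequentially" by blast
  qed
qed

lemma complete_Wasserstein_algebra_P: "complete_Wasserstein_algebra p P W mix_measure"
  using Wasserstein_algebra_P mcomplete_W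
  by (simp add: complete_Wasserstein_algebra_def complete_Wasserstein_algebra_axioms_def)

end

section \<open>Convex combinations\<close>

context barycentric_algebra
begin

text \<open>A barycentric algebra embeds at height \<open>1\<close> into the commutative monoid of its positive multiples,
  in which finite convex combinations become ordinary finite sums. The value \<open>(-1, undefined)\<close> is a
  junk element that makes the addition a commutative monoid on the whole type.\<close>

definition cone :: "(real \<times> 'a) set" where
  "cone = insert (0, undefined) ({0<..} \<times> A)"

definition cone_add :: "real \<times> 'a \<Rightarrow> real \<times> 'a \<Rightarrow> real \<times> 'a" (infixl "\<oplus>" 65) where
  "a \<oplus> b = (if a = (0, undefined) then b else if b = (0, undefined) then a
    else if a \<in> cone \<and> b \<in> cone then (fst a + fst b, mix (fst a / (fst a + fst b)) (snd a) (snd b))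
    else (- 1, undefined))"

lemma cone_add_zero [simp]: "(0, undefined) \<oplus> a = a" "a \<oplus> (0, undefined) = a"
  by (simp_all add: cone_add_def)

lemma cone_add_eq:
  assumes "a \<in> cone" "b \<in> cone"
  shows "a \<oplus> b = (if fst a = 0 then b else if fst b = 0 then a
    else (fst a + fst b, mix (fst a / (fst a + fst b)) (snd a) (snd b)))"
  using assms by (auto simp: cone_add_def cone_def)

lemma cone_add_closed: "a \<in> cone \<Longrightarrow> b \<in> cone \<Longrightarrow> a \<oplus> b \<in> cone"
  by (auto simp: cone_add_eq) (auto simp: cone_def intro!: mix_closed)

lemma cone_add_commute: "a \<oplus> b = b \<oplus> a"
proof (cases "a \<in> cone - {(0, undefined)} \<and> b \<in> cone - {(0, undefined)}")
  case False
  then show ?thesis by (auto simp: cone_add_def)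
next
  case True
  then have *: "0 < fst a" "0 < fst b" "snd a \<in> A" "snd b \<in> A" by (auto simp: cone_def)
  then have "1 - fst a / (fst a + fst b) = fst b / (fst b + fst a)" by (simp add: field_simps)
  then show ?thesis
    using True * mix_commute[of "fst a / (fst a + fst b)" "snd a" "snd b"]
    by (simp add: cone_add_eq add.commute)
qed

text \<open>For nonzero cone elements of weights u, v, w both sides carry the total weight, and the
  points agree by \<open>mix_assoc\<close>. The neutral element is immediate. If all three are
  nonzero and one lies outside the cone, both sides are the junk value, which absorbs every nonzero
  summand.\<close>

lemma cone_add_assoc: "a \<oplus> b \<oplus> c = a \<oplus> (b \<oplus> c)"
proof (cases "a = (0, undefined) \<or> b = (0, undefined) \<or> c = (0, undefined)")
  case True
  then show ?thesis by (auto simp: cone_add_def)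
next
  case nz: False
  have junk: "(- 1, undefined) \<notin> cone" by (simp add: cone_def)
  have sum_nz: "x \<oplus> y \<noteq> (0, undefined)" if "x \<noteq> (0, undefined)" "y \<noteq> (0, undefined)" for x y
    using that by (auto simp: cone_add_def cone_def)
  show ?thesis
  proof (cases "a \<in> cone \<and> b \<in> cone \<and> c \<in> cone")
    case False
    have junk_sum: "x \<oplus> y = (- 1, undefined)"
      if "x \<noteq> (0, undefined)" "y \<noteq> (0, undefined)" "x \<notin> cone \<or> y \<notin> cone" for x y
      using that by (auto simp: cone_add_def)
    have nz': "a \<noteq> (0, undefined)" "b \<noteq> (0, undefined)" "c \<noteq> (0, undefined)" using nz by blast+
    have "a \<oplus> b \<notin> cone \<or> c \<notin> cone"
    proof (cases "a \<in> cone \<and> b \<in> cone")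
      case False
      then have "a \<oplus> b = (- 1, undefined)" by (intro junk_sum nz') blast
      then show ?thesis using junk by (simp only: simp_thms)
    qed (use False in blast)
    moreover have "a \<notin> cone \<or> b \<oplus> c \<notin> cone"
    proof (cases "b \<in> cone \<and> c \<in> cone")
      case False
      then have "b \<oplus> c = (- 1, undefined)" by (intro junk_sum nz') blast
      then show ?thesis using junk by (simp only: simp_thms)
    qed (use False in blast)
    ultimately show ?thesis
      by (simp only: junk_sum[OF sum_nz[OF nz'(1,2)] nz'(3)] junk_sum[OF nz'(1) sum_nz[OF nz'(2,3)]])
  next
    case True
    define u v w where "u = fst a" and "v = fst b" and "w = fst c"
    have *: "0 < u" "0 < v" "0 < w" "snd a \<in> A" "snd b \<in> A" "snd c \<in> A"
      using True nz by (auto simp: cone_def u_def v_def w_def)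
    \<comment> \<open>Relative weights of the left nesting. The inner parameter (r - q * r) / (1 - q
      * r) of \<open>mix_assoc\<close> then becomes v / (v + w), the relative weight in the right
      nesting.\<close>
    define q r where "q = u / (u + v)" and "r = (u + v) / (u + v + w)"
    have qr: "0 \<le> q" "q < 1" "0 \<le> r" "r < 1" using * by (auto simp: q_def r_def)
    have 1: "q * r = u / (u + (v + w))" using * by (simp add: q_def r_def add.assoc)
    have "r - q * r = v / (u + (v + w))" "1 - q * r = (v + w) / (u + (v + w))"
    proof -
      define S where "S = u + (v + w)"
      have "0 < S" "r = (u + v) / S" using * by (simp_all add: S_def r_def add.assoc)
      moreover from this have "1 - u / S = (v + w) / S" by (simp add: S_def divide_simps)
      ultimately show "r - q * r = v / (u + (v + w))" "1 - q * r = (v + w) / (u + (v + w))"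
        unfolding 1 S_def[symmetric] by (simp_all add: diff_divide_distrib[symmetric])
    qed
    then have 2: "(r - q * r) / (1 - q * r) = v / (v + w)" using * by simp
    show ?thesis
    proof -
      have ab: "a \<oplus> b = (u + v, mix q (snd a) (snd b))" and bc: "b \<oplus> c = (v + w, mix (v / (v + w)) (snd b) (snd c))"
        using True * by (simp_all add: cone_add_eq q_def u_def v_def w_def)
      have "a \<oplus> b \<oplus> c = (u + v + w, mix r (mix q (snd a) (snd b)) (snd c))"
        using True * cone_add_closed[of a b] unfolding ab by (subst cone_add_eq) (simp_all add: r_def w_def)
      moreover have "a \<oplus> (b \<oplus> c) = (u + (v + w), mix (u / (u + (v + w))) (snd a) (mix (v / (v + w)) (snd b) (snd c)))"
        using True * cone_add_closed[of b c] unfolding bc by (subst cone_add_eq) (simp_all add: u_def)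
      ultimately show ?thesis
        using mix_assoc[OF qr *(4-6), unfolded 2, unfolded 1] by (simp add: add.assoc)
    qed
  qed
qed

text \<open>Supplies finite sums together with their rules for reordering, regrouping and neutral
  terms, which would otherwise have to be proved for iterated mixtures.\<close>

interpretation cone: comm_monoid_set cone_add "(0, undefined)"
  by unfold_locales (rule cone_add_assoc, rule cone_add_commute, simp add: cone_add_def)

text \<open>Weight zero forgets the point and yields the neutral element, so adding points without
  mass to an index set changes nothing.\<close>

definition weighted :: "real \<Rightarrow> 'a \<Rightarrow> real \<times> 'a" where
  "weighted w x = (if w = 0 then (0, undefined) else (w, x))"

lemma fst_weighted [simp]: "fst (weighted w x) = w"
  and weighted_0: "weighted 0 x = (0, undefined)"
  and snd_weighted: "w \<noteq> 0 \<Longrightarrow> snd (weighted w x) = x"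
  by (simp_all add: weighted_def)

lemma weighted_closed: "0 \<le> w \<Longrightarrow> (0 < w \<Longrightarrow> x \<in> A) \<Longrightarrow> weighted w x \<in> cone"
  by (auto simp: weighted_def cone_def)

lemma cone_eq_weighted: "a \<in> cone \<Longrightarrow> a = weighted (fst a) (snd a)"
  by (auto simp: weighted_def cone_def)

lemma weighted_add_weighted:
  assumes "0 \<le> v" "0 \<le> w" "0 < v \<Longrightarrow> x \<in> A" "0 < w \<Longrightarrow> y \<in> A"
  shows "weighted v x \<oplus> weighted w y = (if v = 0 then weighted w y else if w = 0 then weighted v x
    else weighted (v + w) (mix (v / (v + w)) x y))"
proof -
  have "weighted v x \<in> cone" "weighted w y \<in> cone" using assms by (auto intro: weighted_closed)
  then show ?thesis
    using assms by (simp add: cone_add_eq snd_weighted) (simp add: weighted_def add_nonneg_eq_0_iff)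
qed

lemma weighted_add:
  assumes "0 \<le> v" "0 \<le> w" "x \<in> A"
  shows "weighted (v + w) x = weighted v x \<oplus> weighted w x"
  using assms mix_idem[of "v / (v + w)" x] by (simp add: weighted_add_weighted)

text \<open>An unnormalised convex combination: the first coordinate accumulates the total weight,
  the second is the point proper once that weight is positive.\<close>

definition combination :: "'i set \<Rightarrow> ('i \<Rightarrow> real) \<Rightarrow> ('i \<Rightarrow> 'a) \<Rightarrow> real \<times> 'a" where
  "combination I w x = cone.F (\<lambda>i. weighted (w i) (x i)) I"

lemma combination_empty [simp]: "combination {} w x = (0, undefined)"
  by (simp add: combination_def)

lemma combination_insert:
  assumes "finite I" "i \<notin> I" "\<And>j. j \<in> insert i I \<Longrightarrow> 0 \<le> w j \<and> x j \<in> A"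
  shows "combination (insert i I) w x = weighted (w i) (x i) \<oplus> combination I w x"
  unfolding combination_def using assms by (intro cone.insert)

lemma combination_closed:
  assumes "\<And>i. i \<in> I \<Longrightarrow> 0 \<le> w i \<and> x i \<in> A"
  shows "combination I w x \<in> cone"
  unfolding combination_def using assms
proof (induction I rule: infinite_finite_induct)
  case (insert i I)
  then show ?case by (auto intro!: cone_add_closed weighted_closed)
qed (simp_all add: cone_def)

lemma fst_combination:
  assumes "finite I" "\<And>i. i \<in> I \<Longrightarrow> 0 \<le> w i \<and> x i \<in> A"
  shows "fst (combination I w x) = sum w I"
  using assms
proof (induction I rule: finite_induct)
  case (insert i I)
  then show ?case
    by (subst combination_insert) (simp_all add: cone_add_eq weighted_closed combination_closed)
qed simp

lemma snd_combination:
  assumes "finite I" "\<And>i. i \<in> I \<Longrightarrow> 0 \<le> w i \<and> x i \<in> A" "0 < sum w I"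
  shows "snd (combination I w x) \<in> A"
  using combination_closed[of I w x, OF assms(2)] fst_combination[of I w x, OF assms(1,2)] assms(3)
  by (auto simp: cone_def)

lemma combination_eq_weighted:
  assumes "finite I" "\<And>i. i \<in> I \<Longrightarrow> 0 \<le> w i \<and> x i \<in> A"
  shows "combination I w x = weighted (sum w I) (snd (combination I w x))"
  using cone_eq_weighted[OF combination_closed[of I w x]] fst_combination[of I w x] assms by simp

lemma combination_cong:
  assumes "\<And>i. i \<in> I \<Longrightarrow> w i = v i \<and> x i = y i \<and> 0 \<le> v i \<and> y i \<in> A"
  shows "combination I w x = combination I v y"
  unfolding combination_def using assms by (intro cone.cong) auto

lemma combination_mono_neutral:
  assumes "finite J" "I \<subseteq> J" "\<And>i. i \<in> J \<Longrightarrow> 0 \<le> w i \<and> x i \<in> A" "\<And>i. i \<in> J - I \<Longrightarrow> w i = 0"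
  shows "combination I w x = combination J w x"
  unfolding combination_def
  using assms by (intro cone.mono_neutral_left) (auto simp: weighted_0)

lemma combination_add:
  assumes "\<And>i. i \<in> I \<Longrightarrow> 0 \<le> v i \<and> 0 \<le> w i \<and> x i \<in> A"
  shows "combination I (\<lambda>i. v i + w i) x = combination I v x \<oplus> combination I w x"
proof -
  have "combination I (\<lambda>i. v i + w i) x = cone.F (\<lambda>i. weighted (v i) (x i) \<oplus> weighted (w i) (x i)) I"
    unfolding combination_def
    using assms by (intro cone.cong) (auto intro: weighted_add)
  then show ?thesis
    unfolding combination_def by (simp add: cone.distrib)
qed

lemma combination_single:
  assumes "finite I" "j \<in> I" "0 \<le> w" "\<And>i. i \<in> I \<Longrightarrow> x i \<in> A"
  shows "combination I (\<lambda>i. if i = j then w else 0) x = weighted w (x j)"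
proof -
  have "combination {j} (\<lambda>i. if i = j then w else 0) x = combination I (\<lambda>i. if i = j then w else 0) x"
    using assms by (intro combination_mono_neutral) auto
  then show ?thesis
    using assms combination_insert[of "{}" j "\<lambda>i. if i = j then w else 0" x] by simp
qed

text \<open>Terms sharing the same point are collected by adding their weights. In the induction a
  new index changes the weight of a single fibre, and \<open>combination_add\<close> splits that
  change off. For a pushforward the collected weights are its point masses.\<close>

lemma combination_fibres:
  assumes "finite K" "finite I" "\<phi> \<in> K \<rightarrow> I" "\<And>k. k \<in> K \<Longrightarrow> 0 \<le> v k" "\<And>i. i \<in> I \<Longrightarrow> x i \<in> A"
  shows "combination K v (\<lambda>k. x (\<phi> k)) = combination I (\<lambda>i. \<Sum>k | k \<in> K \<and> \<phi> k = i. v k) x"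
  using assms(1,3,4)
proof (induction K rule: finite_induct)
  case empty
  have "combination I (\<lambda>i. 0) x = combination {} (\<lambda>i. 0) x"
    using assms by (intro combination_mono_neutral[symmetric]) auto
  then show ?case by simp
next
  case (insert k K)
  define s where "s i = (\<Sum>k | k \<in> K \<and> \<phi> k = i. v k)" for i
  have s: "0 \<le> s i" for i unfolding s_def using insert.prems by (intro sum_nonneg) auto
  have eq: "(\<Sum>l | l \<in> insert k K \<and> \<phi> l = i. v l) = (if i = \<phi> k then v k else 0) + s i" for i
  proof -
    have "{l. l \<in> insert k K \<and> \<phi> l = i} = (if i = \<phi> k then insert k {l. l \<in> K \<and> \<phi> l = i} else {l. l \<in> K \<and> \<phi> l = i})"
      by auto
    then show ?thesis using insert.hyps by (simp add: s_def)
  qed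
  have \<phi>: "\<phi> j \<in> I" if "j \<in> insert k K" for j using insert.prems that by blast
  have "combination (insert k K) v (\<lambda>k. x (\<phi> k)) = weighted (v k) (x (\<phi> k)) \<oplus> combination K v (\<lambda>k. x (\<phi> k))"
    using insert.hyps insert.prems(2) assms(5) \<phi> by (intro combination_insert) auto
  also have "combination K v (\<lambda>k. x (\<phi> k)) = combination I s x"
    unfolding s_def using insert by (intro insert.IH) auto
  also have "weighted (v k) (x (\<phi> k)) = combination I (\<lambda>i. if i = \<phi> k then v k else 0) x"
    using insert.prems assms by (intro combination_single[symmetric]) auto
  also have "\<dots> \<oplus> combination I s x = combination I (\<lambda>i. (if i = \<phi> k then v k else 0) + s i) x"
    using insert.prems assms s by (intro combination_add[symmetric]) auto
  finally show ?case unfolding eq .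
qed

text \<open>Mixing parameters are ratios of weights, so a common positive factor cancels everywhere
  except in the total weight.\<close>

lemma combination_scale:
  assumes "finite I" "\<And>i. i \<in> I \<Longrightarrow> 0 \<le> w i \<and> x i \<in> A" "0 < s"
  shows "combination I (\<lambda>i. s * w i) x = weighted (s * sum w I) (snd (combination I w x))"
  using assms(1,2)
proof (induction I rule: finite_induct)
  case empty
  then show ?case by (simp add: weighted_def)
next
  case (insert i I)
  define t where "t = snd (combination I w x)"
  have T: "combination I w x = weighted (sum w I) t"
    unfolding t_def using insert by (intro combination_eq_weighted) auto
  have nn: "0 \<le> w i" "0 \<le> sum w I" using insert by (auto intro: sum_nonneg)
  have A: "x i \<in> A" "0 < sum w I \<Longrightarrow> t \<in> A"
    using insert by (auto simp: t_def intro: snd_combination)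
  have *: "combination (insert i I) w x = weighted (w i) (x i) \<oplus> weighted (sum w I) t"
    unfolding T[symmetric] using insert by (intro combination_insert) auto
  have "combination (insert i I) (\<lambda>i. s * w i) x = weighted (s * w i) (x i) \<oplus> combination I (\<lambda>i. s * w i) x"
    using insert assms(3) by (intro combination_insert) auto
  also have "combination I (\<lambda>i. s * w i) x = weighted (s * sum w I) t"
    using insert by (simp add: t_def)
  also have "weighted (s * w i) (x i) \<oplus> weighted (s * sum w I) t
      = weighted (s * (w i + sum w I)) (snd (weighted (w i) (x i) \<oplus> weighted (sum w I) t))"
  proof -
    have "s * w i / (s * w i + s * sum w I) = w i / (w i + sum w I)"
      using assms(3) by (simp add: distrib_left[symmetric])
    then show ?thesis
      using nn A assms(3) by (simp add: weighted_add_weighted zero_less_mult_iff snd_weighted weighted_0 distrib_left add_nonneg_eq_0_iff)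
  qed
  finally show ?case using insert.hyps by (simp add: *)
qed

text \<open>For 0 < r < 1 the combination splits into two summands of total weights \<open>r\<close>
  and 1 - r, and their cone sum is the mixture with parameter \<open>r\<close>. The end points are
  separate because scaling asks for a positive factor.\<close>

lemma mix_combination:
  assumes "finite I" "\<And>i. i \<in> I \<Longrightarrow> 0 \<le> v i \<and> 0 \<le> w i \<and> x i \<in> A" "sum v I = 1" "sum w I = 1" "0 \<le> r" "r \<le> 1"
  shows "snd (combination I (\<lambda>i. r * v i + (1 - r) * w i) x) = mix r (snd (combination I v x)) (snd (combination I w x))"
proof -
  have A: "snd (combination I v x) \<in> A" "snd (combination I w x) \<in> A"
    using assms by (auto intro!: snd_combination)
  consider "r = 0" | "r = 1" | "0 < r" "r < 1" using assms by linarith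
  then show ?thesis
  proof cases
    case 1
    then show ?thesis using mix_commute[of 0 "snd (combination I v x)" "snd (combination I w x)"] mix_one A by simp
  next
    case 2
    then show ?thesis using mix_one A by simp
  next
    case 3
    have "combination I (\<lambda>i. r * v i + (1 - r) * w i) x = combination I (\<lambda>i. r * v i) x \<oplus> combination I (\<lambda>i. (1 - r) * w i) x"
      using assms by (intro combination_add) auto
    also have "combination I (\<lambda>i. r * v i) x = weighted r (snd (combination I v x))"
      using combination_scale[of I v x r] assms 3 by simp
    also have "combination I (\<lambda>i. (1 - r) * w i) x = weighted (1 - r) (snd (combination I w x))"
      using combination_scale[of I w x "1 - r"] assms 3 by simp
    finally show ?thesis using 3 A by (simp add: weighted_add_weighted snd_weighted)
  qed
qed

end

section \<open>The p-th power inequality for finite combinations\<close>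

context Wasserstein_algebra
begin

text \<open>The binary axiom is iterated. Multiplying the distance by the total weight makes the
  inequality homogeneous, so the induction hypothesis applies to a partial sum without renormalising
  it.\<close>

lemma combination_dist_powr_le:
  assumes "finite I" "\<And>i. i \<in> I \<Longrightarrow> 0 \<le> w i \<and> x i \<in> A \<and> y i \<in> A" "0 < sum w I"
  shows "sum w I * d (snd (combination I w x)) (snd (combination I w y)) powr p
    \<le> (\<Sum>i\<in>I. w i * d (x i) (y i) powr p)"
  using assms
proof (induction I rule: finite_induct)
  case (insert i I)
  define S T where "S = snd (combination I w x)" and "T = snd (combination I w y)"
  have ST: "combination I w x = weighted (sum w I) S" "combination I w y = weighted (sum w I) T"
    unfolding S_def T_def using insert by (auto intro!: combination_eq_weighted)
  have ins: "combination (insert i I) w x = weighted (w i) (x i) \<oplus> weighted (sum w I) S"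
      "combination (insert i I) w y = weighted (w i) (y i) \<oplus> weighted (sum w I) T"
    unfolding ST[symmetric] using insert by (auto intro!: combination_insert)
  have nn: "0 \<le> w i" "0 \<le> sum w I" using insert by (auto intro: sum_nonneg)
  \<comment> \<open>With total weight zero the second coordinate of a combination need not lie in
    \<open>A\<close>, so the binary axiom can be applied only in the last case.\<close>
  consider "w i = 0" | "sum w I = 0" "w i > 0" | "w i > 0" "sum w I > 0"
    using nn by linarith
  then show ?case
  proof cases
    case 1
    then show ?thesis using insert by (simp add: ins weighted_0 flip: ST)
  next
    case 2
    then show ?thesis using insert.hyps insert.prems
      by (simp add: ins weighted_0 snd_weighted sum_nonneg)
  next
    case 3
    define r where "r = w i / (w i + sum w I)"
    have r: "0 \<le> r" "r \<le> 1" "(w i + sum w I) * r = w i" "(w i + sum w I) * (1 - r) = sum w I"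
      using 3 by (auto simp: r_def field_simps)
    have A: "S \<in> A" "T \<in> A" "x i \<in> A" "y i \<in> A"
      unfolding S_def T_def using insert.hyps insert.prems 3 by (auto intro!: snd_combination)
    have "d (mix r (x i) S) (mix r (y i) T) powr p
        \<le> r * d (x i) (y i) powr p + (1 - r) * d S T powr p"
      by (intro mix_powr_le r A)
    then have "(w i + sum w I) * d (mix r (x i) S) (mix r (y i) T) powr p
        \<le> (w i + sum w I) * (r * d (x i) (y i) powr p + (1 - r) * d S T powr p)"
      using nn by (intro mult_left_mono) auto
    also have "\<dots> = w i * d (x i) (y i) powr p + sum w I * d S T powr p"
      by (simp only: distrib_left mult.assoc[symmetric] r)
    also have "\<dots> \<le> w i * d (x i) (y i) powr p + (\<Sum>i\<in>I. w i * d (x i) (y i) powr p)"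
      using insert.IH insert.prems 3 by (simp add: S_def T_def)
    finally show ?thesis
      using 3 insert.hyps A by (simp add: ins weighted_add_weighted snd_weighted r_def)
  qed
qed simp

end

section \<open>Universal property\<close>

context complete_metric_order
begin

text \<open>Sending the complement of \<open>F\<close>, a null set, to a point of \<open>F\<close>
  exhibits the measure as the law of a map with finite range.\<close>

lemma FinI:
  assumes "prob_space \<mu>" and s: "sets \<mu> = sets Borel" and F: "finite F" "F \<subseteq> M" "AE x in \<mu>. x \<in> F"
  shows "\<mu> \<in> Fin"
proof -
  interpret prob_space \<mu> by fact
  have [measurable_cong]: "sets \<mu> = sets Borel" by fact
  have sp: "space \<mu> = M" using sets_eq_imp_space_eq[OF s] by simp
  have Fm [measurable]: "F \<in> sets Borel" using F by (intro finite_in_sets_Borel)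
  obtain x0 where x0: "x0 \<in> F" using F(3) by fastforce
  define f where "f x = (if x \<in> F then x else x0)" for x
  have f: "f \<in> \<mu> \<rightarrow>\<^sub>M Borel" unfolding f_def using x0 F by (intro measurable_If) auto
  have "distr \<mu> Borel f = distr \<mu> Borel (\<lambda>x. x)"
  proof (rule distr_cong_AE)
    show "AE x in \<mu>. f x = x" using F(3) by eventually_elim (simp add: f_def)
  qed (use f in auto)
  also have "\<dots> = \<mu>" using s by (simp add: distr_id2)
  finally show ?thesis using distr_in_Fin[OF assms(1) f F(1)] x0 by (simp add: f_def)
qed

lemma Fin_in_P: "\<mu> \<in> Fin \<Longrightarrow> \<mu> \<in> P"
  by (simp add: Fin_def)

lemma FinE:
  assumes "\<mu> \<in> Fin"
  obtains F where "finite F" "F \<subseteq> M" "AE x in \<mu>. x \<in> F"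
  using assms by (auto simp: Fin_def)

lemma AE_dirac: "x \<in> M \<Longrightarrow> AE y in dirac x. y \<in> {x}"
  unfolding dirac_def using finite_in_sets_Borel[of "{x}"] by (subst AE_return) auto

lemma dirac_in_Fin: "x \<in> M \<Longrightarrow> dirac x \<in> Fin"
  using P_D[OF dirac_in_P] AE_dirac by (intro FinI[of _ "{x}"]) auto

lemma AE_finite_mix:
  assumes "\<mu> \<in> P" "\<nu> \<in> P" "finite F" "F \<subseteq> M" "AE x in \<mu>. x \<in> F" "AE x in \<nu>. x \<in> F"
  shows "AE x in mix_measure r \<mu> \<nu>. x \<in> F"
  by (rule AE_mix_measure) (use assms P_D(2) finite_in_sets_Borel in simp_all)

lemma mix_in_Fin:
  assumes "\<mu> \<in> Fin" "\<nu> \<in> Fin" "0 \<le> r" "r \<le> 1"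
  shows "mix_measure r \<mu> \<nu> \<in> Fin"
proof -
  note P = assms(1,2)[THEN Fin_in_P]
  obtain F where F: "finite F" "F \<subseteq> M" "AE x in \<mu>. x \<in> F" using FinE[OF assms(1)] .
  obtain G where G: "finite G" "G \<subseteq> M" "AE x in \<nu>. x \<in> G" using FinE[OF assms(2)] .
  have "AE x in mix_measure r \<mu> \<nu>. x \<in> F \<union> G"
  proof (rule AE_finite_mix[OF P])
    show "AE x in \<mu>. x \<in> F \<union> G" using F(3) by eventually_elim simp
    show "AE x in \<nu>. x \<in> F \<union> G" using G(3) by eventually_elim simp
  qed (use F G in auto)
  moreover have "mix_measure r \<mu> \<nu> \<in> P" by (intro mix_in_P P assms)
  ultimately show ?thesis using F G by (auto simp: Fin_def)
qed

lemma measure_mix_P: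
  assumes "\<mu> \<in> P" "\<nu> \<in> P" "0 \<le> r" "r \<le> 1" "B \<in> sets Borel"
  shows "measure (mix_measure r \<mu> \<nu>) B = r * measure \<mu> B + (1 - r) * measure \<nu> B"
  using assms P_D(1,2)[OF assms(1)] P_D(1,2)[OF assms(2)] by (intro measure_mix_measure) auto

lemma affine_eq_on_Fin:
  assumes g: "affine_map_on P mix_measure mixB g" and h: "affine_map_on P mix_measure mixB h"
    and eq: "\<And>x. x \<in> M \<Longrightarrow> g (dirac x) = h (dirac x)" and \<mu>: "\<mu> \<in> Fin"
  shows "g \<mu> = h \<mu>"
proof -
  have "g \<mu> = h \<mu>" if "finite F" "F \<subseteq> M" "AE x in \<mu>. x \<in> F" "\<mu> \<in> P" for F \<mu>
    using that
  proof (induction F arbitrary: \<mu> rule: finite_induct)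
    case empty
    interpret prob_space \<mu> by (rule P_D[OF empty(3)])
    have "AE x in \<mu>. False" using empty by simp
    then show ?case by simp
  next
    case (insert x F)
    note D = P_D[OF insert.prems(3)]
    interpret prob_space \<mu> by (rule D)
    have x: "x \<in> M" and xm: "{x} \<in> sets \<mu>" using insert.prems singleton_in_sets_Borel D by auto
    define t where "t = measure \<mu> {x}"
    have t: "0 \<le> t" "t \<le> 1" by (simp_all add: t_def)
    consider "t = 0" | "t = 1" | "0 < t" "t < 1" using t by linarith
    then show ?case
    proof cases
      case 1
      then have "AE y in \<mu>. y \<notin> {x}"
        using xm by (intro AE_not_in) (auto simp: t_def emeasure_eq_measure)
      then have "AE y in \<mu>. y \<in> F"
        using insert.prems(2) by eventually_elim auto
      then show ?thesis using insert.prems by (intro insert.IH) auto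
    next
      case 2
      have "\<mu> = dirac x"
      proof (rule prob_space_eqI_finite_support[where S = "{x}"])
        show "prob_space (dirac x)" by (rule P_D[OF dirac_in_P[OF x]])
        show "sets \<mu> = sets (dirac x)" using D P_D(2)[OF dirac_in_P[OF x]] by simp
        show "AE y in \<mu>. y \<in> {x}" using 2 by (intro AE_prob_1) (simp add: t_def)
        show "measure \<mu> {s} = measure (dirac x) {s}" if "s \<in> {x}" for s
          using that 2 singleton_in_sets_Borel[OF x] by (simp add: t_def dirac_def measure_return)
      qed (use xm x AE_dirac in \<open>auto intro: prob_space_axioms\<close>)
      then show ?thesis using eq x by simp
    next
      case 3
      define C where "C = M - {x}"
      have C: "C \<in> sets \<mu>" "measure \<mu> C = 1 - t" using xm D prob_compl[OF xm] by (auto simp: C_def t_def)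
      have C0: "emeasure \<mu> C \<noteq> 0" "emeasure \<mu> C \<noteq> \<infinity>" using C 3 by (simp_all add: emeasure_eq_measure)
      define \<mu>' where "\<mu>' = uniform_measure \<mu> C"
      have ps: "prob_space \<mu>'" unfolding \<mu>'_def by (rule prob_space_uniform_measure[OF C0])
      have s': "sets \<mu>' = sets Borel" using D by (simp add: \<mu>'_def)
      have AE: "AE y in \<mu>'. y \<in> F"
      proof -
        have "AE y in \<mu>. y \<in> C \<longrightarrow> y \<in> F"
          using insert.prems(2) by eventually_elim (auto simp: C_def)
        then show ?thesis unfolding \<mu>'_def by (rule AE_uniform_measureI[OF C(1)])
      qed
      have F: "finite F" "F \<subseteq> M" using insert by auto
      have \<mu>'P: "\<mu>' \<in> P" by (rule Fin_in_P[OF FinI[OF ps s' F AE]])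
      have "\<mu> = mix_measure t (dirac x) \<mu>'"
      proof (rule prob_space_measure_eqI)
        show "prob_space (mix_measure t (dirac x) \<mu>')" "sets \<mu> = sets (mix_measure t (dirac x) \<mu>')"
          using P_D(1,2)[OF mix_in_P[OF dirac_in_P[OF x] \<mu>'P t]] D by auto
        fix B assume B: "B \<in> sets \<mu>"
        have "measure \<mu> B = measure \<mu> ({x} \<inter> B) + measure \<mu> (C \<inter> B)"
        proof -
          have "B = ({x} \<inter> B) \<union> (C \<inter> B)" using sets.sets_into_space[OF B] D by (auto simp: C_def)
          moreover have "measure \<mu> (({x} \<inter> B) \<union> (C \<inter> B)) = measure \<mu> ({x} \<inter> B) + measure \<mu> (C \<inter> B)"
            using B C xm by (intro finite_measure_Union) (auto simp: C_def)
          ultimately show ?thesis by simp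
        qed
        also have "measure \<mu> ({x} \<inter> B) = t * measure (dirac x) B"
          using B D by (auto simp: t_def dirac_def measure_return indicator_def)
        also have "measure \<mu> (C \<inter> B) = (1 - t) * measure \<mu>' B"
          unfolding \<mu>'_def using C C0 B 3 by (subst measure_uniform_measure) auto
        finally show "measure \<mu> B = measure (mix_measure t (dirac x) \<mu>') B"
          using measure_mix_P[OF dirac_in_P[OF x] \<mu>'P t] B D by simp
      qed (rule prob_space_axioms)
      then have "\<And>k. affine_map_on P mix_measure mixB k \<Longrightarrow> k \<mu> = mixB t (k (dirac x)) (k \<mu>')"
        using dirac_in_P[OF x] \<mu>'P t by (auto simp: affine_map_on_def)
      then show ?thesis using g h eq x insert.IH[OF F(2) AE \<mu>'P] by metis
    qed
  qed
  then show ?thesis using \<mu> by (auto simp: Fin_def)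
qed

end

section \<open>Extension of a nonexpansive map\<close>

locale Wasserstein_extension = complete_metric_order M d p +
    T: complete_Wasserstein_algebra p B dB mixB
  for M :: "'a set" and d p and B :: "'b set" and dB mixB +
  fixes f :: "'a \<Rightarrow> 'b"
  assumes f: "nonexpansive_map M d B dB f"
begin

lemma f_in: "x \<in> M \<Longrightarrow> f x \<in> B"
  and f_le: "x \<in> M \<Longrightarrow> y \<in> M \<Longrightarrow> dB (f x) (f y) \<le> d x y"
  using f by (auto simp: nonexpansive_map_def)

text \<open>Summing over all atoms avoids the choice of a finite carrier. On \<open>Fin\<close> any
  finite carrier gives the same value by \<open>bary_eq\<close>, since its other points have weight
  zero.\<close>

definition bary :: "'a measure \<Rightarrow> 'b" where
  "bary \<mu> = snd (T.combination {x \<in> M. measure \<mu> {x} \<noteq> 0} (\<lambda>x. measure \<mu> {x}) f)"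

lemma sum_point_masses_P:
  assumes "\<mu> \<in> P" "finite F" "F \<subseteq> M" "AE x in \<mu>. x \<in> F"
  shows "(\<Sum>x\<in>F. measure \<mu> {x}) = 1"
  using assms P_D(2)[OF assms(1)] singleton_in_sets_Borel
  by (intro sum_point_masses P_D(1)) auto

lemma bary_eq:
  assumes \<mu>: "\<mu> \<in> P" and F: "finite F" "F \<subseteq> M" "AE x in \<mu>. x \<in> F"
  shows "bary \<mu> = snd (T.combination F (\<lambda>x. measure \<mu> {x}) f)"
proof -
  interpret prob_space \<mu> by (rule P_D[OF \<mu>])
  have s: "sets \<mu> = sets Borel" by (rule P_D[OF \<mu>])
  have "x \<in> F" if "x \<in> M" "measure \<mu> {x} \<noteq> 0" for x
  proof (rule ccontr)
    assume "x \<notin> F"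
    have "AE y in \<mu>. y \<notin> {x}" using F(3) by eventually_elim (use \<open>x \<notin> F\<close> in auto)
    then have "measure \<mu> {x} = 0"
      using prob_eq_0[of "{x}"] singleton_in_sets_Borel[OF that(1)] s by simp
    then show False using that by simp
  qed
  then have "T.combination {x \<in> M. measure \<mu> {x} \<noteq> 0} (\<lambda>x. measure \<mu> {x}) f = T.combination F (\<lambda>x. measure \<mu> {x}) f"
    using F f_in by (intro T.combination_mono_neutral) auto
  then show ?thesis by (simp add: bary_def)
qed

lemma bary_in:
  assumes "\<mu> \<in> Fin"
  shows "bary \<mu> \<in> B"
proof -
  obtain F where F: "finite F" "F \<subseteq> M" "AE x in \<mu>. x \<in> F" using FinE[OF assms] .
  show ?thesis
    unfolding bary_eq[OF Fin_in_P[OF assms] F]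
    using F f_in sum_point_masses_P[OF Fin_in_P[OF assms] F] by (intro T.snd_combination) auto
qed

lemma bary_dirac:
  assumes "x \<in> M"
  shows "bary (dirac x) = f x"
proof -
  have 1: "measure (dirac x) {x} = 1"
    using singleton_in_sets_Borel[OF assms] by (simp add: dirac_def measure_return)
  have "bary (dirac x) = snd (T.combination {x} (\<lambda>y. measure (dirac x) {y}) f)"
    using assms AE_dirac by (intro bary_eq dirac_in_P) auto
  also have "T.combination {x} (\<lambda>y. measure (dirac x) {y}) f = T.combination {x} (\<lambda>y. if y = x then 1 else 0) f"
    using 1 assms f_in by (intro T.combination_cong) auto
  also have "\<dots> = T.weighted 1 (f x)"
    using assms f_in by (intro T.combination_single) auto
  finally show ?thesis by (simp add: T.weighted_def)
qed

lemma bary_mix: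
  assumes \<mu>: "\<mu> \<in> Fin" and \<nu>: "\<nu> \<in> Fin" and r: "0 \<le> r" "r \<le> 1"
  shows "bary (mix_measure r \<mu> \<nu>) = mixB r (bary \<mu>) (bary \<nu>)"
proof -
  note P = Fin_in_P[OF \<mu>] Fin_in_P[OF \<nu>]
  obtain F' where F': "finite F'" "F' \<subseteq> M" "AE x in \<mu>. x \<in> F'" using FinE[OF \<mu>] .
  obtain G where G: "finite G" "G \<subseteq> M" "AE x in \<nu>. x \<in> G" using FinE[OF \<nu>] .
  define F where "F = F' \<union> G"
  have F: "finite F" "F \<subseteq> M" using F' G by (auto simp: F_def)
  have AE: "AE x in \<mu>. x \<in> F" using F'(3) by eventually_elim (simp add: F_def)
  have AE': "AE x in \<nu>. x \<in> F" using G(3) by eventually_elim (simp add: F_def)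
  have "bary (mix_measure r \<mu> \<nu>) = snd (T.combination F (\<lambda>x. measure (mix_measure r \<mu> \<nu>) {x}) f)"
    by (intro bary_eq mix_in_P P r F AE_finite_mix AE AE')
  also have "T.combination F (\<lambda>x. measure (mix_measure r \<mu> \<nu>) {x}) f
      = T.combination F (\<lambda>x. r * measure \<mu> {x} + (1 - r) * measure \<nu> {x}) f"
    using F r f_in singleton_in_sets_Borel by (intro T.combination_cong) (auto simp: measure_mix_P[OF P r])
  also have "snd \<dots> = mixB r (snd (T.combination F (\<lambda>x. measure \<mu> {x}) f)) (snd (T.combination F (\<lambda>x. measure \<nu> {x}) f))"
    using F r f_in sum_point_masses_P P AE AE' by (intro T.mix_combination) auto
  finally show ?thesis by (simp add: bary_eq[OF _ F] P AE AE')
qed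

text \<open>Applied to the two projections of a coupling, this writes the barycentres of both
  marginals over one common index set with the same weights, the form in which they can be compared
  term by term.\<close>

lemma bary_distr:
  assumes \<gamma>: "prob_space \<gamma>" and S: "finite S" "\<And>z. z \<in> S \<Longrightarrow> {z} \<in> sets \<gamma>" "AE z in \<gamma>. z \<in> S"
    and g: "g \<in> \<gamma> \<rightarrow>\<^sub>M Borel" "g ` S \<subseteq> M" "distr \<gamma> Borel g \<in> P"
  shows "bary (distr \<gamma> Borel g) = snd (T.combination S (\<lambda>z. measure \<gamma> {z}) (\<lambda>z. f (g z)))"
proof -
  have F: "finite (g ` S)" using S by simp
  have "AE x in distr \<gamma> Borel g. x \<in> g ` S"
  proof (subst AE_distr_iff[OF g(1)])
    have "{x \<in> space Borel. x \<in> g ` S} = g ` S" using g(2) by auto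
    then show "{x \<in> space Borel. x \<in> g ` S} \<in> sets Borel" using finite_in_sets_Borel[OF F g(2)] by simp
    show "AE z in \<gamma>. g z \<in> g ` S" using S(3) by eventually_elim (rule imageI)
  qed
  then have "bary (distr \<gamma> Borel g) = snd (T.combination (g ` S) (\<lambda>x. measure (distr \<gamma> Borel g) {x}) f)"
    by (intro bary_eq F g)
  also have "T.combination (g ` S) (\<lambda>x. measure (distr \<gamma> Borel g) {x}) f
      = T.combination (g ` S) (\<lambda>x. \<Sum>z | z \<in> S \<and> g z = x. measure \<gamma> {z}) f"
    using g f_in singleton_in_sets_Borel point_mass_distr[OF \<gamma> S g(1)]
    by (intro T.combination_cong) (auto intro!: sum_nonneg)
  also have "\<dots> = T.combination S (\<lambda>z. measure \<gamma> {z}) (\<lambda>z. f (g z))"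
    using S(1) F g(2) f_in by (intro T.combination_fibres[symmetric]) auto
  finally show ?thesis .
qed

lemma bary_nonexpansive:
  assumes \<mu>: "\<mu> \<in> Fin" and \<nu>: "\<nu> \<in> Fin"
  shows "dB (bary \<mu>) (bary \<nu>) \<le> W \<mu> \<nu>"
proof (rule field_le_epsilon)
  fix e :: real assume "e > 0"
  note P = Fin_in_P[OF \<mu>] Fin_in_P[OF \<nu>]
  obtain F where F: "finite F" "F \<subseteq> M" "AE x in \<mu>. x \<in> F" using FinE[OF \<mu>] .
  obtain G where G: "finite G" "G \<subseteq> M" "AE x in \<nu>. x \<in> G" using FinE[OF \<nu>] .
  \<comment> \<open>The infimum defining \<open>W\<close> is not known to be attained, so a coupling
    is drawn from a strict bound.\<close>
  define a where "a = W \<mu> \<nu> + e"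
  have a: "0 < a" using \<open>e > 0\<close> by (simp add: a_def W_eq add_nonneg_pos)
  have "coupled a \<mu> \<nu>" using \<open>e > 0\<close> by (intro coupled_of_W_less P) (simp add: a_def)
  then obtain \<gamma> where g: "\<gamma> \<in> Cpl \<mu> \<nu>" "cost p \<gamma> \<le> ennreal (a powr p)" by (auto simp: coupled_def)
  note c = couplingsD[OF g(1)]
  interpret \<gamma>: prob_space \<gamma> by (rule c)
  have [measurable_cong]: "sets \<gamma> = sets Borel2" by (rule c)
  have AE: "AE z in \<gamma>. z \<in> F \<times> G"
  proof -
    have "AE z in \<gamma>. fst z \<in> F" by (rule AE_coupling_fst[OF g(1) F(3)])
    moreover have "AE z in \<gamma>. snd z \<in> G" by (rule AE_coupling_snd[OF g(1) G(3)])
    ultimately show ?thesis by eventually_elim (simp add: mem_Times_iff)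
  qed
  have pt: "{z} \<in> sets \<gamma>" if "z \<in> M \<times> M" for z
    using singleton_in_sets_Borel2[of "fst z" "snd z"] that by (auto simp: c(2))
  have FG: "finite (F \<times> G)" "F \<times> G \<subseteq> M \<times> M" using F G by auto
  have S: "finite (F \<times> G)" "\<And>z. z \<in> F \<times> G \<Longrightarrow> {z} \<in> sets \<gamma>" "AE z in \<gamma>. z \<in> F \<times> G"
    using FG pt AE by blast+
  have b1: "bary \<mu> = snd (T.combination (F \<times> G) (\<lambda>z. measure \<gamma> {z}) (\<lambda>z. f (fst z)))"
    using bary_distr[OF \<gamma>.prob_space_axioms S, of fst] F(2) by (force simp: c(4) P)
  have b2: "bary \<nu> = snd (T.combination (F \<times> G) (\<lambda>z. measure \<gamma> {z}) (\<lambda>z. f (snd z)))"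
    using bary_distr[OF \<gamma>.prob_space_axioms S, of snd] G(2) by (force simp: c(5) P)
  note sum1 = sum_point_masses[OF \<gamma>.prob_space_axioms S]
  have "dB (bary \<mu>) (bary \<nu>) powr p \<le> (\<Sum>z\<in>F \<times> G. measure \<gamma> {z} * dB (f (fst z)) (f (snd z)) powr p)"
    using T.combination_dist_powr_le[of "F \<times> G" "\<lambda>z. measure \<gamma> {z}" "\<lambda>z. f (fst z)" "\<lambda>z. f (snd z)"]
      sum1 FG F(2) G(2) f_in unfolding b1 b2 by (auto simp: subset_iff)
  also have "\<dots> \<le> (\<Sum>z\<in>F \<times> G. measure \<gamma> {z} * d (fst z) (snd z) powr p)"
    using F(2) G(2) order by (intro sum_mono mult_left_mono powr_mono2 f_le) auto
  also have "\<dots> \<le> a powr p"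
  proof -
    \<comment> \<open>The weighted sum is the integral of a function concentrated on F \<times> G
      that never exceeds the cost integrand.\<close>
    have "ennreal (\<Sum>z\<in>F \<times> G. measure \<gamma> {z} * d (fst z) (snd z) powr p)
        = (\<Sum>z\<in>F \<times> G. ennreal (d (fst z) (snd z) powr p) * emeasure \<gamma> {z})"
      by (subst sum_ennreal[symmetric]) (auto simp: \<gamma>.emeasure_eq_measure ennreal_mult mult.commute)
    also have "\<dots> = (\<Sum>z\<in>F \<times> G. \<integral>\<^sup>+u. ennreal (d (fst z) (snd z) powr p) * indicator {z} u \<partial>\<gamma>)"
      by (intro sum.cong[OF refl] nn_integral_cmult_indicator[symmetric] pt) (rule subsetD[OF FG(2)])
    also have "\<dots> = (\<integral>\<^sup>+u. (\<Sum>z\<in>F \<times> G. ennreal (d (fst z) (snd z) powr p) * indicator {z} u) \<partial>\<gamma>)"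
      by (intro nn_integral_sum[symmetric] borel_measurable_times_ennreal borel_measurable_const borel_measurable_indicator pt)
         (rule subsetD[OF FG(2)])
    also have "\<dots> \<le> cost p \<gamma>"
      unfolding cost_def
    proof (rule nn_integral_mono)
      fix u
      have "(\<Sum>z\<in>F \<times> G. ennreal (d (fst z) (snd z) powr p) * indicator {z} u)
          = (\<Sum>z\<in>F \<times> G. if z = u then ennreal (d (fst z) (snd z) powr p) else 0)"
        by (intro sum.cong) (auto simp: indicator_def)
      also have "\<dots> \<le> ennreal (d (fst u) (snd u) powr p)"
        using FG(1) by (simp add: sum.delta)
      finally show "(\<Sum>z\<in>F \<times> G. ennreal (d (fst z) (snd z) powr p) * indicator {z} u) \<le> ennreal (d (fst u) (snd u) powr p)" .
    qed
    also have "\<dots> \<le> ennreal (a powr p)" by (rule g)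
    finally show ?thesis by simp
  qed
  finally have "dB (bary \<mu>) (bary \<nu>) powr p \<le> a powr p" .
  then have "dB (bary \<mu>) (bary \<nu>) \<le> a"
    using powr_less_mono2[of p a "dB (bary \<mu>) (bary \<nu>)"] order a by linarith
  then show "dB (bary \<mu>) (bary \<nu>) \<le> W \<mu> \<nu> + e" by (simp add: a_def)
qed

text \<open>A description free of approximating sequences: by density of \<open>Fin\<close> the
  inequality pins \<open>b\<close> down, and it is exactly the estimate that later proofs consume.
  \<open>restrict\<close> makes the map extensional.\<close>

definition extend :: "'a measure \<Rightarrow> 'b" where
  "extend = restrict (\<lambda>\<mu>. SOME b. b \<in> B \<and> (\<forall>\<nu>\<in>Fin. dB (bary \<nu>) b \<le> W \<nu> \<mu>)) P"

text \<open>Along finitely supported measures converging to \<open>\<mu>\<close> the barycentres are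
  Cauchy, since \<open>bary\<close> is nonexpansive. Their limit satisfies the inequality because it
  holds up to a vanishing error at each approximant.\<close>

lemma extend:
  assumes \<mu>: "\<mu> \<in> P"
  shows "extend \<mu> \<in> B" "\<And>\<nu>. \<nu> \<in> Fin \<Longrightarrow> dB (bary \<nu>) (extend \<mu>) \<le> W \<nu> \<mu>"
proof -
  interpret W: Metric_space P W by (rule Metric_space_W)
  have "\<forall>n. \<exists>\<nu>\<in>Fin. W \<nu> \<mu> < 1 / real (Suc n)" by (intro allI Fin_dense \<mu>) simp
  then obtain \<nu> where \<nu>: "\<And>n. \<nu> n \<in> Fin" "\<And>n. W (\<nu> n) \<mu> < 1 / real (Suc n)" by metis
  have \<nu>P: "\<nu> n \<in> P" for n by (rule Fin_in_P[OF \<nu>(1)])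
  have "T.MCauchy (\<lambda>n. bary (\<nu> n))"
    unfolding T.MCauchy_def
  proof (intro conjI allI impI)
    show "range (\<lambda>n. bary (\<nu> n)) \<subseteq> B" using bary_in \<nu>(1) by blast
    fix e :: real assume "e > 0"
    then obtain N where N: "1 / real (Suc N) < e / 2" using nat_approx_posE[of "e/2"] by auto
    have "dB (bary (\<nu> n)) (bary (\<nu> m)) < e" if "N \<le> n" "N \<le> m" for n m
    proof -
      have "W (\<nu> k) \<mu> < e / 2" if "N \<le> k" for k
      proof -
        have "1 / real (Suc k) \<le> 1 / real (Suc N)" using that by (intro divide_left_mono) auto
        then show ?thesis using \<nu>(2)[of k] N by linarith
      qed
      then have "W (\<nu> n) \<mu> < e / 2" "W (\<nu> m) \<mu> < e / 2" using that by auto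
      then show ?thesis
        using bary_nonexpansive[OF \<nu>(1)[of n] \<nu>(1)[of m]] W.triangle'[OF \<nu>P \<mu> \<nu>P, of n m] by linarith
    qed
    then show "\<exists>N. \<forall>n m. N \<le> n \<longrightarrow> N \<le> m \<longrightarrow> dB (bary (\<nu> n)) (bary (\<nu> m)) < e" by blast
  qed
  then obtain b where b: "limitin T.mtopology (\<lambda>n. bary (\<nu> n)) b sequentially"
    using T.complete unfolding T.mcomplete_def by blast
  have bB: "b \<in> B" using T.limitin_mspace[OF b] .
  have "dB (bary \<rho>) b \<le> W \<rho> \<mu>" if \<rho>: "\<rho> \<in> Fin" for \<rho>
  proof (rule field_le_epsilon)
    fix e :: real assume "e > 0"
    then have "0 < e / 2" by simp
    then obtain N1 where N1: "\<And>n. n \<ge> N1 \<Longrightarrow> dB (bary (\<nu> n)) b < e / 2"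
      using b unfolding T.limit_metric_sequentially by meson
    obtain N2 where N2: "1 / real (Suc N2) < e / 2" using nat_approx_posE[OF \<open>0 < e / 2\<close>] by blast
    define n where "n = max N1 N2"
    have "1 / real (Suc n) \<le> 1 / real (Suc N2)" unfolding n_def by (intro divide_left_mono) auto
    then have "W (\<nu> n) \<mu> < e / 2" using \<nu>(2)[of n] N2 by linarith
    moreover have "dB (bary (\<nu> n)) b < e / 2" using N1 by (simp add: n_def)
    moreover have "dB (bary \<rho>) b \<le> dB (bary \<rho>) (bary (\<nu> n)) + dB (bary (\<nu> n)) b"
      by (intro T.triangle bary_in \<rho> \<nu> bB)
    moreover have "W \<rho> (\<nu> n) \<le> W \<rho> \<mu> + W (\<nu> n) \<mu>"
      by (intro W.triangle' Fin_in_P[OF \<rho>] \<nu>P \<mu>)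
    ultimately show "dB (bary \<rho>) b \<le> W \<rho> \<mu> + e"
      using bary_nonexpansive[OF \<rho> \<nu>(1)[of n]] by linarith
  qed
  then have "b \<in> B \<and> (\<forall>\<nu>\<in>Fin. dB (bary \<nu>) b \<le> W \<nu> \<mu>)" using bB by blast
  from someI[of "\<lambda>b. b \<in> B \<and> (\<forall>\<nu>\<in>Fin. dB (bary \<nu>) b \<le> W \<nu> \<mu>)", OF this] \<mu>
  show "extend \<mu> \<in> B" "\<And>\<nu>. \<nu> \<in> Fin \<Longrightarrow> dB (bary \<nu>) (extend \<mu>) \<le> W \<nu> \<mu>"
    by (simp_all add: extend_def)
qed

lemma extend_dirac:
  assumes "x \<in> M"
  shows "extend (dirac x) = f x"
proof -
  have "dB (bary (dirac x)) (extend (dirac x)) \<le> 0"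
    using extend(2)[OF dirac_in_P[OF assms] dirac_in_Fin[OF assms]] W_self[OF dirac_in_P[OF assms]] by simp
  then have "dB (bary (dirac x)) (extend (dirac x)) = 0"
    using T.nonneg by (intro antisym)
  then show ?thesis
    using T.zero extend(1)[OF dirac_in_P[OF assms]] bary_dirac f_in assms by metis
qed

lemma extend_nonexpansive: "nonexpansive_map P W B dB extend"
  unfolding nonexpansive_map_def
proof (intro conjI ballI Pi_I extend(1))
  interpret W: Metric_space P W by (rule Metric_space_W)
  fix \<mu> \<nu> assume \<mu>: "\<mu> \<in> P" and \<nu>: "\<nu> \<in> P"
  show "dB (extend \<mu>) (extend \<nu>) \<le> W \<mu> \<nu>"
  proof (rule field_le_epsilon)
    fix e :: real assume "e > 0"
    then obtain \<rho> where \<rho>: "\<rho> \<in> Fin" "W \<rho> \<mu> < e / 2" using Fin_dense[OF \<mu>, of "e/2"] by auto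
    have "dB (extend \<mu>) (extend \<nu>) \<le> dB (bary \<rho>) (extend \<mu>) + dB (bary \<rho>) (extend \<nu>)"
      by (intro T.triangle'' bary_in extend \<mu> \<nu> \<rho>)
    moreover have "W \<rho> \<nu> \<le> W \<rho> \<mu> + W \<mu> \<nu>"
      by (intro W.triangle Fin_in_P[OF \<rho>(1)] \<mu> \<nu>)
    ultimately show "dB (extend \<mu>) (extend \<nu>) \<le> W \<mu> \<nu> + e"
      using extend(2)[OF \<mu> \<rho>(1)] extend(2)[OF \<nu> \<rho>(1)] \<rho>(2) by linarith
  qed
qed

text \<open>Both sides lie within e/2 of the barycentre of a mixture of finitely supported
  approximants: one side because mixing measures is nonexpansive, the other because mixing in
  \<open>B\<close> is, with \<open>bary_mix\<close> joining the two.\<close>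

lemma extend_affine: "affine_map_on P mix_measure mixB extend"
  unfolding affine_map_on_def
proof (intro ballI)
  interpret WA: Wasserstein_algebra p P W mix_measure by (rule Wasserstein_algebra_P)
  fix r :: real and \<mu> \<nu> assume r: "r \<in> {0..1}" and \<mu>: "\<mu> \<in> P" and \<nu>: "\<nu> \<in> P"
  let ?m = "mix_measure r \<mu> \<nu>"
  have r': "0 \<le> r" "r \<le> 1" using r by auto
  have m: "?m \<in> P" by (intro mix_in_P \<mu> \<nu> r')
  have mB: "mixB r (extend \<mu>) (extend \<nu>) \<in> B" by (intro T.mix_closed extend \<mu> \<nu> r')
  have "dB (extend ?m) (mixB r (extend \<mu>) (extend \<nu>)) \<le> 0 + e" if "e > 0" for e
  proof -
    obtain \<rho> where \<rho>: "\<rho> \<in> Fin" "W \<rho> \<mu> < e / 2" using Fin_dense[OF \<mu>, of "e/2"] \<open>e > 0\<close> by auto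
    obtain \<tau> where \<tau>: "\<tau> \<in> Fin" "W \<tau> \<nu> < e / 2" using Fin_dense[OF \<nu>, of "e/2"] \<open>e > 0\<close> by auto
    let ?k = "mix_measure r \<rho> \<tau>"
    have k: "?k \<in> Fin" by (intro mix_in_Fin \<rho> \<tau> r')
    have "W ?k ?m \<le> max (W \<rho> \<mu>) (W \<tau> \<nu>)"
      by (intro WA.mix_nonexpansive r' Fin_in_P[OF \<rho>(1)] Fin_in_P[OF \<tau>(1)] \<mu> \<nu>)
    then have 1: "dB (bary ?k) (extend ?m) \<le> e / 2" using extend(2)[OF m k] \<rho>(2) \<tau>(2) by linarith
    have "dB (mixB r (bary \<rho>) (bary \<tau>)) (mixB r (extend \<mu>) (extend \<nu>)) \<le> max (dB (bary \<rho>) (extend \<mu>)) (dB (bary \<tau>) (extend \<nu>))"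
      by (intro T.mix_nonexpansive r' bary_in \<rho> \<tau> extend \<mu> \<nu>)
    then have 2: "dB (bary ?k) (mixB r (extend \<mu>) (extend \<nu>)) \<le> e / 2"
      unfolding bary_mix[OF \<rho>(1) \<tau>(1) r'] using extend(2)[OF \<mu> \<rho>(1)] extend(2)[OF \<nu> \<tau>(1)] \<rho>(2) \<tau>(2) by linarith
    have "dB (extend ?m) (mixB r (extend \<mu>) (extend \<nu>)) \<le> dB (bary ?k) (extend ?m) + dB (bary ?k) (mixB r (extend \<mu>) (extend \<nu>))"
      by (intro T.triangle'' bary_in k extend(1) m mB)
    then show ?thesis using 1 2 by linarith
  qed
  then have "dB (extend ?m) (mixB r (extend \<mu>) (extend \<nu>)) \<le> 0" by (rule field_le_epsilon)
  then have "dB (extend ?m) (mixB r (extend \<mu>) (extend \<nu>)) = 0" using T.nonneg by (intro antisym)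
  then show "extend ?m = mixB r (extend \<mu>) (extend \<nu>)" using T.zero extend(1)[OF m] mB by blast
qed

lemma nonexpansive_affine_unique:
  assumes g: "nonexpansive_map P W B dB g" "affine_map_on P mix_measure mixB g"
    and h: "nonexpansive_map P W B dB h" "affine_map_on P mix_measure mixB h"
    and eq: "\<And>x. x \<in> M \<Longrightarrow> g (dirac x) = h (dirac x)" and \<mu>: "\<mu> \<in> P"
  shows "g \<mu> = h \<mu>"
proof -
  have in_B: "g \<nu> \<in> B" "h \<nu> \<in> B" if "\<nu> \<in> P" for \<nu>
    using g(1) h(1) that by (auto simp: nonexpansive_map_def)
  have le: "dB (g \<nu>) (g \<rho>) \<le> W \<nu> \<rho>" "dB (h \<nu>) (h \<rho>) \<le> W \<nu> \<rho>" if "\<nu> \<in> P" "\<rho> \<in> P" for \<nu> \<rho>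
    using g(1) h(1) that by (auto simp: nonexpansive_map_def)
  have "dB (g \<mu>) (h \<mu>) \<le> 0 + e" if "e > 0" for e
  proof -
    obtain \<nu> where \<nu>: "\<nu> \<in> Fin" "W \<nu> \<mu> < e / 2" using Fin_dense[OF \<mu>, of "e/2"] \<open>e > 0\<close> by auto
    have \<nu>P: "\<nu> \<in> P" by (rule Fin_in_P[OF \<nu>(1)])
    have "g \<nu> = h \<nu>" by (rule affine_eq_on_Fin[OF g(2) h(2) eq \<nu>(1)])
    moreover have "dB (g \<mu>) (h \<mu>) \<le> dB (g \<nu>) (g \<mu>) + dB (g \<nu>) (h \<mu>)"
      by (intro T.triangle'' in_B \<nu>P \<mu>)
    ultimately show ?thesis using le[OF \<nu>P \<mu>] \<nu>(2) by simp
  qed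
  then have "dB (g \<mu>) (h \<mu>) \<le> 0" by (rule field_le_epsilon)
  then have "dB (g \<mu>) (h \<mu>) = 0" using T.nonneg by (intro antisym)
  then show ?thesis using T.zero in_B[OF \<mu>] by blast
qed

text \<open>The condition \<open>extensional P\<close> fixes the values off the measure space, so
  that uniqueness of a map on that space becomes uniqueness of a total function.\<close>

lemma universal:
  "\<exists>!g. g \<in> extensional P \<and> nonexpansive_map P W B dB g \<and> affine_map_on P mix_measure mixB g \<and>
    (\<forall>x\<in>M. g (dirac x) = f x)"
proof (intro ex1I conjI ballI)
  show "extend \<in> extensional P" by (simp add: extend_def)
  show "nonexpansive_map P W B dB extend" by (rule extend_nonexpansive)
  show "affine_map_on P mix_measure mixB extend" by (rule extend_affine)
  show "extend (dirac x) = f x" if "x \<in> M" for x by (rule extend_dirac[OF that])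
  fix g assume "g \<in> extensional P \<and> nonexpansive_map P W B dB g \<and> affine_map_on P mix_measure mixB g \<and>
    (\<forall>x\<in>M. g (dirac x) = f x)"
  then have g: "g \<in> extensional P" "nonexpansive_map P W B dB g" "affine_map_on P mix_measure mixB g"
      "\<And>x. x \<in> M \<Longrightarrow> g (dirac x) = f x" by blast+
  show "g = extend"
  proof (rule extensionalityI[OF g(1)])
    show "extend \<in> extensional P" by (simp add: extend_def)
    show "g \<mu> = extend \<mu>" if "\<mu> \<in> P" for \<mu>
      by (rule nonexpansive_affine_unique[OF g(2,3) extend_nonexpansive extend_affine _ that])
         (simp only: g(4) extend_dirac)
  qed
qed

end

theorem theorem3p6:
  fixes M :: "'a set" and d :: "'a \<Rightarrow> 'a \<Rightarrow> real" and p :: real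
  assumes "Metric_space M d"
    and "Metric_space.mcomplete M d"
    and "1 \<le> p"
  shows
    "complete_Wasserstein_algebra p
       (Metric_space.Wasserstein_space M d p) (Metric_space.Wasserstein_dist M d p) mix_measure \<and>
     nonexpansive_map M d
       (Metric_space.Wasserstein_space M d p) (Metric_space.Wasserstein_dist M d p)
       (Metric_space.dirac M d) \<and>
     (\<forall>(B :: 'b set) dB mixB f.
        complete_Wasserstein_algebra p B dB mixB \<longrightarrow> nonexpansive_map M d B dB f \<longrightarrow>
        (\<exists>!g. g \<in> extensional (Metric_space.Wasserstein_space M d p) \<and>
              nonexpansive_map
                (Metric_space.Wasserstein_space M d p) (Metric_space.Wasserstein_dist M d p) B dB g \<and>
              affine_map_on (Metric_space.Wasserstein_space M d p) mix_measure mixB g \<and>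
              (\<forall>x\<in>M. g (Metric_space.dirac M d x) = f x)))"
proof -
  interpret complete_metric_order M d p
    using assms by (simp add: complete_metric_order_def complete_metric_order_axioms_def)
  show ?thesis
  proof (intro conjI allI impI complete_Wasserstein_algebra_P dirac_nonexpansive)
    fix B :: "'b set" and dB mixB f
    assume "complete_Wasserstein_algebra p B dB mixB" and "nonexpansive_map M d B dB f"
    then interpret Wasserstein_extension M d p B dB mixB f
      by (intro Wasserstein_extension.intro Wasserstein_extension_axioms.intro complete_metric_order_axioms)
    show "\<exists>!g. g \<in> extensional P \<and> nonexpansive_map P W B dB g \<and>
        affine_map_on P mix_measure mixB g \<and> (\<forall>x\<in>M. g (dirac x) = f x)"
      by (rule universal)
  qed
qed

end
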